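(* Let $(G,P)$ be a weak quasi-lattice ordered group with $P$ Noetherian, and let $P_{\inf}$ be the minimal set of $P$. Let $\{X_p\}_{p\in P}$ be a compactly aligned product system of essential $C^*$-correspondences over $P$ with $X_e=A$, let $N:P\to(0,\infty)$ be a homomorphism and let $\beta\in\mathbb{R}$. Then a tracial state $\tau$ on $A$ satisfies $$\tau(a)+\sum_{\emptyset\neq K\subset J}(-1)^{|K|}N(\vee K)^{-\beta}\,\mathrm{Tr}_\tau^{\vee K}(a)\ \geq\ 0\quad\text{for all finite } J\subset P\setminus\{e\}\text{ and all } a\in A_+$$ if and only if $$\tau(a)+\sum_{\emptyset\neq K\subset J}(-1)^{|K|}N(\vee K)^{-\beta}\,\mathrm{Tr}_\tau^{\vee K}(a)\ \geq\ 0\quad\text{for all finite } J\subset P_{\inf}\text{ and all } a\in A_+,$$ where the terms corresponding to $\vee K=\infty$ are set to zero.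
   Context: Monoids. A weak quasi-lattice ordered group $(G,P)$ is a discrete group $G$ with a submonoid $P$ such that $P\cap P^{-1}=\{e\}$ and, whenever $p,q\in P$ satisfy $pP\cap qP\ne\emptyset$, there is a (unique) $p\vee q\in P$ with $pP\cap qP=(p\vee q)P$. Write $p\le q$ if $q\in pP$. For finite nonempty $K\subset P$, $\vee K\in P$ is the element with $\bigcap_{k\in K}kP=(\vee K)P$ if this intersection is nonempty, and $\vee K=\infty$ otherwise. $P$ is Noetherian if there is no infinite descending sequence for the proper factor relation ($p$ is a proper factor of $q$ if $q=xpy$ with $x,y\in P$ not both equal to $e$). An atom is $s\in P\setminus\{e\}$ that is not a product of two elements of $P\setminus\{e\}$; $P_a$ is the set of atoms. The minimal set $P_{\inf}$ is $\bigcup_{n\ge1}P_n$, where $P_1=P_a$ and, for $n\ge2$, $P_n=\{x^{-1}(x\vee p): x\in P_a,\ p\in P_{n-1},\ x\vee p<\infty\}$; equivalently, $P_{\inf}$ is the smallest subset of $P$ containing $P_a$ and closed under $p\mapsto x^{-1}(x\vee p)$ for $x\in P_a$ with $x\vee p<\infty$. Product systems. A $C^*$-correspondence over a $C^*$-algebra $A$ is a right Hilbert $A$-module $X$ with a left action $\varphi:A\to\mathcal{L}(X)$; it is essential if $\overline{\varphi(A)X}=X$. A product system over $P$ is a family $(X_p)_{p\in P}$ of $C^*$-correspondences over $A$ with a monoid structure on $\bigcup_pX_p$ such that $\xi\zeta\in X_{pq}$ for $\xi\in X_p,\zeta\in X_q$, the map $\xi\otimes\zeta\mapsto\xi\zeta$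 extends to an isometric isomorphism $X_p\otimes_AX_q\simeq X_{pq}$ for all $p,q\in P$ with $p\ne e$, $X_e={}_AA_A$, and multiplication by $X_e$ gives the bimodule structure. For $p\le r$ let $\iota_p^r:\mathcal{L}(X_p)\to\mathcal{L}(X_r)$ be $S\mapsto S\otimes I_{p^{-1}r}$ under $X_r\simeq X_p\otimes_AX_{p^{-1}r}$. $X$ is compactly aligned if $\iota^r_p(\mathcal{K}(X_p))\iota^r_q(\mathcal{K}(X_q))\subset\mathcal{K}(X_r)$ whenever $pP\cap qP=rP$. Induced traces. For a finite positive trace $\tau$ on $A$ and a $C^*$-correspondence $Y$, $\mathrm{Tr}^Y_\tau(T)=\sup_H\sum_{\xi\in H}\tau(\langle\xi,T\xi\rangle)$ for $T\in\mathcal{L}(Y)_+$, the supremum over finite $H\subset Y$ with $\sum_{\xi\in H}\theta_{\xi,\xi}\le1$, where $\theta_{\xi,\zeta}\eta=\xi\langle\zeta,\eta\rangle$. $\mathrm{Tr}^p_\tau(a)$ means $\mathrm{Tr}^{X_p}_\tau(\varphi_p(a))$ for $a\in A_+$, a possibly infinite trace on $A$; the inequality for $J=\{q\}$ forces $\mathrm{Tr}^q_\tau(a)<\infty$. *)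

theory Defs
  imports "HOL-Analysis.Analysis" "HOL-Algebra.Coset"
begin

section \<open>C*-algebras and tracial states\<close>

class complex_vector = real_vector +
  fixes scaleC :: "complex \<Rightarrow> 'a \<Rightarrow> 'a" (infixr \<open>*\<^sub>C\<close> 75)
  assumes scaleC_add_right: "c *\<^sub>C (x + y) = c *\<^sub>C x + c *\<^sub>C y"
    and scaleC_add_left: "(c + d) *\<^sub>C x = c *\<^sub>C x + d *\<^sub>C x"
    and scaleC_scaleC: "c *\<^sub>C d *\<^sub>C x = (c * d) *\<^sub>C x"
    and scaleC_one: "1 *\<^sub>C x = x"
    and scaleR_scaleC: "r *\<^sub>R x = complex_of_real r *\<^sub>C x"

global_interpretation complex_vector: vector_space "scaleC :: complex \<Rightarrow> 'a \<Rightarrow> 'a::complex_vector"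
  by unfold_locales (simp_all add: scaleC_add_right scaleC_add_left scaleC_scaleC scaleC_one)

text \<open>No unit is assumed.\<close>

class cstar_algebra = complex_vector + real_normed_algebra + banach +
  fixes star :: "'a \<Rightarrow> 'a"
  assumes mult_scaleC_left: "(c *\<^sub>C x) * y = c *\<^sub>C (x * y)"
    and mult_scaleC_right: "x * (c *\<^sub>C y) = c *\<^sub>C (x * y)"
    and norm_scaleC: "norm (c *\<^sub>C x) = cmod c * norm x"
    and star_add: "star (x + y) = star x + star y"
    and star_scaleC: "star (c *\<^sub>C x) = cnj c *\<^sub>C star x"
    and star_mult: "star (x * y) = star y * star x"
    and star_star: "star (star x) = x"
    and norm_star_mult: "norm (star x * x) = (norm x)\<^sup>2"

definition pos_element :: "'a::cstar_algebra \<Rightarrow> bool" where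
  "pos_element a \<longleftrightarrow> (\<exists>b. a = star b * b)"

definition tracial_state :: "('a::cstar_algebra \<Rightarrow> complex) \<Rightarrow> bool" where
  "tracial_state \<tau> \<longleftrightarrow>
     bounded_linear \<tau> \<and> (\<forall>c a. \<tau> (c *\<^sub>C a) = c * \<tau> a) \<and>
     (\<forall>a. pos_element a \<longrightarrow> \<tau> a \<in> \<real> \<and> 0 \<le> Re (\<tau> a)) \<and>
     onorm \<tau> = 1 \<and>
     (\<forall>a b. \<tau> (a * b) = \<tau> (b * a))"

section \<open>Hilbert modules and C*-correspondences\<close>

text \<open>
  The fibres of a product system are modules over one algebra with different underlying sets.
  They are represented as complex subspaces \<open>elems Y\<close> of one ambient vector space; this is no
  restriction, since an arbitrary family of complex vector spaces embeds in its direct sum. The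
  inner product, the two actions and hence the norm belong to the individual module, and are only
  ever evaluated on \<open>elems Y\<close>.
\<close>

record ('a, 'x) corr =
  elems :: "'x set"
  ip :: "'x \<Rightarrow> 'x \<Rightarrow> 'a"
  ract :: "'x \<Rightarrow> 'a \<Rightarrow> 'x"
  lact :: "'a \<Rightarrow> 'x \<Rightarrow> 'x"

definition hnorm :: "('a::cstar_algebra, 'x) corr \<Rightarrow> 'x \<Rightarrow> real" where
  "hnorm Y \<xi> = sqrt (norm (ip Y \<xi> \<xi>))"

locale hilbert_module =
  fixes Y :: "('a::cstar_algebra, 'x::complex_vector) corr"
  assumes subspace: "complex_vector.subspace (elems Y)"
    and ract_closed: "\<xi> \<in> elems Y \<Longrightarrow> ract Y \<xi> a \<in> elems Y"
    and ract_add_left: "\<xi> \<in> elems Y \<Longrightarrow> \<zeta> \<in> elems Y \<Longrightarrow> ract Y (\<xi> + \<zeta>) a = ract Y \<xi> a + ract Y \<zeta> a"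
    and ract_add_right: "\<xi> \<in> elems Y \<Longrightarrow> ract Y \<xi> (a + b) = ract Y \<xi> a + ract Y \<xi> b"
    and ract_scaleC_left: "\<xi> \<in> elems Y \<Longrightarrow> ract Y (c *\<^sub>C \<xi>) a = c *\<^sub>C ract Y \<xi> a"
    and ract_scaleC_right: "\<xi> \<in> elems Y \<Longrightarrow> ract Y \<xi> (c *\<^sub>C a) = c *\<^sub>C ract Y \<xi> a"
    and ract_mult: "\<xi> \<in> elems Y \<Longrightarrow> ract Y \<xi> (a * b) = ract Y (ract Y \<xi> a) b"
    and ip_add: "\<xi> \<in> elems Y \<Longrightarrow> \<zeta> \<in> elems Y \<Longrightarrow> \<eta> \<in> elems Y \<Longrightarrow>
                   ip Y \<xi> (\<zeta> + \<eta>) = ip Y \<xi> \<zeta> + ip Y \<xi> \<eta>"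
    and ip_scaleC: "\<xi> \<in> elems Y \<Longrightarrow> \<zeta> \<in> elems Y \<Longrightarrow> ip Y \<xi> (c *\<^sub>C \<zeta>) = c *\<^sub>C ip Y \<xi> \<zeta>"
    and ip_ract: "\<xi> \<in> elems Y \<Longrightarrow> \<zeta> \<in> elems Y \<Longrightarrow> ip Y \<xi> (ract Y \<zeta> a) = ip Y \<xi> \<zeta> * a"
    and ip_star: "\<xi> \<in> elems Y \<Longrightarrow> \<zeta> \<in> elems Y \<Longrightarrow> star (ip Y \<xi> \<zeta>) = ip Y \<zeta> \<xi>"
    and ip_pos: "\<xi> \<in> elems Y \<Longrightarrow> pos_element (ip Y \<xi> \<xi>)"
    and ip_definite: "\<xi> \<in> elems Y \<Longrightarrow> ip Y \<xi> \<xi> = 0 \<Longrightarrow> \<xi> = 0"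
    and complete: "(\<And>n. u n \<in> elems Y) \<Longrightarrow>
                   (\<And>e. e > 0 \<Longrightarrow> \<exists>n0. \<forall>m\<ge>n0. \<forall>n\<ge>n0. hnorm Y (u m - u n) < e) \<Longrightarrow>
                   \<exists>\<xi>\<in>elems Y. (\<lambda>n. hnorm Y (u n - \<xi>)) \<longlonglongrightarrow> 0"

text \<open>
  Operators on \<open>Y\<close> are extensional functions on \<open>elems Y\<close>, so that equality of operators is
  equality in HOL. Linearity and boundedness of adjointable maps are automatic.
\<close>

definition adjointable :: "('a::cstar_algebra, 'x) corr \<Rightarrow> ('x \<Rightarrow> 'x) set" where
  "adjointable Y = {T \<in> elems Y \<rightarrow>\<^sub>E elems Y.
     \<exists>S \<in> elems Y \<rightarrow>\<^sub>E elems Y. \<forall>\<xi>\<in>elems Y. \<forall>\<zeta>\<in>elems Y. ip Y (T \<xi>) \<zeta> = ip Y \<xi> (S \<zeta>)}"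

definition adj_op :: "('a::cstar_algebra, 'x) corr \<Rightarrow> ('x \<Rightarrow> 'x) \<Rightarrow> ('x \<Rightarrow> 'x)" where
  "adj_op Y T = (THE S. S \<in> elems Y \<rightarrow>\<^sub>E elems Y \<and>
     (\<forall>\<xi>\<in>elems Y. \<forall>\<zeta>\<in>elems Y. ip Y (T \<xi>) \<zeta> = ip Y \<xi> (S \<zeta>)))"

definition pos_op :: "('a::cstar_algebra, 'x) corr \<Rightarrow> ('x \<Rightarrow> 'x) \<Rightarrow> bool" where
  "pos_op Y T \<longleftrightarrow> (\<exists>S\<in>adjointable Y. T = compose (elems Y) (adj_op Y S) S)"

definition op_le :: "('a::cstar_algebra, 'x::ab_group_add) corr \<Rightarrow> ('x \<Rightarrow> 'x) \<Rightarrow> ('x \<Rightarrow> 'x) \<Rightarrow> bool" where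
  "op_le Y S T \<longleftrightarrow> pos_op Y (\<lambda>\<eta>\<in>elems Y. T \<eta> - S \<eta>)"

definition id_op :: "('a, 'x) corr \<Rightarrow> 'x \<Rightarrow> 'x" where
  "id_op Y = (\<lambda>\<eta>\<in>elems Y. \<eta>)"

definition theta :: "('a, 'x) corr \<Rightarrow> 'x \<Rightarrow> 'x \<Rightarrow> 'x \<Rightarrow> 'x" where
  "theta Y \<xi> \<zeta> = (\<lambda>\<eta>\<in>elems Y. ract Y \<xi> (ip Y \<zeta> \<eta>))"

text \<open>
  Scalars can be absorbed into \<open>\<xi>\<close>, so finite sums of the \<open>theta Y \<xi> \<zeta>\<close> are their linear span.
\<close>

definition finite_rank :: "('a, 'x::ab_group_add) corr \<Rightarrow> ('x \<Rightarrow> 'x) set" where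
  "finite_rank Y = {\<lambda>\<eta>\<in>elems Y. \<Sum>(\<xi>, \<zeta>)\<leftarrow>s. theta Y \<xi> \<zeta> \<eta> | s. s \<in> lists (elems Y \<times> elems Y)}"

definition compact_ops :: "('a::cstar_algebra, 'x::ab_group_add) corr \<Rightarrow> ('x \<Rightarrow> 'x) set" where
  "compact_ops Y = {T \<in> adjointable Y.
     \<forall>e>0. \<exists>F\<in>finite_rank Y. \<forall>\<eta>\<in>elems Y. hnorm Y (T \<eta> - F \<eta>) \<le> e * hnorm Y \<eta>}"

definition left_op :: "('a, 'x) corr \<Rightarrow> 'a \<Rightarrow> 'x \<Rightarrow> 'x" where
  "left_op Y a = (\<lambda>\<eta>\<in>elems Y. lact Y a \<eta>)"

text \<open>\<open>left_op Y\<close> is a \<open>*\<close>-homomorphism from the algebra to \<open>adjointable Y\<close>.\<close>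

locale correspondence = hilbert_module Y
  for Y :: "('a::cstar_algebra, 'x::complex_vector) corr" +
  assumes left_op_adjointable: "left_op Y a \<in> adjointable Y"
    and lact_add: "\<xi> \<in> elems Y \<Longrightarrow> lact Y (a + b) \<xi> = lact Y a \<xi> + lact Y b \<xi>"
    and lact_scaleC: "\<xi> \<in> elems Y \<Longrightarrow> lact Y (c *\<^sub>C a) \<xi> = c *\<^sub>C lact Y a \<xi>"
    and lact_mult: "\<xi> \<in> elems Y \<Longrightarrow> lact Y (a * b) \<xi> = lact Y a (lact Y b \<xi>)"
    and left_op_star: "left_op Y (star a) = adj_op Y (left_op Y a)"

text \<open>\<open>\<phi>(A)Y\<close> is read, as usual, as a closed linear span.\<close>

locale essential_correspondence = correspondence Y
  for Y :: "('a::cstar_algebra, 'x::complex_vector) corr" +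
  assumes essential: "\<xi> \<in> elems Y \<Longrightarrow> e > 0 \<Longrightarrow>
    \<exists>\<zeta>\<in>complex_vector.span {lact Y a \<eta> | a \<eta>. \<eta> \<in> elems Y}. hnorm Y (\<xi> - \<zeta>) < e"

section \<open>Induced traces\<close>

definition tr_admissible :: "('a::cstar_algebra, 'x::ab_group_add) corr \<Rightarrow> 'x set \<Rightarrow> bool" where
  "tr_admissible Y H \<longleftrightarrow> finite H \<and> H \<subseteq> elems Y \<and>
     op_le Y (\<lambda>\<eta>\<in>elems Y. \<Sum>\<xi>\<in>H. theta Y \<xi> \<xi> \<eta>) (id_op Y)"

text \<open>Meant for positive \<open>T\<close>, where all summands are nonnegative reals.\<close>

definition Tr_op :: "('a::cstar_algebra \<Rightarrow> complex) \<Rightarrow> ('a, 'x::ab_group_add) corr \<Rightarrow> ('x \<Rightarrow> 'x) \<Rightarrow> ereal" where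
  "Tr_op \<tau> Y T = (SUP H \<in> Collect (tr_admissible Y). ereal (\<Sum>\<xi>\<in>H. Re (\<tau> (ip Y \<xi> (T \<xi>)))))"

definition Tr :: "('a::cstar_algebra \<Rightarrow> complex) \<Rightarrow> ('a, 'x::ab_group_add) corr \<Rightarrow> 'a \<Rightarrow> ereal" where
  "Tr \<tau> Y a = Tr_op \<tau> Y (left_op Y a)"

section \<open>Interior tensor products\<close>

text \<open>
  A finite sum of elementary tensors \<open>\<xi> \<otimes> \<zeta>\<close> is given by the list of the pairs \<open>(\<xi>, \<zeta>)\<close>. The
  interior tensor product of \<open>Y\<close> and \<open>Z\<close> over the algebra is the separated completion of the space
  of such sums with respect to
  \<open>\<langle>\<xi> \<otimes> \<zeta>, \<xi>' \<otimes> \<zeta>'\<rangle> = \<langle>\<zeta>, \<phi>(\<langle>\<xi>, \<xi>'\<rangle>)\<zeta>'\<rangle>\<close>.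
\<close>

definition tensor_ip ::
  "('a, 'x) corr \<Rightarrow> ('a, 'y) corr \<Rightarrow> ('x \<times> 'y) list \<Rightarrow> ('x \<times> 'y) list \<Rightarrow> 'a::cstar_algebra" where
  "tensor_ip Y Z s t = (\<Sum>(\<xi>, \<zeta>)\<leftarrow>s. \<Sum>(\<xi>', \<zeta>')\<leftarrow>t. ip Z \<zeta> (lact Z (ip Y \<xi> \<xi>') \<zeta>'))"

text \<open>
  The assignment \<open>\<xi> \<otimes> \<zeta> \<mapsto> m \<xi> \<zeta>\<close> extends to an isometric isomorphism of the completion onto the
  (complete) module \<open>W\<close>: on finite sums it preserves the inner products and has dense range.
\<close>

definition tensor_iso ::
  "('a::cstar_algebra, 'x) corr \<Rightarrow> ('a, 'y) corr \<Rightarrow> ('a, 'z::ab_group_add) corr \<Rightarrow> ('x \<Rightarrow> 'y \<Rightarrow> 'z) \<Rightarrow> bool" where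
  "tensor_iso Y Z W m \<longleftrightarrow>
     (\<forall>\<xi>\<in>elems Y. \<forall>\<zeta>\<in>elems Z. m \<xi> \<zeta> \<in> elems W) \<and>
     (\<forall>s\<in>lists (elems Y \<times> elems Z). \<forall>t\<in>lists (elems Y \<times> elems Z).
        ip W (\<Sum>(\<xi>, \<zeta>)\<leftarrow>s. m \<xi> \<zeta>) (\<Sum>(\<xi>, \<zeta>)\<leftarrow>t. m \<xi> \<zeta>) = tensor_ip Y Z s t) \<and>
     (\<forall>\<eta>\<in>elems W. \<forall>e>0. \<exists>s\<in>lists (elems Y \<times> elems Z). hnorm W (\<eta> - (\<Sum>(\<xi>, \<zeta>)\<leftarrow>s. m \<xi> \<zeta>)) < e)"

section \<open>Weak quasi-lattice ordered groups\<close>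

locale weak_quasi_lattice_ordered = group G + submonoid P G
  for G :: "('g, 'm) monoid_scheme" (structure) and P :: "'g set" +
  assumes P_inter_inv: "P \<inter> set_inv P = {\<one>}"
    and ex_join: "p \<in> P \<Longrightarrow> q \<in> P \<Longrightarrow> (p <# P) \<inter> (q <# P) \<noteq> {} \<Longrightarrow>
                  \<exists>r\<in>P. (p <# P) \<inter> (q <# P) = r <# P"

text \<open>\<open>\<Or>K\<close> for finite nonempty \<open>K \<subseteq> P\<close>; the value \<open>\<infinity>\<close> is \<^const>\<open>None\<close>.\<close>

definition vee :: "('g, 'm) monoid_scheme \<Rightarrow> 'g set \<Rightarrow> 'g set \<Rightarrow> 'g option" where
  "vee G P K =
     (if (\<Inter>k\<in>K. k <#\<^bsub>G\<^esub> P) = {} then None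
      else Some (THE r. r \<in> P \<and> (\<Inter>k\<in>K. k <#\<^bsub>G\<^esub> P) = r <#\<^bsub>G\<^esub> P))"

definition proper_factor :: "('g, 'm) monoid_scheme \<Rightarrow> 'g set \<Rightarrow> 'g \<Rightarrow> 'g \<Rightarrow> bool" where
  "proper_factor G P p q \<longleftrightarrow>
     (\<exists>x\<in>P. \<exists>y\<in>P. \<not> (x = \<one>\<^bsub>G\<^esub> \<and> y = \<one>\<^bsub>G\<^esub>) \<and> q = x \<otimes>\<^bsub>G\<^esub> p \<otimes>\<^bsub>G\<^esub> y)"

definition noetherian_monoid :: "('g, 'm) monoid_scheme \<Rightarrow> 'g set \<Rightarrow> bool" where
  "noetherian_monoid G P \<longleftrightarrow>
     \<not> (\<exists>u :: nat \<Rightarrow> 'g. \<forall>n. u n \<in> P \<and> proper_factor G P (u (Suc n)) (u n))"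

definition atoms :: "('g, 'm) monoid_scheme \<Rightarrow> 'g set \<Rightarrow> 'g set" where
  "atoms G P = {s \<in> P - {\<one>\<^bsub>G\<^esub>}. \<not> (\<exists>x\<in>P - {\<one>\<^bsub>G\<^esub>}. \<exists>y\<in>P - {\<one>\<^bsub>G\<^esub>}. s = x \<otimes>\<^bsub>G\<^esub> y)}"

text \<open>Numbered from \<open>0\<close>, i.e. \<open>minimal_level G P n\<close> is $P_{n+1}$.\<close>

primrec minimal_level :: "('g, 'm) monoid_scheme \<Rightarrow> 'g set \<Rightarrow> nat \<Rightarrow> 'g set" where
  "minimal_level G P 0 = atoms G P"
| "minimal_level G P (Suc n) =
     {inv\<^bsub>G\<^esub> x \<otimes>\<^bsub>G\<^esub> r | x p r. x \<in> atoms G P \<and> p \<in> minimal_level G P n \<and> vee G P {x, p} = Some r}"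

text \<open>
  The unit belongs to this set as soon as there is an atom: every atom \<open>x\<close> contributes \<open>inv x \<otimes> (x \<or> x)\<close>.
\<close>

definition minimal_set :: "('g, 'm) monoid_scheme \<Rightarrow> 'g set \<Rightarrow> 'g set" where
  "minimal_set G P = (\<Union>n. minimal_level G P n)"

section \<open>Product systems\<close>

text \<open>
  The multiplication of the disjoint union of the fibres is given by maps
  \<open>mul p q\<close> from \<open>X p \<times> X q\<close> to \<open>X (p \<otimes> q)\<close>, and \<open>j\<close> is the identification of the coefficient
  algebra, as a bimodule over itself, with the fibre at the unit. A unit element for the
  multiplication is not required, since it would have to be a unit of the algebra (and if the algebra
  has a unit, it is one automatically for essential fibres).
\<close>

locale product_system = submonoid P G
  for G :: "('g, 'm) monoid_scheme" (structure) and P :: "'g set"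
    and X :: "'g \<Rightarrow> ('a::cstar_algebra, 'x::complex_vector) corr"
    and mul :: "'g \<Rightarrow> 'g \<Rightarrow> 'x \<Rightarrow> 'x \<Rightarrow> 'x"
    and j :: "'a \<Rightarrow> 'x" +
  assumes fibre: "p \<in> P \<Longrightarrow> correspondence (X p)"
    and mul_closed: "p \<in> P \<Longrightarrow> q \<in> P \<Longrightarrow> \<xi> \<in> elems (X p) \<Longrightarrow> \<zeta> \<in> elems (X q) \<Longrightarrow>
                     mul p q \<xi> \<zeta> \<in> elems (X (p \<otimes> q))"
    and mul_assoc: "p \<in> P \<Longrightarrow> q \<in> P \<Longrightarrow> r \<in> P \<Longrightarrow>
                    \<xi> \<in> elems (X p) \<Longrightarrow> \<zeta> \<in> elems (X q) \<Longrightarrow> \<eta> \<in> elems (X r) \<Longrightarrow>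
                    mul (p \<otimes> q) r (mul p q \<xi> \<zeta>) \<eta> = mul p (q \<otimes> r) \<xi> (mul q r \<zeta> \<eta>)"
    and mul_tensor: "p \<in> P \<Longrightarrow> q \<in> P \<Longrightarrow> p \<noteq> \<one> \<Longrightarrow> tensor_iso (X p) (X q) (X (p \<otimes> q)) (mul p q)"
    and j_bij: "bij_betw j UNIV (elems (X \<one>))"
    and j_add: "j (a + b) = j a + j b"
    and j_scaleC: "j (c *\<^sub>C a) = c *\<^sub>C j a"
    and j_ip: "ip (X \<one>) (j a) (j b) = star a * b"
    and j_ract: "ract (X \<one>) (j a) b = j (a * b)"
    and j_lact: "lact (X \<one>) a (j b) = j (a * b)"
    and mul_left: "p \<in> P \<Longrightarrow> \<xi> \<in> elems (X p) \<Longrightarrow> mul \<one> p (j a) \<xi> = lact (X p) a \<xi>"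
    and mul_right: "p \<in> P \<Longrightarrow> \<xi> \<in> elems (X p) \<Longrightarrow> mul p \<one> \<xi> (j a) = ract (X p) \<xi> a"

text \<open>\<open>iota G X mul p r S\<close> is the operator \<open>S \<otimes> I\<close> on \<open>X r\<close>.\<close>

definition iota :: "('g, 'm) monoid_scheme \<Rightarrow> ('g \<Rightarrow> ('a::cstar_algebra, 'x) corr) \<Rightarrow>
    ('g \<Rightarrow> 'g \<Rightarrow> 'x \<Rightarrow> 'x \<Rightarrow> 'x) \<Rightarrow> 'g \<Rightarrow> 'g \<Rightarrow> ('x \<Rightarrow> 'x) \<Rightarrow> ('x \<Rightarrow> 'x)" where
  "iota G X mul p r S = (THE T. T \<in> adjointable (X r) \<and>
     (\<forall>\<xi>\<in>elems (X p). \<forall>\<zeta>\<in>elems (X (inv\<^bsub>G\<^esub> p \<otimes>\<^bsub>G\<^esub> r)).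
        T (mul p (inv\<^bsub>G\<^esub> p \<otimes>\<^bsub>G\<^esub> r) \<xi> \<zeta>) = mul p (inv\<^bsub>G\<^esub> p \<otimes>\<^bsub>G\<^esub> r) (S \<xi>) \<zeta>))"

definition compactly_aligned :: "('g, 'm) monoid_scheme \<Rightarrow> 'g set \<Rightarrow>
    ('g \<Rightarrow> ('a::cstar_algebra, 'x::ab_group_add) corr) \<Rightarrow> ('g \<Rightarrow> 'g \<Rightarrow> 'x \<Rightarrow> 'x \<Rightarrow> 'x) \<Rightarrow> bool" where
  "compactly_aligned G P X mul \<longleftrightarrow>
     (\<forall>p\<in>P. \<forall>q\<in>P. \<forall>r\<in>P. (p <#\<^bsub>G\<^esub> P) \<inter> (q <#\<^bsub>G\<^esub> P) = r <#\<^bsub>G\<^esub> P \<longrightarrow>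
        (\<forall>S\<in>compact_ops (X p). \<forall>T\<in>compact_ops (X q).
           compose (elems (X r)) (iota G X mul p r S) (iota G X mul q r T) \<in> compact_ops (X r)))"

section \<open>The alternating sums\<close>

text \<open>
  Extended real arithmetic sets \<open>\<infinity> - \<infinity> = \<infinity>\<close>. This is harmless in the conditions below, which range
  over all finite subsets \<open>J\<close> of some set: singletons \<open>J = {q}\<close> already force \<open>Tr \<tau> (X q) a\<close> to be finite.
\<close>

definition alternating_sum :: "('g, 'm) monoid_scheme \<Rightarrow> 'g set \<Rightarrow>
    ('g \<Rightarrow> ('a::cstar_algebra, 'x::ab_group_add) corr) \<Rightarrow> ('g \<Rightarrow> real) \<Rightarrow> real \<Rightarrow>
    ('a \<Rightarrow> complex) \<Rightarrow> 'g set \<Rightarrow> 'a \<Rightarrow> ereal" where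
  "alternating_sum G P X N \<beta> \<tau> J a =
     ereal (Re (\<tau> a)) +
     (\<Sum>K | K \<subseteq> J \<and> K \<noteq> {}.
        case vee G P K of
          None \<Rightarrow> 0
        | Some r \<Rightarrow> ereal ((-1) ^ card K * N r powr (- \<beta>)) * Tr \<tau> (X r) a)"

end

theory Submission
  imports Defs
begin

text \<open>
  Write $F_p\tau = N(p)^{-\beta}\,\mathrm{Tr}^p_\tau$ and
  $f_J = \sum_{K \subseteq J} (-1)^{|K|} F_{\vee K}\tau$, so that the claim is about positivity of the
  functionals $f_J$. Two facts carry the proof.

  First, induction is transitive, $F_{xp} = F_x F_p$, and $F_x$ preserves positivity of finite real
  linear combinations of traces. For $J = J_0 \cup \{xq\}$ inclusion-exclusion then gives
  $f_J = f_{J_0 \cup \{x\}} + F_x f_{L \cup \{q\}}$ with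
  $L = \{x^{-1}(x \vee k) : k \in J_0,\ x \vee k < \infty\}$: the terms of $f_J$ that contain $xq$
  differ from those of $f_{J_0 \cup \{x\}}$ that contain $x$ by a sum over upper bounds of $x$, and
  cancelling $x$ turns it into an alternating sum again (\<open>ideal_excl_mult\<close>).

  Second, by the Noetherian condition every element of $P$ is a product of elements of the minimal
  set, and passing from $p$ to $x^{-1}(x \vee p)$ does not increase the number of factors
  (\<open>factor_length_residual\<close>). Choosing $x$ in the minimal set, both summands above have smaller
  total length than $J$, and induction reduces positivity for all finite $J$ to positivity for $J$
  inside the minimal set (\<open>ideal_excl_nonneg\<close>). Conversely, the minimal set lies in $P$; only its
  element $e$ needs care, and a set $J$ that contains $e$ gives $\tau - \mathrm{Tr}^e_\tau$, because
  all other terms cancel in pairs.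

  The analysis is in the first fact. It rests on approximate units of Hilbert modules: if
  $k = \sum_\xi \theta_{\xi,\xi} \le 1$ and $S^2 = 1 - k$, then $\sum_{i<n} S^i k S^i = 1 - S^{2n}$ is again
  of the form $\sum_\zeta \theta_{\zeta,\zeta} \le 1$ and almost fixes every $\xi$ (\<open>approximate_unit\<close>).
  The trace property shows that any family that almost fixes suitable vectors computes the induced
  trace up to a small error (\<open>trace_sum_eventually\<close>); products of approximate units of two
  modules are such families for their tensor product. Hence
  $\mathrm{Tr}^{xr}_\tau(a) = \lim \sum_\xi \mathrm{Tr}^r_\tau(\langle\xi, a\xi\rangle)$ along an approximate
  unit of $X_x$ (\<open>sum_tr_le_Tr\<close>, \<open>less_Tr_eventually\<close>), which one and the same family
  realizes for finitely many $r$ at once; this is transitivity and positivity of $F_x$ together.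

  All of this needs the order of a C*-algebra without unit: that elements $b^*b$ form a closed cone
  on which the norm is monotone. It is derived from square roots of $1 - a$ in the unitization.
\<close>

section \<open>Elementary facts on C*-algebras\<close>

lemma scaleC_real: "complex_of_real r *\<^sub>C (x::'a::complex_vector) = r *\<^sub>R x"
  by (simp add: scaleR_scaleC)

lemma star_zero [simp]: "star (0::'a::cstar_algebra) = 0"
  using star_add[of "0::'a" 0] by simp

lemma star_minus: "star (- x) = - star (x::'a::cstar_algebra)"
  using star_add[of x "- x"] by (simp add: eq_neg_iff_add_eq_0 add.commute)

lemma star_diff: "star (x - y) = star x - star (y::'a::cstar_algebra)"
  using star_add[of x "- y"] by (simp add: star_minus)

lemma star_scaleR: "star (r *\<^sub>R x) = r *\<^sub>R star (x::'a::cstar_algebra)"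
  by (simp add: scaleR_scaleC star_scaleC)

lemma norm_star [simp]: "norm (star x) = norm (x::'a::cstar_algebra)"
proof -
  have le: "norm y \<le> norm (star y)" for y :: 'a
  proof (cases "y = 0")
    case False
    have "norm y * norm y = norm (star y * y)"
      by (simp add: norm_star_mult power2_eq_square)
    also have "\<dots> \<le> norm (star y) * norm y"
      by (rule norm_mult_ineq)
    finally show ?thesis
      using False by simp
  qed simp
  show ?thesis
    using le[of x] le[of "star x"] by (simp add: star_star)
qed

lemma norm_mult_star: "norm (x * star x) = (norm (x::'a::cstar_algebra))\<^sup>2"
  using norm_star_mult[of "star x"] by (simp add: star_star)

lemma norm_selfadjoint_square: "star x = x \<Longrightarrow> norm (x * x) = (norm (x::'a::cstar_algebra))\<^sup>2"
  using norm_star_mult[of x] by simp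

lemma star_mult_eq_zero: "star x * x = 0 \<Longrightarrow> (x::'a::cstar_algebra) = 0"
  using norm_star_mult[of x] by simp

lemma bounded_linear_star: "bounded_linear (star :: 'a \<Rightarrow> 'a::cstar_algebra)"
  by (rule bounded_linear_intro[where K = 1]) (simp_all add: star_add star_scaleR)

lemma bounded_linear_scaleC: "bounded_linear (\<lambda>x::'a::cstar_algebra. c *\<^sub>C x)"
  by (rule bounded_linear_intro[where K = "cmod c"])
     (simp_all add: scaleC_add_right scaleR_scaleC scaleC_scaleC norm_scaleC mult.commute)

section \<open>The unitization\<close>

datatype 'a unitization = Unitization (vec: 'a) (scal: complex)

definition act :: "'a unitization \<Rightarrow> 'a \<Rightarrow> 'a::cstar_algebra" where
  "act x b = vec x * b + scal x *\<^sub>C b"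

lemma bounded_linear_act: "bounded_linear (act x)"
  unfolding act_def
  by (intro bounded_linear_add bounded_linear_mult_right bounded_linear_scaleC)

instantiation unitization :: (cstar_algebra) complex_vector
begin

definition "0 = Unitization 0 0"
definition "x + y = Unitization (vec x + vec y) (scal x + scal y)"
definition "- x = Unitization (- vec x) (- scal x)"
definition "x - y = Unitization (vec x - vec y) (scal x - scal y)"
definition "r *\<^sub>R x = Unitization (r *\<^sub>R vec x) (r *\<^sub>R scal x)"
definition "c *\<^sub>C x = Unitization (c *\<^sub>C vec x) (c * scal x)"

instance
  by standard
     (auto simp: zero_unitization_def plus_unitization_def uminus_unitization_def
       minus_unitization_def scaleR_unitization_def scaleC_unitization_def
       algebra_simps scaleC_add_left scaleC_add_right scaleC_scaleC scaleC_one scaleC_real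
       scaleR_conv_of_real simp flip: scaleR_scaleC intro!: unitization.expand)

end

lemma vec_simps [simp]:
  "vec 0 = 0" "vec (x + y) = vec x + vec y" "vec (x - y) = vec x - vec y" "vec (- x) = - vec x"
  "vec (r *\<^sub>R x) = r *\<^sub>R vec x" "vec (c *\<^sub>C x) = c *\<^sub>C vec x"
  for x y :: "'a::cstar_algebra unitization"
  by (simp_all add: zero_unitization_def plus_unitization_def uminus_unitization_def
       minus_unitization_def scaleR_unitization_def scaleC_unitization_def)

lemma scal_simps [simp]:
  "scal 0 = 0" "scal (x + y) = scal x + scal y" "scal (x - y) = scal x - scal y"
  "scal (- x) = - scal x" "scal (r *\<^sub>R x) = r *\<^sub>R scal x" "scal (c *\<^sub>C x) = c * scal x"
  for x y :: "'a::cstar_algebra unitization"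
  by (simp_all add: zero_unitization_def plus_unitization_def uminus_unitization_def
       minus_unitization_def scaleR_unitization_def scaleC_unitization_def)

instantiation unitization :: (cstar_algebra) ring_1
begin

definition "1 = Unitization 0 1"
definition "x * y = Unitization (vec x * vec y + scal x *\<^sub>C vec y + scal y *\<^sub>C vec x) (scal x * scal y)"

instance
proof
  fix a b c :: "'a unitization"
  show "a * b * c = a * (b * c)"
    by (simp add: times_unitization_def algebra_simps scaleC_add_right scaleC_scaleC
        mult_scaleC_left mult_scaleC_right)
qed (auto simp: times_unitization_def one_unitization_def algebra_simps scaleC_add_left
       scaleC_add_right zero_unitization_def plus_unitization_def scaleC_one
       intro: unitization.expand)

end

lemma vec_one [simp]: "vec 1 = 0" and scal_one [simp]: "scal 1 = 1"
  and vec_mult [simp]: "vec (x * y) = vec x * vec y + scal x *\<^sub>C vec y + scal y *\<^sub>C vec x"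
  and scal_mult [simp]: "scal (x * y) = scal x * scal y"
  by (simp_all add: one_unitization_def times_unitization_def)

lemma act_simps:
  "act (x + y) b = act x b + act y b" "act (r *\<^sub>R x) b = r *\<^sub>R act x b"
  "act (x * y) b = act x (act y b)" "act 1 b = b" "act 0 b = 0" "act (c *\<^sub>C x) b = c *\<^sub>C act x b"
  by (simp_all add: act_def algebra_simps scaleC_add_left scaleC_add_right scaleC_scaleC
      mult_scaleC_left mult_scaleC_right scaleC_one scaleR_scaleC mult.commute)

text \<open>
  The maximum with the modulus of the scalar part makes this a norm also when the algebra already has
  a unit, in which case the unitization is the direct sum with the complex numbers.
\<close>

instantiation unitization :: (cstar_algebra) real_normed_algebra_1
begin

definition "norm x = max (cmod (scal x)) (onorm (act x))"
definition "dist x y = norm (x - y)" for x y :: "'a unitization"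
definition "sgn x = x /\<^sub>R norm x" for x :: "'a unitization"
definition [code del]:
  "(uniformity :: ('a unitization \<times> 'a unitization) filter) = (INF e\<in>{0<..}. principal {(x, y). dist x y < e})"
definition [code del]:
  "open (U :: 'a unitization set) \<longleftrightarrow> (\<forall>x\<in>U. eventually (\<lambda>(x', y). x' = x \<longrightarrow> y \<in> U) uniformity)"

instance
proof
  fix x y :: "'a unitization" and r :: real
  show "norm x = 0 \<longleftrightarrow> x = 0"
  proof
    assume "norm x = 0"
    then have s: "scal x = 0" and "onorm (act x) = 0"
      using onorm_pos_le[OF bounded_linear_act[of x]] norm_ge_zero[of "scal x"]
      unfolding norm_unitization_def by (simp_all add: max_def split: if_splits)
    then have "act x (star (vec x)) = 0"
      using onorm_eq_0[OF bounded_linear_act[of x]] by simp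
    then have "norm (vec x * star (vec x)) = 0"
      using s by (simp add: act_def)
    then show "x = 0"
      using s by (auto simp: norm_mult_star intro: unitization.expand)
  next
    have "act (0::'a unitization) = (\<lambda>b. 0)"
      by (rule ext) (simp add: act_simps)
    then show "norm x = 0" if "x = 0"
      using that by (simp add: norm_unitization_def onorm_zero)
  qed
  have "act (x + y) = (\<lambda>b. act x b + act y b)"
    by (rule ext) (simp add: act_simps)
  then have "onorm (act (x + y)) \<le> onorm (act x) + onorm (act y)"
    using onorm_triangle[OF bounded_linear_act[of x] bounded_linear_act[of y]] by simp
  then show "norm (x + y) \<le> norm x + norm y"
    using norm_triangle_ineq[of "scal x" "scal y"] unfolding norm_unitization_def
    by (simp add: max_def split: if_splits)
  have "act (r *\<^sub>R x) = (\<lambda>b. r *\<^sub>R act x b)"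
    by (rule ext) (simp add: act_simps)
  then have "onorm (act (r *\<^sub>R x)) = \<bar>r\<bar> * onorm (act x)"
    using onorm_scaleR[OF bounded_linear_act[of x], of r] by simp
  then show "norm (r *\<^sub>R x) = \<bar>r\<bar> * norm x"
    unfolding norm_unitization_def by (simp add: max_mult_distrib_left)
  have "act (x * y) = act x \<circ> act y"
    by (rule ext) (simp add: act_simps)
  then have "onorm (act (x * y)) \<le> onorm (act x) * onorm (act y)"
    using onorm_compose[OF bounded_linear_act[of x] bounded_linear_act[of y]] by simp
  also have "\<dots> \<le> norm x * norm y"
    unfolding norm_unitization_def
    by (intro mult_mono) (auto simp: onorm_pos_le bounded_linear_act le_max_iff_disj)
  finally have "onorm (act (x * y)) \<le> norm x * norm y" .
  moreover have "cmod (scal (x * y)) \<le> norm x * norm y"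
    unfolding norm_unitization_def
    by (simp add: norm_mult) (intro mult_mono, auto simp: le_max_iff_disj)
  ultimately show "norm (x * y) \<le> norm x * norm y"
    by (simp add: norm_unitization_def[of "x * y"])
  have "act (1::'a unitization) = (\<lambda>b. b)"
    by (rule ext) (simp add: act_simps)
  moreover have "onorm (\<lambda>b::'a. b) \<le> 1"
    using onorm_id_le by simp
  ultimately show "norm (1::'a unitization) = 1"
    by (simp add: norm_unitization_def)
  show "r *\<^sub>R x * y = r *\<^sub>R (x * y)"
    by (rule unitization.expand)
       (simp add: scaleR_add_right scaleR_scaleC[of r "_ :: 'a"] scaleC_scaleC
         scaleR_conv_of_real[of r "_ :: complex"] scaleC_add_right mult_scaleC_left mult.commute)
  show "x * r *\<^sub>R y = r *\<^sub>R (x * y)"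
    by (rule unitization.expand)
       (simp add: scaleR_add_right scaleR_scaleC[of r "_ :: 'a"] scaleC_scaleC
         scaleR_conv_of_real[of r "_ :: complex"] scaleC_add_right mult_scaleC_right mult.commute)
qed (rule dist_unitization_def sgn_unitization_def uniformity_unitization_def open_unitization_def
     | simp add: times_unitization_def)+

end

lemma norm_vec_le: "norm (vec x) \<le> 2 * norm x"
proof (cases "vec x = 0")
  case False
  have "norm (vec x * star (vec x)) \<le> norm (act x (star (vec x))) + norm (scal x *\<^sub>C star (vec x))"
    unfolding act_def by (metis add_diff_cancel_right' norm_triangle_ineq4)
  also have "\<dots> \<le> onorm (act x) * norm (vec x) + cmod (scal x) * norm (vec x)"
    using onorm[OF bounded_linear_act[of x], of "star (vec x)"] by (simp add: norm_scaleC)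
  also have "\<dots> \<le> 2 * norm x * norm (vec x)"
    unfolding distrib_right[symmetric] norm_unitization_def by (intro mult_right_mono) auto
  finally show ?thesis
    using False by (simp add: norm_mult_star power2_eq_square)
qed simp

lemma norm_scal_le: "cmod (scal x) \<le> norm x"
  by (simp add: norm_unitization_def)

definition emb :: "'a::cstar_algebra \<Rightarrow> 'a unitization" where
  "emb a = Unitization a 0"

lemma vec_emb [simp]: "vec (emb a) = a" and scal_emb [simp]: "scal (emb a) = 0"
  by (simp_all add: emb_def)

lemma norm_emb [simp]: "norm (emb a) = norm a"
proof -
  have act: "act (emb a) = (\<lambda>b. a * b)"
    by (rule ext) (simp add: act_def)
  have "onorm (\<lambda>b. a * b) \<le> norm a"
    by (rule onorm_bound) (simp_all add: norm_mult_ineq)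
  moreover have "norm a \<le> onorm (\<lambda>b. a * b)"
  proof (cases "a = 0")
    case False
    have "norm a * norm a \<le> onorm (\<lambda>b. a * b) * norm a"
      using onorm[OF bounded_linear_mult_right[of a], of "star a"]
      by (simp add: norm_mult_star power2_eq_square)
    then show ?thesis
      using False by simp
  qed (simp add: onorm_pos_le bounded_linear_mult_right)
  ultimately show ?thesis
    by (simp add: norm_unitization_def act onorm_pos_le bounded_linear_mult_right max_absorb2)
qed

lemma norm_unitization_le: "norm x \<le> norm (vec x) + cmod (scal x)"
proof -
  have x: "x = emb (vec x) + scal x *\<^sub>C 1"
    by (rule unitization.expand) simp
  have "act (scal x *\<^sub>C (1::'a unitization)) = (\<lambda>b. scal x *\<^sub>C b)"
    by (rule ext) (simp add: act_simps)
  moreover have "onorm (\<lambda>b::'a. scal x *\<^sub>C b) \<le> cmod (scal x)"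
    by (rule onorm_bound) (simp_all add: norm_scaleC)
  ultimately have "norm (scal x *\<^sub>C (1::'a unitization)) \<le> cmod (scal x)"
    by (simp add: norm_unitization_def)
  then show ?thesis
    using norm_triangle_ineq[of "emb (vec x)" "scal x *\<^sub>C 1"] x by simp
qed

instance unitization :: (cstar_algebra) banach
proof
  fix u :: "nat \<Rightarrow> 'a unitization"
  assume u: "Cauchy u"
  have "Cauchy (\<lambda>n. vec (u n))"
  proof (rule metric_CauchyI)
    fix e :: real
    assume "0 < e"
    then obtain M where "\<forall>m\<ge>M. \<forall>n\<ge>M. norm (u m - u n) < e / 2"
      using u unfolding Cauchy_def dist_norm by (metis half_gt_zero)
    then show "\<exists>M. \<forall>m\<ge>M. \<forall>n\<ge>M. dist (vec (u m)) (vec (u n)) < e"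
      using norm_vec_le[of "u _ - u _"] unfolding dist_norm
      by (metis (no_types, lifting) vec_simps(3) less_divide_eq_numeral1(1) mult.commute
          order_le_less_trans)
  qed
  moreover have "Cauchy (\<lambda>n. scal (u n))"
  proof (rule metric_CauchyI)
    fix e :: real
    assume "0 < e"
    then obtain M where "\<forall>m\<ge>M. \<forall>n\<ge>M. norm (u m - u n) < e"
      using u unfolding Cauchy_def dist_norm by metis
    then show "\<exists>M. \<forall>m\<ge>M. \<forall>n\<ge>M. dist (scal (u m)) (scal (u n)) < e"
      using norm_scal_le[of "u _ - u _"] unfolding dist_norm
      by (metis (no_types, lifting) scal_simps(3) order_le_less_trans)
  qed
  ultimately obtain a c where lim: "(\<lambda>n. vec (u n)) \<longlonglongrightarrow> a" "(\<lambda>n. scal (u n)) \<longlonglongrightarrow> c"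
    using Cauchy_convergent convergent_def by metis
  have "(\<lambda>n. norm (vec (u n) - a) + cmod (scal (u n) - c)) \<longlonglongrightarrow> 0"
    using lim by (intro tendsto_add_zero tendsto_norm_zero LIM_zero)
  then have "(\<lambda>n. norm (u n - Unitization a c)) \<longlonglongrightarrow> 0"
  proof (rule Lim_null_comparison[rotated])
    show "\<forall>\<^sub>F n in sequentially. norm (norm (u n - Unitization a c)) \<le> norm (vec (u n) - a) + cmod (scal (u n) - c)"
      using norm_unitization_le[of "u n - Unitization a c" for n] by simp
  qed
  then have "u \<longlonglongrightarrow> Unitization a c"
    using LIM_zero_iff tendsto_norm_zero_iff by blast
  then show "convergent u"
    by (auto simp: convergent_def)
qed

instantiation unitization :: (cstar_algebra) cstar_algebra
begin

definition "star x = Unitization (star (vec x)) (cnj (scal x))"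

instance
proof
  fix x y :: "'a unitization" and c :: complex
  show "norm (c *\<^sub>C x) = cmod c * norm x"
  proof -
    have "act (c *\<^sub>C x) = (\<lambda>b. c *\<^sub>C act x b)"
      by (rule ext) (simp add: act_simps)
    moreover have "onorm (\<lambda>b. c *\<^sub>C act x b) = cmod c * onorm (act x)"
    proof (rule antisym)
      have bl: "bounded_linear (\<lambda>b. c *\<^sub>C act x b)"
        by (rule bounded_linear_compose[OF bounded_linear_scaleC bounded_linear_act])
      show "onorm (\<lambda>b. c *\<^sub>C act x b) \<le> cmod c * onorm (act x)"
        using onorm[OF bounded_linear_act[of x]]
        by (intro onorm_bound)
           (auto simp: norm_scaleC onorm_pos_le bounded_linear_act mult.assoc intro!: mult_left_mono)
      show "cmod c * onorm (act x) \<le> onorm (\<lambda>b. c *\<^sub>C act x b)"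
      proof (cases "c = 0")
        case False
        have "onorm (act x) \<le> onorm (\<lambda>b. c *\<^sub>C act x b) / cmod c"
          using onorm[OF bl] False
          by (intro onorm_bound) (auto simp: norm_scaleC onorm_pos_le bl field_simps)
        then show ?thesis
          using False by (simp add: field_simps)
      qed (simp add: onorm_pos_le bl)
    qed
    ultimately show ?thesis
      by (simp add: norm_unitization_def norm_mult max_mult_distrib_left)
  qed
  show "star (x * y) = star y * star x" for x y :: "'a unitization"
    by (simp add: star_unitization_def times_unitization_def star_add star_mult star_scaleC
        add_ac mult.commute)
  show star': "star (star x) = x" for x :: "'a unitization"
    by (simp add: star_unitization_def star_star)
  have sq: "(onorm (act x))\<^sup>2 \<le> onorm (act (star x * x))" for x :: "'a unitization"
  proof -
    have "norm (act x b) \<le> sqrt (onorm (act (star x * x))) * norm b" for b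
    proof -
      have "star (act x b) * act x b = star b * act (star x * x) b"
        by (simp add: act_def star_unitization_def star_add star_mult star_scaleC algebra_simps
            mult_scaleC_left mult_scaleC_right scaleC_add_right scaleC_add_left scaleC_scaleC)
      then have "(norm (act x b))\<^sup>2 \<le> norm b * norm (act (star x * x) b)"
        by (metis norm_mult_ineq norm_star norm_star_mult)
      also have "\<dots> \<le> norm b * (onorm (act (star x * x)) * norm b)"
        by (intro mult_left_mono onorm bounded_linear_act) auto
      finally have "(norm (act x b))\<^sup>2 \<le> (sqrt (onorm (act (star x * x))) * norm b)\<^sup>2"
        by (simp add: power_mult_distrib onorm_pos_le bounded_linear_act power2_eq_square mult_ac)
      then show ?thesis
        by (rule power2_le_imp_le) (simp add: onorm_pos_le bounded_linear_act)
    qed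
    then have "onorm (act x) \<le> sqrt (onorm (act (star x * x)))"
      by (intro onorm_bound) (auto simp: onorm_pos_le bounded_linear_act)
    then show ?thesis
      by (metis bounded_linear_act onorm_pos_le real_le_rsqrt real_sqrt_ge_zero real_sqrt_pow2
          power_mono)
  qed
  have mul: "onorm (act (x * y)) \<le> onorm (act x) * onorm (act y)" for x y :: "'a unitization"
  proof -
    have "act (x * y) = act x \<circ> act y"
      by (rule ext) (simp add: act_simps)
    then show ?thesis
      using onorm_compose[OF bounded_linear_act[of x] bounded_linear_act[of y]] by simp
  qed
  have le: "onorm (act x) \<le> onorm (act (star x))" for x :: "'a unitization"
  proof (cases "onorm (act x) = 0")
    case False
    then have pos: "0 < onorm (act x)"
      using onorm_pos_le[OF bounded_linear_act[of x]] by simp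
    have "onorm (act x) * onorm (act x) \<le> onorm (act (star x)) * onorm (act x)"
      using sq[of x] mul[of "star x" x] by (simp add: power2_eq_square)
    then show ?thesis
      using pos by simp
  qed (simp add: onorm_pos_le bounded_linear_act)
  have "onorm (act (star x)) = onorm (act x)"
    using le[of x] le[of "star x"] by (simp add: star')
  then have "onorm (act (star x * x)) = (onorm (act x))\<^sup>2"
    using sq[of x] mul[of "star x" x] by (simp add: power2_eq_square)
  moreover have "cmod (scal (star x * x)) = (cmod (scal x))\<^sup>2"
    by (simp add: star_unitization_def norm_mult power2_eq_square)
  ultimately show "norm (star x * x) = (norm x)\<^sup>2"
    using onorm_pos_le[OF bounded_linear_act[of x]]
    by (simp add: norm_unitization_def max_def power2_le_iff_abs_le abs_le_square_iff)
qed (auto simp: scaleC_unitization_def plus_unitization_def times_unitization_def star_unitization_def star_add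
       star_scaleC algebra_simps scaleC_add_right scaleC_scaleC mult_scaleC_left mult_scaleC_right
       mult.commute)

end

lemma vec_star [simp]: "vec (star x) = star (vec x)" and scal_star [simp]: "scal (star x) = cnj (scal x)"
  by (simp_all add: star_unitization_def)

section \<open>Squares of self-adjoint elements in a unital C*-algebra\<close>

class unital_cstar_algebra = cstar_algebra + real_normed_algebra_1

instance unitization :: (cstar_algebra) unital_cstar_algebra ..

text \<open>
  The iteration for \<open>1 - sqrt (1 - a)\<close> at \<open>a = 1\<close>.
\<close>

primrec sqrt_majorant :: "nat \<Rightarrow> real" where
  "sqrt_majorant 0 = 0"
| "sqrt_majorant (Suc n) = (1 + (sqrt_majorant n)\<^sup>2) / 2"

lemma sqrt_majorant_bounds: "0 \<le> sqrt_majorant n \<and> sqrt_majorant n \<le> 1"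
proof (induction n)
  case (Suc n)
  then have "(sqrt_majorant n)\<^sup>2 \<le> 1"
    by (simp add: power_le_one)
  then show ?case
    by simp
qed simp

lemma incseq_sqrt_majorant: "incseq sqrt_majorant"
proof (rule incseq_SucI)
  fix n
  have "0 \<le> (1 - sqrt_majorant n)\<^sup>2"
    by simp
  then show "sqrt_majorant n \<le> sqrt_majorant (Suc n)"
    by (simp add: power2_diff)
qed

lemma Cauchy_sqrt_majorant: "Cauchy sqrt_majorant"
  using sqrt_majorant_bounds incseq_sqrt_majorant
  by (intro convergent_Cauchy Bseq_mono_convergent BseqI'[where K = 1])
     (auto simp: incseq_def abs_of_nonneg)

lemma star_one [simp]: "star (1::'b::unital_cstar_algebra) = 1"
  using star_mult[of "star (1::'b)" 1] by (simp add: star_star)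

text \<open>
  If \<open>s = 1 - L\<close>, then \<open>s * s = 1 - a\<close> says that \<open>L\<close> is a fixed point of
  \<open>R \<mapsto> (a + R * R) / 2\<close>. The iterates from \<open>0\<close> are polynomials in \<open>a\<close> with nonnegative
  coefficients, so their differences are dominated in norm by the same iteration at the number \<open>1\<close>.
  This reaches the boundary case \<open>norm a = 1\<close>, where the iteration is not a contraction.
\<close>

lemma sqrt_one_minus:
  fixes a :: "'b::unital_cstar_algebra"
  assumes sa: "star a = a" and a: "norm a \<le> 1"
  obtains s where "star s = s" "s * s = 1 - a" "norm (1 - s) \<le> 1" "\<And>z. z * a = a * z \<Longrightarrow> z * s = s * z"
proof -
  define R where "R = rec_nat (0::'b) (\<lambda>n R. (1/2) *\<^sub>R (a + R * R))"
  have R0: "R 0 = 0" and RS: "R (Suc n) = (1/2) *\<^sub>R (a + R n * R n)" for n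
    by (simp_all add: R_def)
  have norm_R: "norm (R n) \<le> sqrt_majorant n" for n
  proof (induction n)
    case (Suc n)
    have "norm (a + R n * R n) \<le> 1 + sqrt_majorant n * sqrt_majorant n"
      using a Suc mult_mono[OF Suc Suc] sqrt_majorant_bounds[of n]
      by (intro norm_triangle_le add_mono order_trans[OF norm_mult_ineq]) auto
    then show ?case
      by (simp add: RS power2_eq_square)
  qed (simp add: R0)
  have diff_R: "norm (R (n + k) - R n) \<le> sqrt_majorant (n + k) - sqrt_majorant n" for n k
  proof (induction n)
    case (Suc n)
    let ?x = "R (n + k)" and ?y = "R n" and ?r = "sqrt_majorant (n + k)" and ?q = "sqrt_majorant n"
    have "R (Suc n + k) - R (Suc n) = (1/2) *\<^sub>R ((?x - ?y) * ?x + ?y * (?x - ?y))"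
      by (simp add: RS algebra_simps)
    also have "norm \<dots> \<le> (1/2) * ((?r - ?q) * ?r + ?q * (?r - ?q))"
    proof -
      have "norm ((?x - ?y) * ?x) \<le> (?r - ?q) * ?r" "norm (?y * (?x - ?y)) \<le> ?q * (?r - ?q)"
        using Suc norm_R[of "n + k"] norm_R[of n] sqrt_majorant_bounds[of n]
          order_trans[OF norm_ge_zero Suc]
        by (auto intro!: order_trans[OF norm_mult_ineq] mult_mono)
      then show ?thesis
        using norm_triangle_ineq[of "(?x - ?y) * ?x" "?y * (?x - ?y)"] by simp
    qed
    also have "\<dots> = sqrt_majorant (Suc n + k) - sqrt_majorant (Suc n)"
      by (simp add: power2_eq_square algebra_simps)
    finally show ?case .
  qed (simp add: R0 norm_R)
  have "Cauchy R"
  proof (rule CauchyI')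
    fix e :: real
    assume "0 < e"
    then obtain M where M: "\<And>m n. M \<le> m \<Longrightarrow> M \<le> n \<Longrightarrow> \<bar>sqrt_majorant m - sqrt_majorant n\<bar> < e"
      using Cauchy_sqrt_majorant unfolding Cauchy_def dist_real_def by meson
    have "norm (R m - R n) < e" if "M \<le> m" "m < n" for m n
    proof -
      have "norm (R n - R m) \<le> sqrt_majorant n - sqrt_majorant m"
        using diff_R[of m "n - m"] that by simp
      also have "\<dots> < e"
        using M[of n m] that by simp
      finally show ?thesis
        by (simp add: norm_minus_commute)
    qed
    then show "\<exists>M. \<forall>m\<ge>M. \<forall>n>m. dist (R m) (R n) < e"
      unfolding dist_norm by blast
  qed
  then obtain L where L: "R \<longlonglongrightarrow> L"
    using Cauchy_convergent convergent_def by blast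
  have sa_R: "star (R n) = R n" for n
    by (induction n) (simp_all add: R0 RS star_scaleR star_add star_mult sa)
  have "(\<lambda>n. star (R n)) \<longlonglongrightarrow> star L"
    by (rule bounded_linear.tendsto[OF bounded_linear_star L])
  then have sa_L: "star L = L"
    using L LIMSEQ_unique by (simp add: sa_R) blast
  have "(\<lambda>n. (1/2) *\<^sub>R (a + R n * R n)) \<longlonglongrightarrow> (1/2) *\<^sub>R (a + L * L)"
    by (intro tendsto_intros L)
  then have "(1/2) *\<^sub>R (a + L * L) = L"
    using LIMSEQ_Suc[OF L] LIMSEQ_unique by (simp add: RS) blast
  then have "2 *\<^sub>R ((1/2) *\<^sub>R (a + L * L)) = 2 *\<^sub>R L"
    by (rule arg_cong)
  then have fixpoint: "a + L * L = 2 *\<^sub>R L"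
    by simp
  have comm: "z * (1 - L) = (1 - L) * z" if z: "z * a = a * z" for z
  proof -
    have R: "z * R n = R n * z" for n
    proof (induction n)
      case (Suc n)
      have "z * (R n * R n) = R n * R n * z"
        by (metis Suc mult.assoc)
      then show ?case
        by (simp add: RS algebra_simps z)
    qed (simp add: R0)
    have "(\<lambda>n. z * R n) \<longlonglongrightarrow> z * L" "(\<lambda>n. R n * z) \<longlonglongrightarrow> L * z"
      by (intro tendsto_intros L)+
    then have "z * L = L * z"
      using LIMSEQ_unique by (simp add: R) blast
    then show ?thesis
      by (simp add: algebra_simps)
  qed
  have "norm L \<le> 1"
    using Lim_norm_ubound[OF _ L, of 1] norm_R sqrt_majorant_bounds
    by (meson always_eventually order_trans trivial_limit_sequentially)
  moreover have "(1 - L) * (1 - L) = 1 - a"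
    using fixpoint by (simp add: algebra_simps scaleR_2)
  ultimately show ?thesis
    by (intro that[of "1 - L"] comm) (simp_all add: star_diff sa_L)
qed

lemma sqrt_near_one:
  fixes c :: "'b::unital_cstar_algebra"
  assumes "star c = c" and "norm (1 - c) \<le> 1"
  obtains s where "star s = s" "s * s = c" "norm (1 - s) \<le> 1" "\<And>z. z * c = c * z \<Longrightarrow> z * s = s * z"
proof (rule sqrt_one_minus[of "1 - c"])
  show "star (1 - c) = 1 - c" "norm (1 - c) \<le> 1"
    using assms by (simp_all add: star_diff)
  fix s
  assume s: "star s = s" "s * s = 1 - (1 - c)" "norm (1 - s) \<le> 1"
    and comm: "\<And>z. z * (1 - c) = (1 - c) * z \<Longrightarrow> z * s = s * z"
  show thesis
  proof (rule that[OF s(1) _ s(3)])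
    show "s * s = c"
      using s(2) by simp
    show "z * s = s * z" if "z * c = c * z" for z
      using that by (intro comm) (simp add: algebra_simps)
  qed
qed

lemma star_mult_cartesian:
  fixes s b :: "'b::cstar_algebra"
  assumes "star s = s" "star b = b" "s * b = b * s"
  shows "star (s + \<i> *\<^sub>C b) * (s + \<i> *\<^sub>C b) = s * s + b * b"
  using assms
  by (simp add: star_add star_scaleC algebra_simps mult_scaleC_left mult_scaleC_right
      scaleC_scaleC)

text \<open>
  The element \<open>s\<close> is the real part of \<open>s + \<i> *\<^sub>C b\<close>, whose norm is given by the
  C*-identity.
\<close>

lemma norm_cartesian_le:
  fixes s b :: "'b::cstar_algebra"
  assumes sa: "star s = s" "star b = b" and "s * b = b * s"
  shows "(norm s)\<^sup>2 \<le> norm (s * s + b * b)"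
proof -
  let ?u = "s + \<i> *\<^sub>C b"
  have "?u + star ?u = 2 *\<^sub>R s"
    by (simp add: star_add star_scaleC sa scaleR_2)
  then have "2 * norm s \<le> norm ?u + norm (star ?u)"
    using norm_triangle_ineq[of ?u "star ?u"] by simp
  then have "norm s \<le> norm ?u"
    by (simp del: norm_star add: norm_star[of ?u])
  then have "(norm s)\<^sup>2 \<le> (norm ?u)\<^sup>2"
    by (simp add: power_mono)
  then show ?thesis
    using star_mult_cartesian[OF assms] norm_star_mult[of ?u] by simp
qed

definition is_square :: "'b::cstar_algebra \<Rightarrow> bool" where
  "is_square a \<longleftrightarrow> (\<exists>b. star b = b \<and> a = b * b)"

lemma is_square_star: "is_square a \<Longrightarrow> star a = a"
  by (auto simp: is_square_def star_mult)

lemma is_square_scaleR: "is_square a \<Longrightarrow> 0 \<le> r \<Longrightarrow> is_square (r *\<^sub>R a)"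
proof -
  assume "is_square a" "0 \<le> r"
  then obtain b where "star b = b" "a = b * b"
    by (auto simp: is_square_def)
  with \<open>0 \<le> r\<close> show ?thesis
    by (auto simp: is_square_def star_scaleR intro!: exI[of _ "sqrt r *\<^sub>R b"])
qed

text \<open>
  With \<open>s\<close> a square root of \<open>1 - b * b\<close>, the element \<open>s + \<i> *\<^sub>C b\<close> is unitary.
\<close>

lemma norm_one_minus_square_le:
  fixes b :: "'b::unital_cstar_algebra"
  assumes sa: "star b = b" and b: "norm b \<le> 1"
  shows "norm (1 - b * b) \<le> 1"
proof -
  have "norm (b * b) \<le> 1"
    using b by (simp add: norm_selfadjoint_square sa power_le_one)
  then obtain s where s: "star s = s" "s * s = 1 - b * b" "\<And>z. z * (b * b) = b * b * z \<Longrightarrow> z * s = s * z"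
    using sqrt_one_minus[of "b * b"] sa by (metis star_mult)
  have "(norm s)\<^sup>2 \<le> norm (s * s + b * b)"
    using s(1,2) sa s(3)[of b] by (intro norm_cartesian_le) (auto simp: mult.assoc)
  then show ?thesis
    using s(2) norm_selfadjoint_square[OF s(1)] by simp
qed

text \<open>
  This and \<open>is_squareI_norm\<close> describe squares by norms, without spectral theory; in this form
  closure under sums and limits is the triangle inequality and continuity.
\<close>

lemma is_square_norm:
  fixes a :: "'b::unital_cstar_algebra"
  assumes "is_square a" and t: "norm a \<le> t"
  shows "norm (t *\<^sub>R 1 - a) \<le> t"
proof (cases "t = 0")
  case False
  then have "0 < t"
    using t norm_ge_zero[of a] by linarith
  obtain b where b: "star b = b" "(1/t) *\<^sub>R a = b * b"
    using is_square_scaleR[OF assms(1), of "1/t"] \<open>0 < t\<close> by (auto simp: is_square_def)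
  have "(norm b)\<^sup>2 = norm ((1/t) *\<^sub>R a)"
    using b norm_selfadjoint_square[of b] by simp
  also have "\<dots> \<le> 1"
    using t \<open>0 < t\<close> by (simp add: field_simps)
  finally have "norm b \<le> 1"
    using power2_le_imp_le[of "norm b" 1] by simp
  then have "norm (1 - (1/t) *\<^sub>R a) \<le> 1"
    using b norm_one_minus_square_le[of b] by simp
  then have "t * norm (1 - (1/t) *\<^sub>R a) \<le> t"
    using \<open>0 < t\<close> by (simp add: field_simps)
  moreover have "t *\<^sub>R (1 - (1/t) *\<^sub>R a) = t *\<^sub>R 1 - a"
    using \<open>0 < t\<close> by (simp add: algebra_simps)
  ultimately show ?thesis
    using \<open>0 < t\<close> by (metis abs_of_pos norm_scaleR)
qed (use t in simp)

lemma square_root: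
  fixes a :: "'b::unital_cstar_algebra"
  assumes sa: "star a = a" and "0 < t" and t: "norm (t *\<^sub>R 1 - a) \<le> t"
  obtains r where "is_square r" "r * r = a" "\<And>z. z * a = a * z \<Longrightarrow> z * r = r * z"
proof -
  let ?c = "(1/t) *\<^sub>R a"
  have "1 - ?c = (1/t) *\<^sub>R (t *\<^sub>R 1 - a)"
    using \<open>0 < t\<close> by (simp add: algebra_simps)
  then have "norm (1 - ?c) = (1/t) * norm (t *\<^sub>R 1 - a)"
    using \<open>0 < t\<close> by (simp only: norm_scaleR) simp
  also have "\<dots> \<le> 1"
    using t \<open>0 < t\<close> by (simp add: field_simps)
  finally have "norm (1 - ?c) \<le> 1" .
  then obtain s where s: "star s = s" "s * s = ?c" "norm (1 - s) \<le> 1"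
    "\<And>z. z * ?c = ?c * z \<Longrightarrow> z * s = s * z"
    using sqrt_near_one[of ?c] sa by (metis star_scaleR)
  have "is_square s"
    using sqrt_near_one[OF s(1,3)] unfolding is_square_def by metis
  show ?thesis
  proof
    show "is_square (sqrt t *\<^sub>R s)"
      using \<open>is_square s\<close> \<open>0 < t\<close> by (intro is_square_scaleR) auto
    show "sqrt t *\<^sub>R s * sqrt t *\<^sub>R s = a"
      using s(2) \<open>0 < t\<close> by simp
    show "z * sqrt t *\<^sub>R s = sqrt t *\<^sub>R s * z" if "z * a = a * z" for z
      using s(4)[of z] that by (simp add: algebra_simps)
  qed
qed

lemma is_square_commuting_root:
  fixes a :: "'b::unital_cstar_algebra"
  assumes "is_square a"
  obtains r where "is_square r" "r * r = a" "\<And>z. z * a = a * z \<Longrightarrow> z * r = r * z"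
proof -
  have "norm ((norm a + 1) *\<^sub>R 1 - a) \<le> norm a + 1"
    using assms by (intro is_square_norm) auto
  moreover have "0 < norm a + 1"
    by (simp add: add_nonneg_pos)
  ultimately show ?thesis
    using square_root[OF is_square_star[OF assms]] that by blast
qed

lemma is_squareI_norm:
  fixes a :: "'b::unital_cstar_algebra"
  assumes "star a = a" "0 < t" "norm (t *\<^sub>R 1 - a) \<le> t"
  shows "is_square a"
  using square_root[OF assms] is_square_star unfolding is_square_def by metis

lemma is_square_add:
  fixes a b :: "'b::unital_cstar_algebra"
  assumes "is_square a" "is_square b"
  shows "is_square (a + b)"
proof (rule is_squareI_norm)
  let ?s = "norm a + 1" and ?t = "norm b + 1"
  show "star (a + b) = a + b"
    using assms by (simp add: star_add is_square_star)
  show "0 < ?s + ?t"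
    by (intro add_pos_pos add_nonneg_pos) auto
  have eq: "(?s + ?t) *\<^sub>R 1 - (a + b) = (?s *\<^sub>R 1 - a) + (?t *\<^sub>R 1 - b)"
    by (simp add: scaleR_left.add scaleR_2)
  have "norm (?s *\<^sub>R 1 - a) + norm (?t *\<^sub>R 1 - b) \<le> ?s + ?t"
    using assms by (intro add_mono is_square_norm) auto
  then show "norm ((?s + ?t) *\<^sub>R 1 - (a + b)) \<le> ?s + ?t"
    unfolding eq using norm_triangle_ineq order_trans by blast
qed

lemma is_square_limit:
  fixes f :: "nat \<Rightarrow> 'b::unital_cstar_algebra"
  assumes f: "\<And>n. is_square (f n)" and lim: "f \<longlonglongrightarrow> a"
  shows "is_square a"
proof -
  obtain t where t: "0 < t" "\<And>n. norm (f n) \<le> t"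
    using Bseq_def convergent_imp_Bseq[OF convergentI[OF lim]] by (auto simp: Bseq_def)
  show ?thesis
  proof (rule is_squareI_norm[OF _ \<open>0 < t\<close>])
    have "(\<lambda>n. star (f n)) \<longlonglongrightarrow> star a"
      by (rule bounded_linear.tendsto[OF bounded_linear_star lim])
    then show "star a = a"
      using lim LIMSEQ_unique by (simp add: f is_square_star) blast
    have "(\<lambda>n. norm (t *\<^sub>R 1 - f n)) \<longlonglongrightarrow> norm (t *\<^sub>R 1 - a)"
      by (intro tendsto_intros lim)
    then show "norm (t *\<^sub>R 1 - a) \<le> t"
      using is_square_norm[OF f t(2)] by (intro LIMSEQ_le_const2) auto
  qed
qed

lemma norm_selfadjoint_power:
  fixes u :: "'b::unital_cstar_algebra"
  assumes "star u = u"
  shows "norm (u ^ (2 ^ k)) = norm u ^ (2 ^ k)"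
proof (induction k)
  case (Suc k)
  have star_pow: "star (u ^ n) = u ^ n" for n
    by (induction n) (simp_all add: star_mult assms power_commutes)
  have "u ^ 2 ^ Suc k = u ^ 2 ^ k * u ^ 2 ^ k"
    by (simp add: power_add[symmetric] mult_2)
  then have "norm (u ^ 2 ^ Suc k) = (norm (u ^ 2 ^ k))\<^sup>2"
    using norm_selfadjoint_square[OF star_pow] by simp
  then show ?case
    by (simp add: Suc power_mult[symmetric] mult.commute)
qed simp

lemma linear_growth_imp_le_1:
  fixes x C :: real
  assumes "0 \<le> C" and le: "\<And>k. x ^ (2 ^ k) \<le> 1 + C * 2 ^ k"
  shows "x \<le> 1"
proof (rule ccontr)
  assume "\<not> x \<le> 1"
  then obtain d where d: "0 < d" "x = 1 + d"
    by (metis add.commute diff_add_cancel diff_gt_0_iff_gt linorder_not_le)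
  obtain k :: nat where "(1 + 2 * C) / d\<^sup>2 < k"
    using reals_Archimedean2 by blast
  then have "1 + 2 * C < real k * d\<^sup>2"
    using d by (simp add: field_simps)
  also have "\<dots> \<le> 2 ^ k * d\<^sup>2"
    using of_nat_less_two_power[of k] by (intro mult_right_mono) (auto intro: less_imp_le)
  finally have k: "1 + 2 * C < 2 ^ k * d\<^sup>2" .
  have "2 ^ k * d \<le> (1 + d) ^ (2 ^ k)"
    using Bernoulli_inequality[of d "2 ^ k"] d by simp
  then have "(2 ^ k * d)\<^sup>2 \<le> ((1 + d) ^ (2 ^ k))\<^sup>2"
    using d by (intro power_mono) auto
  also have "\<dots> = x ^ (2 ^ Suc k)"
    using d by (simp add: power_mult[symmetric] mult.commute)
  also have "\<dots> \<le> 1 + C * 2 ^ Suc k"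
    by (rule le)
  also have "\<dots> \<le> 2 ^ k * (1 + 2 * C)"
    using \<open>0 \<le> C\<close> by (simp add: algebra_simps)
  also have "\<dots> < 2 ^ k * (2 ^ k * d\<^sup>2)"
    using k by (intro mult_strict_left_mono) auto
  finally show False
    by (simp add: power2_eq_square mult_ac)
qed

lemma selfadjoint_squares_cancel:
  fixes s v :: "'b::unital_cstar_algebra"
  assumes sa: "star s = s" "star v = v" and "s * v = v * s" and zero: "s * s + v * v = 0"
  shows "v = 0"
  using norm_cartesian_le[of v s] assms by (simp add: add.commute)

text \<open>
  The product \<open>star y * y\<close> cannot be negative when \<open>y * star y\<close> is positive. Expanding the
  \<open>n\<close>-th power of \<open>U = 1 - star y * y / t\<close> moves all inner factors to powers of
  \<open>T = 1 - y * star y / t\<close>, which are contractions, so the norms of the powers of \<open>U\<close> grow at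
  most linearly. But \<open>U\<close> is self-adjoint, so the norm of its \<open>2 ^ k\<close>-th power is the power of its norm.
  Hence \<open>U = 1 + w * w / t\<close> is a contraction, and \<open>1 - U\<close> is at once a square and minus a square.
\<close>

lemma star_mult_eq_minus_square:
  fixes y w :: "'b::unital_cstar_algebra"
  assumes w: "star w = w" and y: "star y * y = - (w * w)" and sq: "is_square (y * star y)"
  shows "w = 0"
proof -
  define t where "t = norm (y * star y) + 1"
  have "0 < t" and "norm (y * star y) \<le> t"
    by (simp_all add: t_def add_nonneg_pos)
  define T where "T = 1 - (1/t) *\<^sub>R (y * star y)"
  define U where "U = 1 - (1/t) *\<^sub>R (star y * y)"
  define Q where "Q = rec_nat (0::'b) (\<lambda>n Q. 1 + Q * T)"
  have Q0: "Q 0 = 0" and QS: "Q (Suc n) = 1 + Q n * T" for n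
    by (simp_all add: Q_def)
  have "t *\<^sub>R T = t *\<^sub>R 1 - y * star y"
    using \<open>0 < t\<close> by (simp add: T_def algebra_simps)
  then have "t * norm T \<le> t"
    using is_square_norm[OF sq \<open>norm (y * star y) \<le> t\<close>] \<open>0 < t\<close> by (metis abs_of_pos norm_scaleR)
  then have T: "norm T \<le> 1"
    using \<open>0 < t\<close> by simp
  have norm_Q: "norm (Q n) \<le> real n" for n
  proof (induction n)
    case (Suc n)
    have "norm (Q n * T) \<le> real n * 1"
      using Suc T by (intro order_trans[OF norm_mult_ineq] mult_mono) auto
    then show ?case
      using norm_triangle_ineq[of 1 "Q n * T"] by (simp add: QS)
  qed (simp add: Q0)
  have intertwine: "y * U = T * y"
    by (simp add: T_def U_def algebra_simps)
  have power_U: "U ^ n = 1 - (1/t) *\<^sub>R (star y * Q n * y)" for n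
  proof (induction n)
    case (Suc n)
    have "U ^ Suc n = U - (1/t) *\<^sub>R (star y * Q n * (y * U))"
      by (simp only: power_Suc2 Suc) (simp add: algebra_simps)
    also have "\<dots> = 1 - (1/t) *\<^sub>R (star y * Q (Suc n) * y)"
      unfolding intertwine by (simp add: QS U_def algebra_simps)
    finally show ?case .
  qed (simp add: Q0)
  have U: "star U = U"
    by (simp add: U_def star_diff star_scaleR star_mult star_star)
  have "norm U ^ (2 ^ k) \<le> 1 + ((1/t) * (norm y)\<^sup>2) * 2 ^ k" for k
  proof -
    have "norm (star y * Q (2 ^ k) * y) \<le> norm y * real (2 ^ k) * norm y"
      using norm_Q[of "2 ^ k"]
      by (intro order_trans[OF norm_mult_ineq] mult_mono order_trans[OF norm_mult_ineq[of "star y"]]) auto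
    then have "norm ((1/t) *\<^sub>R (star y * Q (2 ^ k) * y)) \<le> ((1/t) * (norm y)\<^sup>2) * 2 ^ k"
      using \<open>0 < t\<close> by (simp add: field_simps power2_eq_square)
    then show ?thesis
      using norm_triangle_ineq4[of 1 "(1/t) *\<^sub>R (star y * Q (2 ^ k) * y)"]
        norm_selfadjoint_power[OF U, of k] by (simp add: power_U)
  qed
  then have "norm U \<le> 1"
    using \<open>0 < t\<close> by (intro linear_growth_imp_le_1[of "(1/t) * (norm y)\<^sup>2"]) auto
  then obtain s where s: "star s = s" "s * s = 1 - U" "\<And>z. z * U = U * z \<Longrightarrow> z * s = s * z"
    using sqrt_one_minus[OF U] by metis
  let ?v = "sqrt (1/t) *\<^sub>R w"
  have "w * U = U * w"
    by (simp add: U_def y algebra_simps)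
  have "?v = 0"
  proof (rule selfadjoint_squares_cancel)
    show "s * ?v = ?v * s"
      using s(3)[OF \<open>w * U = U * w\<close>] by simp
    show "s * s + ?v * ?v = 0"
      using \<open>0 < t\<close> by (simp add: s(2) U_def y)
  qed (simp_all add: s(1) star_scaleR w)
  then show ?thesis
    using \<open>0 < t\<close> by simp
qed

text \<open>
  Let \<open>b\<close> be twice the negative part of \<open>d = star x * x\<close>. Then \<open>y = x * b\<close> has
  \<open>star y * y = - (w * w)\<close>, while \<open>y * star y + star y * y\<close> is a sum of squares of the real
  and imaginary parts of \<open>y\<close>. Thus \<open>y * star y\<close> is a square, and the previous lemma gives
  \<open>y = 0\<close> and then \<open>b = 0\<close>.
\<close>

theorem is_square_star_mult:
  fixes x :: "'b::unital_cstar_algebra"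
  shows "is_square (star x * x)"
proof -
  define d where "d = star x * x"
  have sa_d: "star d = d"
    by (simp add: d_def star_mult star_star)
  have "is_square (d * d)"
    using sa_d by (auto simp: is_square_def)
  then obtain m where m: "is_square m" "m * m = d * d" "\<And>z. z * (d * d) = d * d * z \<Longrightarrow> z * m = m * z"
    by (rule is_square_commuting_root) blast
  have dm: "d * m = m * d"
    using m(3)[of d] by (simp add: mult.assoc)
  obtain r where r: "is_square r" "r * r = m" "\<And>z. z * m = m * z \<Longrightarrow> z * r = r * z"
    using m(1) by (rule is_square_commuting_root) blast
  have sa: "star m = m" "star r = r"
    using m(1) r(1) by (simp_all add: is_square_star)
  \<comment> \<open>\<open>m\<close> is the absolute value of \<open>d\<close>.\<close>
  define b where "b = m - d"
  have db: "d * b = - (m * b)"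
    using m(2) dm by (simp add: b_def algebra_simps)
  have rb: "b * r = r * b"
    using r(3)[of m] r(3)[of d] dm by (simp add: b_def algebra_simps)
  have sa_b: "star b = b"
    by (simp add: b_def star_diff sa sa_d)
  define y where "y = x * b"
  define w where "w = r * b"
  have w: "star w = w"
    by (simp add: w_def star_mult sa sa_b rb)
  have "w * w = r * (b * r) * b"
    by (simp add: w_def mult.assoc)
  also have "\<dots> = r * r * b * b"
    unfolding rb by (simp add: mult.assoc)
  finally have ww: "w * w = m * b * b"
    by (simp add: r)
  have "b * m = m * b"
    using dm by (simp add: b_def algebra_simps)
  have "star y * y = b * (d * b)"
    by (simp add: y_def d_def star_mult sa_b mult.assoc)
  also have "\<dots> = - (w * w)"
    unfolding db ww using \<open>b * m = m * b\<close> by (simp add: mult.assoc[symmetric])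
  finally have yy: "star y * y = - (w * w)" .
  define \<alpha> where "\<alpha> = y + star y"
  define \<beta> where "\<beta> = \<i> *\<^sub>C (y - star y)"
  have \<alpha>: "star \<alpha> = \<alpha>"
    by (simp add: \<alpha>_def star_add star_star add.commute)
  have \<beta>: "star \<beta> = \<beta>"
    by (simp add: \<beta>_def star_scaleC star_diff star_star complex_vector.scale_right_diff_distrib)
  have "is_square (\<alpha> * \<alpha>)" "is_square (\<beta> * \<beta>)" "is_square (w * w)"
    using \<alpha> \<beta> w unfolding is_square_def by metis+
  then have "is_square (w * w + (1/2) *\<^sub>R (\<alpha> * \<alpha> + \<beta> * \<beta>))"
    by (intro is_square_add is_square_scaleR) auto
  moreover have "\<alpha> * \<alpha> + \<beta> * \<beta> = 2 *\<^sub>R (y * star y + star y * y)"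
    by (simp add: \<alpha>_def \<beta>_def algebra_simps mult_scaleC_left mult_scaleC_right scaleC_scaleC scaleR_2)
  ultimately have "is_square (y * star y)"
    by (simp add: yy)
  then have "w = 0"
    using star_mult_eq_minus_square[OF w yy] by blast
  then have "y = 0"
    using yy star_mult_eq_zero[of y] by simp
  then have "d * b = 0"
    by (simp add: d_def y_def mult.assoc)
  then have "star b * b = 0"
    using db by (simp add: sa_b) (simp add: b_def left_diff_distrib)
  then have "b = 0"
    by (rule star_mult_eq_zero)
  then show ?thesis
    using m(1) by (simp add: b_def d_def)
qed

text \<open>
  If \<open>t\<close> exceeds \<open>norm (a + b)\<close>, then \<open>t - a = (t - (a + b)) + b\<close> is a square, and its root can
  be chosen to commute with the root \<open>\<alpha>\<close> of \<open>a\<close>; now \<open>\<alpha>\<close> is the real part of an element of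
  norm \<open>sqrt t\<close>.
\<close>

lemma norm_mono_square:
  fixes a b :: "'b::unital_cstar_algebra"
  assumes a: "is_square a" and b: "is_square b"
  shows "norm a \<le> norm (a + b)"
proof (rule field_le_epsilon)
  fix e :: real
  assume "0 < e"
  define t where "t = norm (a + b) + e"
  have "0 < t" "norm (a + b) \<le> t"
    using \<open>0 < e\<close> by (simp_all add: t_def add_nonneg_pos)
  have "is_square (t *\<^sub>R 1 - (a + b))"
    using a b \<open>0 < t\<close> \<open>norm (a + b) \<le> t\<close>
    by (intro is_squareI_norm[of _ t]) (simp_all add: star_add star_diff star_scaleR is_square_star add.commute)
  then have "is_square (t *\<^sub>R 1 - (a + b) + b)"
    using b by (rule is_square_add)
  then have "is_square (t *\<^sub>R 1 - a)"
    by (simp add: diff_diff_eq[symmetric])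
  then obtain q where q: "is_square q" "q * q = t *\<^sub>R 1 - a"
    "\<And>z. z * (t *\<^sub>R 1 - a) = (t *\<^sub>R 1 - a) * z \<Longrightarrow> z * q = q * z"
    by (rule is_square_commuting_root) blast
  obtain \<alpha> where \<alpha>: "star \<alpha> = \<alpha>" "a = \<alpha> * \<alpha>"
    using a by (auto simp: is_square_def)
  have "\<alpha> * q = q * \<alpha>"
    by (rule q(3)) (simp add: \<alpha> algebra_simps)
  then have "(norm \<alpha>)\<^sup>2 \<le> norm (\<alpha> * \<alpha> + q * q)"
    using \<alpha> q(1) by (intro norm_cartesian_le) (auto simp: is_square_star)
  then show "norm a \<le> norm (a + b) + e"
    using norm_selfadjoint_square[OF \<alpha>(1)] \<open>0 < t\<close> by (simp add: \<alpha>(2)[symmetric] q(2) t_def[symmetric])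
qed

section \<open>Positive elements\<close>

lemma emb_simps:
  "emb 0 = 0" "emb (a + b) = emb a + emb b" "emb (a - b) = emb a - emb b"
  "emb (r *\<^sub>R a) = r *\<^sub>R emb a" "emb (a * b) = emb a * emb b" "emb (star a) = star (emb a)"
  by (rule unitization.expand, simp)+

lemma pos_element_iff: "pos_element a \<longleftrightarrow> is_square (emb a)"
proof
  assume "pos_element a"
  then obtain b where "a = star b * b"
    by (auto simp: pos_element_def)
  then show "is_square (emb a)"
    by (simp add: emb_simps is_square_star_mult)
next
  assume "is_square (emb a)"
  then obtain r where r: "star r = r" "emb a = r * r"
    by (auto simp: is_square_def)
  have "scal r * scal r = 0"
    using r(2) by (metis scal_emb scal_mult)
  then have "vec (emb a) = vec r * vec r"
    using r(2) by simp
  moreover have "star (vec r) = vec r"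
    using r(1) by (metis vec_star)
  ultimately show "pos_element a"
    by (metis pos_element_def vec_emb)
qed

lemma pos_star_mult [simp]: "pos_element (star b * b)"
  by (auto simp: pos_element_def)

lemma pos_zero [simp]: "pos_element 0"
  using pos_star_mult[of 0] by simp

lemma pos_add: "pos_element a \<Longrightarrow> pos_element b \<Longrightarrow> pos_element (a + b)"
  by (simp add: pos_element_iff emb_simps is_square_add)

lemma pos_scaleR: "pos_element a \<Longrightarrow> 0 \<le> r \<Longrightarrow> pos_element (r *\<^sub>R a)"
  by (simp add: pos_element_iff emb_simps is_square_scaleR)

lemma pos_norm_mono:
  assumes "pos_element a" "pos_element (b - a)"
  shows "norm a \<le> norm b"
  using norm_mono_square[of "emb a" "emb (b - a)"] assms
  by (simp add: pos_element_iff emb_simps(2)[symmetric])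

lemma pos_limit:
  assumes "\<And>n. pos_element (f n)" "f \<longlonglongrightarrow> a"
  shows "pos_element a"
proof -
  have "(\<lambda>n. norm (emb (f n) - emb a)) \<longlonglongrightarrow> 0"
    using assms(2) by (simp add: emb_simps(3)[symmetric] LIM_zero tendsto_norm_zero)
  then have "(\<lambda>n. emb (f n)) \<longlonglongrightarrow> emb a"
    using LIM_zero_iff tendsto_norm_zero_iff by blast
  then show ?thesis
    using assms(1) is_square_limit[of "\<lambda>n. emb (f n)"] by (simp add: pos_element_iff)
qed

text \<open>
  In the unitization \<open>\<sigma> + d\<close> is a square root of \<open>M - c\<close>. Multiplying by it stays inside the
  algebra, or inside a module, although the unit need not.
\<close>

lemma pos_norm_minus_root:
  assumes c: "pos_element c" and M: "norm c \<le> M"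
  obtains \<sigma> d where "star d = d" "\<sigma> * \<sigma> = M" "d * d + (2 * \<sigma>) *\<^sub>R d = - c"
proof (cases "M = 0")
  case True
  then show ?thesis
    using M by (intro that[of 0 0]) auto
next
  case False
  then have "0 < M"
    using M norm_ge_zero[of c] by linarith
  have "is_square (M *\<^sub>R 1 - emb c)"
    using c M \<open>0 < M\<close>
    by (intro is_squareI_norm[of _ M])
       (simp_all add: star_diff star_scaleR is_square_star pos_element_iff)
  then obtain s where s: "star s = s" "M *\<^sub>R 1 - emb c = s * s"
    by (auto simp: is_square_def)
  have "cnj (scal s) = scal s"
    using s(1) by (metis scal_star)
  then obtain \<sigma> where \<sigma>: "scal s = complex_of_real \<sigma>"
    by (metis Reals_cases Reals_cnj_iff)
  have "scal (M *\<^sub>R 1 - emb c) = scal (s * s)"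
    using s by simp
  then have "complex_of_real M = complex_of_real (\<sigma> * \<sigma>)"
    by (simp add: \<sigma> scaleR_conv_of_real[of M "_ :: complex"])
  then have "\<sigma> * \<sigma> = M"
    by (metis of_real_eq_iff)
  moreover have "vec (M *\<^sub>R 1 - emb c) = vec (s * s)"
    using s by simp
  then have "vec s * vec s + (2 * \<sigma>) *\<^sub>R vec s = - c"
    by (simp add: \<sigma> scaleC_real algebra_simps mult_2 scaleR_left.add[symmetric] scaleR_2)
  moreover have "star (vec s) = vec s"
    using s(1) by (metis vec_star)
  ultimately show ?thesis
    using that by blast
qed

lemma pos_conj_le_norm:
  assumes c: "pos_element c" and M: "norm c \<le> M"
  shows "pos_element (M *\<^sub>R (star x * x) - star x * c * x)"
proof -
  obtain \<sigma> d where d: "star d = d" "\<sigma> * \<sigma> = M" "d * d + (2 * \<sigma>) *\<^sub>R d = - c"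
    using pos_norm_minus_root[OF assms] .
  have two: "(2 * r) *\<^sub>R y = r *\<^sub>R y + r *\<^sub>R y" "(r * 2) *\<^sub>R y = r *\<^sub>R y + r *\<^sub>R y" for r and y :: 'a
    by (metis mult_2 scaleR_left.add) (metis mult_2_right scaleR_left.add)
  have "star (\<sigma> *\<^sub>R x + d * x) * (\<sigma> *\<^sub>R x + d * x)
    = (\<sigma> * \<sigma>) *\<^sub>R (star x * x) + star x * (d * d + (2 * \<sigma>) *\<^sub>R d) * x"
    by (simp add: star_add star_scaleR star_mult d(1) algebra_simps two)
  also have "\<dots> = M *\<^sub>R (star x * x) - star x * c * x"
    unfolding d by simp
  finally show ?thesis
    by (metis pos_star_mult)
qed

section \<open>Hilbert modules\<close>

text \<open>
  Stated for the coefficients \<open>p\<close>, \<open>x\<close>, \<open>q\<close> of a form, since it is applied to the inner product of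
  a module and also to the form \<open>\<langle>\<zeta>, k \<eta>\<rangle>\<close> of a positive operator \<open>k\<close>. The choice that
  proves it is \<open>a = x / M\<close>.
\<close>

lemma cauchy_schwarz_pos:
  fixes p q x :: "'a::cstar_algebra"
  assumes form: "\<And>a. pos_element (star a * p * a - star a * x - star x * a + q)"
    and p: "pos_element p" and M: "norm p \<le> M"
  shows "pos_element (M *\<^sub>R q - star x * x)"
proof -
  have strict: "pos_element (M *\<^sub>R q - star x * x)" if "norm p \<le> M" "0 < M" for M
  proof -
    let ?a = "(1/M) *\<^sub>R x"
    have "pos_element ((star ?a * p * ?a - star ?a * x - star x * ?a + q)
        + (1/M\<^sup>2) *\<^sub>R (M *\<^sub>R (star x * x) - star x * p * x))"
      using that by (intro pos_add form pos_scaleR pos_conj_le_norm[OF p]) auto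
    also have "\<dots> = q - (1/M) *\<^sub>R (star x * x)"
      using that by (simp add: star_scaleR scaleR_right_diff_distrib power2_eq_square)
    finally have "pos_element (M *\<^sub>R (q - (1/M) *\<^sub>R (star x * x)))"
      using that by (intro pos_scaleR) auto
    then show ?thesis
      using that by (simp add: scaleR_right_diff_distrib)
  qed
  have "(\<lambda>n. M + 1 / real (Suc n)) \<longlonglongrightarrow> M + 0"
    by (intro tendsto_add tendsto_const LIMSEQ_Suc[OF lim_1_over_n])
  then have "(\<lambda>n. (M + 1 / real (Suc n)) *\<^sub>R q - star x * x) \<longlonglongrightarrow> (M + 0) *\<^sub>R q - star x * x"
    by (intro tendsto_diff tendsto_scaleR tendsto_const)
  moreover have "0 \<le> M"
    using M norm_ge_zero[of p] by linarith
  then have "pos_element ((M + 1 / real (Suc n)) *\<^sub>R q - star x * x)" for n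
    using M by (intro strict) (auto intro: add_nonneg_pos add_increasing2)
  ultimately show ?thesis
    using pos_limit[of "\<lambda>n. (M + 1 / real (Suc n)) *\<^sub>R q - star x * x"] by simp
qed

lemma cauchy_schwarz_norm:
  fixes p q x :: "'a::cstar_algebra"
  assumes "\<And>a. pos_element (star a * p * a - star a * x - star x * a + q)"
    and p: "pos_element p" and q: "pos_element q"
  shows "(norm x)\<^sup>2 \<le> norm p * norm q"
  using pos_norm_mono[OF pos_star_mult cauchy_schwarz_pos[OF assms(1,2) order_refl]]
  by (simp add: norm_star_mult)

context hilbert_module
begin

lemma elems_closed [simp, intro]:
  "0 \<in> elems Y" "\<xi> \<in> elems Y \<Longrightarrow> \<zeta> \<in> elems Y \<Longrightarrow> \<xi> + \<zeta> \<in> elems Y"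
  "\<xi> \<in> elems Y \<Longrightarrow> c *\<^sub>C \<xi> \<in> elems Y" "\<xi> \<in> elems Y \<Longrightarrow> r *\<^sub>R \<xi> \<in> elems Y"
  "\<xi> \<in> elems Y \<Longrightarrow> - \<xi> \<in> elems Y" "\<xi> \<in> elems Y \<Longrightarrow> \<zeta> \<in> elems Y \<Longrightarrow> \<xi> - \<zeta> \<in> elems Y"
  "\<xi> \<in> elems Y \<Longrightarrow> ract Y \<xi> a \<in> elems Y"
  by (rule complex_vector.subspace_0[OF subspace] complex_vector.subspace_add[OF subspace]
      complex_vector.subspace_scale[OF subspace] complex_vector.subspace_neg[OF subspace]
      complex_vector.subspace_diff[OF subspace] ract_closed
      complex_vector.subspace_scale[OF subspace, of _ "complex_of_real r", folded scaleR_scaleC];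
      assumption)+

lemma elems_sum_list [simp, intro]: "(\<And>x. x \<in> set xs \<Longrightarrow> f x \<in> elems Y) \<Longrightarrow> (\<Sum>x\<leftarrow>xs. f x) \<in> elems Y"
  by (induction xs) auto

lemma ip_add_left:
  "\<xi> \<in> elems Y \<Longrightarrow> \<zeta> \<in> elems Y \<Longrightarrow> \<eta> \<in> elems Y \<Longrightarrow> ip Y (\<xi> + \<zeta>) \<eta> = ip Y \<xi> \<eta> + ip Y \<zeta> \<eta>"
  using ip_star[of \<eta> "\<xi> + \<zeta>"] ip_star[of \<eta> \<xi>] ip_star[of \<eta> \<zeta>] by (simp add: ip_add star_add)

lemma ip_scaleR: "\<xi> \<in> elems Y \<Longrightarrow> \<zeta> \<in> elems Y \<Longrightarrow> ip Y \<xi> (r *\<^sub>R \<zeta>) = r *\<^sub>R ip Y \<xi> \<zeta>"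
  by (simp add: scaleR_scaleC ip_scaleC)

lemma ip_scaleC_left: "\<xi> \<in> elems Y \<Longrightarrow> \<zeta> \<in> elems Y \<Longrightarrow> ip Y (c *\<^sub>C \<xi>) \<zeta> = cnj c *\<^sub>C ip Y \<xi> \<zeta>"
  using ip_star[of \<zeta> "c *\<^sub>C \<xi>"] ip_star[of \<zeta> \<xi>] by (simp add: ip_scaleC star_scaleC)

lemma ip_scaleR_left: "\<xi> \<in> elems Y \<Longrightarrow> \<zeta> \<in> elems Y \<Longrightarrow> ip Y (r *\<^sub>R \<xi>) \<zeta> = r *\<^sub>R ip Y \<xi> \<zeta>"
  by (simp add: scaleR_scaleC ip_scaleC_left)

lemma ip_minus: "\<xi> \<in> elems Y \<Longrightarrow> \<zeta> \<in> elems Y \<Longrightarrow> ip Y \<xi> (- \<zeta>) = - ip Y \<xi> \<zeta>"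
  using ip_scaleR[of \<xi> \<zeta> "-1"] by simp

lemma ip_minus_left: "\<xi> \<in> elems Y \<Longrightarrow> \<zeta> \<in> elems Y \<Longrightarrow> ip Y (- \<xi>) \<zeta> = - ip Y \<xi> \<zeta>"
  using ip_scaleR_left[of \<xi> \<zeta> "-1"] by simp

lemma ip_diff:
  "\<xi> \<in> elems Y \<Longrightarrow> \<zeta> \<in> elems Y \<Longrightarrow> \<eta> \<in> elems Y \<Longrightarrow> ip Y \<xi> (\<zeta> - \<eta>) = ip Y \<xi> \<zeta> - ip Y \<xi> \<eta>"
  using ip_add[of \<xi> \<zeta> "- \<eta>"] by (simp add: ip_minus)

lemma ip_diff_left:
  "\<xi> \<in> elems Y \<Longrightarrow> \<zeta> \<in> elems Y \<Longrightarrow> \<eta> \<in> elems Y \<Longrightarrow> ip Y (\<xi> - \<zeta>) \<eta> = ip Y \<xi> \<eta> - ip Y \<zeta> \<eta>"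
  using ip_add_left[of \<xi> "- \<zeta>" \<eta>] by (simp add: ip_minus_left)

lemma ip_zero [simp]: "\<xi> \<in> elems Y \<Longrightarrow> ip Y \<xi> 0 = 0" "\<xi> \<in> elems Y \<Longrightarrow> ip Y 0 \<xi> = 0"
  using ip_scaleR[of \<xi> 0 0] ip_scaleR_left[of 0 \<xi> 0] by auto

lemma ip_ract_left:
  "\<xi> \<in> elems Y \<Longrightarrow> \<zeta> \<in> elems Y \<Longrightarrow> ip Y (ract Y \<xi> a) \<zeta> = star a * ip Y \<xi> \<zeta>"
  using ip_star[of \<zeta> "ract Y \<xi> a"] ip_star[of \<zeta> \<xi>] by (simp add: ip_ract star_mult ract_closed)

lemma ip_sum_list:
  "\<xi> \<in> elems Y \<Longrightarrow> (\<And>x. x \<in> set xs \<Longrightarrow> f x \<in> elems Y) \<Longrightarrow> ip Y \<xi> (\<Sum>x\<leftarrow>xs. f x) = (\<Sum>x\<leftarrow>xs. ip Y \<xi> (f x))"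
  by (induction xs) (auto simp: ip_add)

lemma elems_eqI:
  assumes "\<xi> \<in> elems Y" "\<zeta> \<in> elems Y" "\<And>\<eta>. \<eta> \<in> elems Y \<Longrightarrow> ip Y \<eta> \<xi> = ip Y \<eta> \<zeta>"
  shows "\<xi> = \<zeta>"
  using ip_definite[of "\<xi> - \<zeta>"] assms(3)[of "\<xi> - \<zeta>"] assms by (simp add: ip_diff)

lemma hnorm_sq: "(hnorm Y \<xi>)\<^sup>2 = norm (ip Y \<xi> \<xi>)"
  by (simp add: hnorm_def)

lemma hnorm_nonneg [simp]: "0 \<le> hnorm Y \<xi>"
  by (simp add: hnorm_def)

lemma hnorm_zero [simp]: "hnorm Y 0 = 0"
  by (simp add: hnorm_def)

lemma hnorm_eq_0: "\<xi> \<in> elems Y \<Longrightarrow> hnorm Y \<xi> = 0 \<Longrightarrow> \<xi> = 0"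
  by (simp add: hnorm_def ip_definite)

lemma ip_form:
  assumes "\<xi> \<in> elems Y" "\<eta> \<in> elems Y"
  shows "pos_element (star a * ip Y \<xi> \<xi> * a - star a * ip Y \<xi> \<eta> - star (ip Y \<xi> \<eta>) * a + ip Y \<eta> \<eta>)"
proof -
  let ?\<zeta> = "ract Y \<xi> a"
  have "ip Y (\<eta> - ?\<zeta>) (\<eta> - ?\<zeta>)
    = star a * ip Y \<xi> \<xi> * a - star a * ip Y \<xi> \<eta> - star (ip Y \<xi> \<eta>) * a + ip Y \<eta> \<eta>"
    using assms by (simp add: ip_diff ip_diff_left ip_ract ip_ract_left ip_star algebra_simps)
  then show ?thesis
    using assms ip_pos[of "\<eta> - ?\<zeta>"] by simp
qed

lemma ip_cauchy_schwarz_pos: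
  assumes "\<xi> \<in> elems Y" "\<eta> \<in> elems Y"
  shows "pos_element ((hnorm Y \<xi>)\<^sup>2 *\<^sub>R ip Y \<eta> \<eta> - star (ip Y \<xi> \<eta>) * ip Y \<xi> \<eta>)"
  using ip_form[OF assms] ip_pos[OF assms(1)] by (rule cauchy_schwarz_pos) (simp add: hnorm_sq)

lemma ip_cauchy_schwarz:
  assumes "\<xi> \<in> elems Y" "\<eta> \<in> elems Y"
  shows "norm (ip Y \<xi> \<eta>) \<le> hnorm Y \<xi> * hnorm Y \<eta>"
proof (rule power2_le_imp_le)
  show "(norm (ip Y \<xi> \<eta>))\<^sup>2 \<le> (hnorm Y \<xi> * hnorm Y \<eta>)\<^sup>2"
    using cauchy_schwarz_norm[OF ip_form[OF assms] ip_pos ip_pos] assms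
    by (simp add: power_mult_distrib hnorm_sq)
qed simp

lemma hnorm_triangle:
  assumes "\<xi> \<in> elems Y" "\<eta> \<in> elems Y"
  shows "hnorm Y (\<xi> + \<eta>) \<le> hnorm Y \<xi> + hnorm Y \<eta>"
proof (rule power2_le_imp_le)
  have "norm (ip Y (\<xi> + \<eta>) (\<xi> + \<eta>))
    \<le> norm (ip Y \<xi> \<xi>) + norm (ip Y \<xi> \<eta>) + (norm (ip Y \<eta> \<xi>) + norm (ip Y \<eta> \<eta>))"
    using assms by (simp add: ip_add ip_add_left norm_triangle_mono add_ac)
  also have "\<dots> \<le> (hnorm Y \<xi>)\<^sup>2 + hnorm Y \<xi> * hnorm Y \<eta> + (hnorm Y \<eta> * hnorm Y \<xi> + (hnorm Y \<eta>)\<^sup>2)"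
    using assms ip_cauchy_schwarz by (intro add_mono) (auto simp: hnorm_sq)
  finally show "(hnorm Y (\<xi> + \<eta>))\<^sup>2 \<le> (hnorm Y \<xi> + hnorm Y \<eta>)\<^sup>2"
    by (simp add: hnorm_sq[symmetric] power2_sum algebra_simps)
qed simp

lemma hnorm_scaleC: "\<xi> \<in> elems Y \<Longrightarrow> hnorm Y (c *\<^sub>C \<xi>) = cmod c * hnorm Y \<xi>"
  by (simp add: hnorm_def ip_scaleC ip_scaleC_left norm_scaleC real_sqrt_mult complex_mod_mult_cnj)

lemma hnorm_scaleR: "\<xi> \<in> elems Y \<Longrightarrow> hnorm Y (r *\<^sub>R \<xi>) = \<bar>r\<bar> * hnorm Y \<xi>"
  by (simp add: scaleR_scaleC hnorm_scaleC)

lemma hnorm_minus_commute: "\<xi> \<in> elems Y \<Longrightarrow> \<eta> \<in> elems Y \<Longrightarrow> hnorm Y (\<xi> - \<eta>) = hnorm Y (\<eta> - \<xi>)"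
  using hnorm_scaleR[of "\<xi> - \<eta>" "-1"] by simp

lemma hnorm_triangle_diff:
  "\<xi> \<in> elems Y \<Longrightarrow> \<eta> \<in> elems Y \<Longrightarrow> \<zeta> \<in> elems Y \<Longrightarrow> hnorm Y (\<xi> - \<zeta>) \<le> hnorm Y (\<xi> - \<eta>) + hnorm Y (\<eta> - \<zeta>)"
  using hnorm_triangle[of "\<xi> - \<eta>" "\<eta> - \<zeta>"] by simp

lemma hnorm_sum_list:
  "(\<And>x. x \<in> set xs \<Longrightarrow> f x \<in> elems Y) \<Longrightarrow> hnorm Y (\<Sum>x\<leftarrow>xs. f x) \<le> (\<Sum>x\<leftarrow>xs. hnorm Y (f x))"
proof (induction xs)
  case (Cons x xs)
  then show ?case
    using hnorm_triangle[of "f x" "\<Sum>x\<leftarrow>xs. f x"] by fastforce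
qed simp

text \<open>
  Operators are ordinary functions whose values outside the module are irrelevant; additivity,
  homogeneity and the module property all follow from the existence of an adjoint.
\<close>

definition adjoint_pair :: "('x \<Rightarrow> 'x) \<Rightarrow> ('x \<Rightarrow> 'x) \<Rightarrow> bool" where
  "adjoint_pair T S \<longleftrightarrow> (\<forall>\<xi>\<in>elems Y. T \<xi> \<in> elems Y \<and> S \<xi> \<in> elems Y) \<and>
     (\<forall>\<xi>\<in>elems Y. \<forall>\<zeta>\<in>elems Y. ip Y (T \<xi>) \<zeta> = ip Y \<xi> (S \<zeta>))"

lemma adjoint_pairD:
  assumes "adjoint_pair T S"
  shows "\<xi> \<in> elems Y \<Longrightarrow> T \<xi> \<in> elems Y" "\<xi> \<in> elems Y \<Longrightarrow> S \<xi> \<in> elems Y"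
    "\<xi> \<in> elems Y \<Longrightarrow> \<zeta> \<in> elems Y \<Longrightarrow> ip Y (T \<xi>) \<zeta> = ip Y \<xi> (S \<zeta>)"
  using assms by (auto simp: adjoint_pair_def)

lemma adjoint_pair_sym: "adjoint_pair T S \<Longrightarrow> adjoint_pair S T"
  unfolding adjoint_pair_def by (metis ip_star)

lemma adjoint_pair_linear:
  assumes "adjoint_pair T S"
  shows adjoint_pair_add: "\<xi> \<in> elems Y \<Longrightarrow> \<zeta> \<in> elems Y \<Longrightarrow> T (\<xi> + \<zeta>) = T \<xi> + T \<zeta>"
    and adjoint_pair_diff: "\<xi> \<in> elems Y \<Longrightarrow> \<zeta> \<in> elems Y \<Longrightarrow> T (\<xi> - \<zeta>) = T \<xi> - T \<zeta>"
    and adjoint_pair_scaleR: "\<xi> \<in> elems Y \<Longrightarrow> T (r *\<^sub>R \<xi>) = r *\<^sub>R T \<xi>"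
    and adjoint_pair_ract: "\<xi> \<in> elems Y \<Longrightarrow> T (ract Y \<xi> a) = ract Y (T \<xi>) a"
proof -
  note S = adjoint_pairD[OF adjoint_pair_sym[OF assms]]
  show "\<xi> \<in> elems Y \<Longrightarrow> \<zeta> \<in> elems Y \<Longrightarrow> T (\<xi> + \<zeta>) = T \<xi> + T \<zeta>"
    by (rule elems_eqI) (auto simp: S(1,2) S(3)[symmetric] ip_add)
  show "\<xi> \<in> elems Y \<Longrightarrow> \<zeta> \<in> elems Y \<Longrightarrow> T (\<xi> - \<zeta>) = T \<xi> - T \<zeta>"
    by (rule elems_eqI) (auto simp: S(1,2) S(3)[symmetric] ip_diff)
  show "\<xi> \<in> elems Y \<Longrightarrow> T (r *\<^sub>R \<xi>) = r *\<^sub>R T \<xi>"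
    by (rule elems_eqI) (auto simp: S(1,2) S(3)[symmetric] ip_scaleR)
  show "\<xi> \<in> elems Y \<Longrightarrow> T (ract Y \<xi> a) = ract Y (T \<xi>) a"
    by (rule elems_eqI) (auto simp: S(1,2) S(3)[symmetric] ip_ract)
qed

lemma adjoint_pair_zero: "adjoint_pair T S \<Longrightarrow> T 0 = 0"
  using adjoint_pair_scaleR[of T S 0 0] by simp

lemma adjoint_pair_sum_list:
  "adjoint_pair T S \<Longrightarrow> (\<And>x. x \<in> set xs \<Longrightarrow> f x \<in> elems Y) \<Longrightarrow> T (\<Sum>x\<leftarrow>xs. f x) = (\<Sum>x\<leftarrow>xs. T (f x))"
  by (induction xs) (auto simp: adjoint_pair_zero adjoint_pair_add)

lemma adjoint_pair_funpow: "adjoint_pair S S \<Longrightarrow> adjoint_pair (S ^^ n) (S ^^ n)"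
proof (induction n)
  case (Suc n)
  have "S ((S ^^ n) \<zeta>) = (S ^^ n) (S \<zeta>)" for \<zeta>
    by (rule funpow_swap1)
  with Suc show ?case
    unfolding adjoint_pair_def by simp
qed (simp add: adjoint_pair_def)

lemma hnorm_limit_unique:
  assumes "\<xi> \<in> elems Y" "\<zeta> \<in> elems Y" "\<And>n. u n \<in> elems Y"
    and "(\<lambda>n. hnorm Y (u n - \<xi>)) \<longlonglongrightarrow> 0" "(\<lambda>n. hnorm Y (u n - \<zeta>)) \<longlonglongrightarrow> 0"
  shows "\<xi> = \<zeta>"
proof -
  have "hnorm Y (\<xi> - \<zeta>) \<le> hnorm Y (u n - \<xi>) + hnorm Y (u n - \<zeta>)" for n
    using hnorm_triangle_diff[of \<xi> "u n" \<zeta>] hnorm_minus_commute[of \<xi> "u n"] assms by simp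
  moreover have "(\<lambda>n. hnorm Y (u n - \<xi>) + hnorm Y (u n - \<zeta>)) \<longlonglongrightarrow> 0"
    by (intro tendsto_add_zero assms)
  ultimately have "hnorm Y (\<xi> - \<zeta>) \<le> 0"
    by (intro LIMSEQ_le_const) auto
  then show ?thesis
    using hnorm_eq_0[of "\<xi> - \<zeta>"] assms by (simp add: order_antisym)
qed

lemma ip_limit:
  assumes "\<xi> \<in> elems Y" "\<zeta> \<in> elems Y" "\<And>n. u n \<in> elems Y" "(\<lambda>n. hnorm Y (u n - \<xi>)) \<longlonglongrightarrow> 0"
  shows "(\<lambda>n. ip Y \<zeta> (u n)) \<longlonglongrightarrow> ip Y \<zeta> \<xi>"
proof (rule LIM_zero_cancel, rule Lim_null_comparison)
  show "(\<lambda>n. hnorm Y \<zeta> * hnorm Y (u n - \<xi>)) \<longlonglongrightarrow> 0"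
    by (intro tendsto_mult_right_zero assms)
  show "\<forall>\<^sub>F n in sequentially. norm (ip Y \<zeta> (u n) - ip Y \<zeta> \<xi>) \<le> hnorm Y \<zeta> * hnorm Y (u n - \<xi>)"
    using ip_cauchy_schwarz[OF assms(2)] assms by (simp add: ip_diff[symmetric])
qed

text \<open>
  The iteration of \<open>sqrt_one_minus\<close>, now run pointwise in the complete module.
\<close>

lemma sqrt_one_minus_operator:
  assumes K: "adjoint_pair K K" and contr: "\<And>\<xi>. \<xi> \<in> elems Y \<Longrightarrow> hnorm Y (K \<xi>) \<le> hnorm Y \<xi>"
  obtains S where "adjoint_pair S S" "\<And>\<xi>. \<xi> \<in> elems Y \<Longrightarrow> S (S \<xi>) = \<xi> - K \<xi>"
proof -
  define R where "R = rec_nat (\<lambda>\<xi>::'x. 0::'x) (\<lambda>n R \<xi>. (1/2) *\<^sub>R (K \<xi> + R (R \<xi>)))"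
  have R0: "R 0 \<xi> = 0" and RS: "R (Suc n) \<xi> = (1/2) *\<^sub>R (K \<xi> + R n (R n \<xi>))" for n \<xi>
    by (simp_all add: R_def)
  have adj: "adjoint_pair (R n) (R n)" for n
  proof (induction n)
    case (Suc n)
    note D = adjoint_pairD[OF K] adjoint_pairD[OF Suc]
    show ?case
      unfolding adjoint_pair_def by (auto simp: RS D ip_scaleR ip_scaleR_left ip_add ip_add_left)
  qed (simp add: adjoint_pair_def R0)
  note R_closed [simp] = adjoint_pairD(1)[OF adj]
  note K_closed [simp] = adjoint_pairD(1)[OF K]
  have norm_R: "\<xi> \<in> elems Y \<Longrightarrow> hnorm Y (R n \<xi>) \<le> sqrt_majorant n * hnorm Y \<xi>" for n \<xi>
  proof (induction n arbitrary: \<xi>)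
    case (Suc n)
    have "hnorm Y (K \<xi> + R n (R n \<xi>)) \<le> hnorm Y \<xi> + sqrt_majorant n * (sqrt_majorant n * hnorm Y \<xi>)"
      using Suc.prems Suc.IH[of \<xi>] Suc.IH[of "R n \<xi>"] contr[of \<xi>] sqrt_majorant_bounds[of n]
        mult_left_mono[OF Suc.IH[OF Suc.prems], of "sqrt_majorant n"]
      by (intro order_trans[OF hnorm_triangle] add_mono) auto
    then show ?case
      using Suc.prems by (simp add: RS hnorm_scaleR power2_eq_square distrib_right mult.assoc)
  qed (simp add: R0)
  have diff_R: "\<xi> \<in> elems Y \<Longrightarrow>
      hnorm Y (R (n + k) \<xi> - R n \<xi>) \<le> (sqrt_majorant (n + k) - sqrt_majorant n) * hnorm Y \<xi>" for n k \<xi>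
  proof (induction n arbitrary: \<xi>)
    case (Suc n)
    note [simp] = Suc.prems
    let ?x = "R (n + k)" and ?y = "R n" and ?r = "sqrt_majorant (n + k)" and ?q = "sqrt_majorant n"
    have le: "0 \<le> ?r - ?q"
      using incseq_sqrt_majorant by (simp add: incseq_def)
    have "hnorm Y (?x (?x \<xi>) - ?y (?x \<xi>)) \<le> (?r - ?q) * (?r * hnorm Y \<xi>)"
      using Suc.IH[of "?x \<xi>"] mult_left_mono[OF norm_R[of \<xi> "n + k"] le] by simp
    moreover have "hnorm Y (?y (?x \<xi> - ?y \<xi>)) \<le> ?q * ((?r - ?q) * hnorm Y \<xi>)"
      using norm_R[of "?x \<xi> - ?y \<xi>" n] mult_left_mono[OF Suc.IH[of \<xi>], of ?q] sqrt_majorant_bounds[of n]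
      by simp
    moreover have eq: "R (Suc n + k) \<xi> - R (Suc n) \<xi>
        = (1/2) *\<^sub>R ((?x (?x \<xi>) - ?y (?x \<xi>)) + ?y (?x \<xi> - ?y \<xi>))"
      by (simp add: RS adjoint_pair_diff[OF adj] scaleR_right_diff_distrib[symmetric])
    ultimately have "hnorm Y (R (Suc n + k) \<xi> - R (Suc n) \<xi>)
        \<le> (1/2) * ((?r - ?q) * (?r * hnorm Y \<xi>) + ?q * ((?r - ?q) * hnorm Y \<xi>))"
      unfolding eq
      using hnorm_triangle[of "?x (?x \<xi>) - ?y (?x \<xi>)" "?y (?x \<xi> - ?y \<xi>)"] by (simp add: hnorm_scaleR)
    also have "\<dots> = (sqrt_majorant (Suc n + k) - sqrt_majorant (Suc n)) * hnorm Y \<xi>"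
      by (simp add: power2_eq_square field_simps)
    finally show ?case .
  qed (simp add: R0 norm_R)
  have "\<exists>\<zeta>\<in>elems Y. (\<lambda>n. hnorm Y (R n \<xi> - \<zeta>)) \<longlonglongrightarrow> 0" if \<xi> [simp]: "\<xi> \<in> elems Y" for \<xi>
  proof (rule complete)
    fix e :: real
    assume "0 < e"
    have "0 < e / (1 + hnorm Y \<xi>)"
      using \<open>0 < e\<close> by (intro divide_pos_pos add_pos_nonneg) auto
    then obtain M where M: "\<And>m n. M \<le> m \<Longrightarrow> M \<le> n \<Longrightarrow> \<bar>sqrt_majorant m - sqrt_majorant n\<bar> < e / (1 + hnorm Y \<xi>)"
      using Cauchy_sqrt_majorant unfolding Cauchy_def dist_real_def by meson
    have le: "hnorm Y (R (n + k) \<xi> - R n \<xi>) < e" if "M \<le> n" for n k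
    proof -
      have "(sqrt_majorant (n + k) - sqrt_majorant n) * hnorm Y \<xi> \<le> e / (1 + hnorm Y \<xi>) * hnorm Y \<xi>"
        using M[of "n + k" n] that by (intro mult_right_mono) auto
      also have "\<dots> < e"
        using \<open>0 < e\<close> by (simp add: field_simps add_pos_nonneg)
      finally show ?thesis
        using diff_R[OF \<xi>, of n k] by linarith
    qed
    have "hnorm Y (R m \<xi> - R n \<xi>) < e" if "M \<le> m" "M \<le> n" for m n
      using le[of n "m - n"] le[of m "n - m"] that hnorm_minus_commute[of "R m \<xi>" "R n \<xi>"]
      by (cases "m \<le> n") auto
    then show "\<exists>n0. \<forall>m\<ge>n0. \<forall>n\<ge>n0. hnorm Y (R m \<xi> - R n \<xi>) < e"
      by blast
  qed simp
  then obtain L where L: "\<And>\<xi>. \<xi> \<in> elems Y \<Longrightarrow> L \<xi> \<in> elems Y"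
    "\<And>\<xi>. \<xi> \<in> elems Y \<Longrightarrow> (\<lambda>n. hnorm Y (R n \<xi> - L \<xi>)) \<longlonglongrightarrow> 0"
    by metis
  note [simp] = L(1)
  have ipL: "ip Y \<xi> (L \<zeta>) = ip Y (L \<xi>) \<zeta>" if [simp]: "\<xi> \<in> elems Y" "\<zeta> \<in> elems Y" for \<xi> \<zeta>
  proof -
    have "(\<lambda>n. ip Y \<xi> (R n \<zeta>)) \<longlonglongrightarrow> ip Y \<xi> (L \<zeta>)"
      by (rule ip_limit) (auto simp: L)
    moreover have "(\<lambda>n. star (ip Y \<zeta> (R n \<xi>))) \<longlonglongrightarrow> star (ip Y \<zeta> (L \<xi>))"
      by (intro bounded_linear.tendsto[OF bounded_linear_star] ip_limit) (auto simp: L)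
    then have "(\<lambda>n. ip Y \<xi> (R n \<zeta>)) \<longlonglongrightarrow> ip Y (L \<xi>) \<zeta>"
      by (simp add: ip_star adjoint_pairD(3)[OF adj])
    ultimately show ?thesis
      by (rule LIMSEQ_unique)
  qed
  then have adjL: "adjoint_pair L L"
    by (simp add: adjoint_pair_def)
  have fixpoint: "L (L \<xi>) = 2 *\<^sub>R L \<xi> - K \<xi>" if [simp]: "\<xi> \<in> elems Y" for \<xi>
  proof (rule hnorm_limit_unique)
    show "R n (R n \<xi>) \<in> elems Y" for n
      by simp
    have "hnorm Y (R n (R n \<xi>) - L (L \<xi>)) \<le> hnorm Y (R n \<xi> - L \<xi>) + hnorm Y (R n (L \<xi>) - L (L \<xi>))" for n
    proof -
      have "hnorm Y (R n (R n \<xi> - L \<xi>)) \<le> 1 * hnorm Y (R n \<xi> - L \<xi>)"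
        using sqrt_majorant_bounds[of n] by (intro order_trans[OF norm_R] mult_right_mono) auto
      then show ?thesis
        using hnorm_triangle_diff[of "R n (R n \<xi>)" "R n (L \<xi>)" "L (L \<xi>)"]
        by (simp add: adjoint_pair_diff[OF adj])
    qed
    then show "(\<lambda>n. hnorm Y (R n (R n \<xi>) - L (L \<xi>))) \<longlonglongrightarrow> 0"
      by (intro Lim_null_comparison[OF _ tendsto_add_zero[OF L(2)[of \<xi>] L(2)[of "L \<xi>"]]]) auto
    have "R n (R n \<xi>) - (2 *\<^sub>R L \<xi> - K \<xi>) = 2 *\<^sub>R (R (Suc n) \<xi> - L \<xi>)" for n
      by (simp add: RS scaleR_right_diff_distrib)
    then have "(\<lambda>n. hnorm Y (R n (R n \<xi>) - (2 *\<^sub>R L \<xi> - K \<xi>))) = (\<lambda>n. 2 * hnorm Y (R (Suc n) \<xi> - L \<xi>))"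
      by (simp add: hnorm_scaleR)
    then show "(\<lambda>n. hnorm Y (R n (R n \<xi>) - (2 *\<^sub>R L \<xi> - K \<xi>))) \<longlonglongrightarrow> 0"
      using tendsto_mult_right_zero[OF LIMSEQ_Suc[OF L(2)[of \<xi>]], of 2] by simp
  qed simp_all
  show ?thesis
  proof
    show "adjoint_pair (\<lambda>\<xi>. \<xi> - L \<xi>) (\<lambda>\<xi>. \<xi> - L \<xi>)"
      unfolding adjoint_pair_def by (simp add: ip_diff ip_diff_left ipL)
    show "\<xi> - L \<xi> - L (\<xi> - L \<xi>) = \<xi> - K \<xi>" if "\<xi> \<in> elems Y" for \<xi>
      using that by (simp add: adjoint_pair_diff[OF adjL] fixpoint scaleR_2)
  qed
qed

section \<open>Admissible families\<close>

text \<open>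
  The operator $\sum_\xi \theta_{\xi,\xi}$ of a family. Families are lists, because products of distinct
  pairs of vectors may coincide in a tensor product.
\<close>

definition frame_op :: "'x list \<Rightarrow> 'x \<Rightarrow> 'x" where
  "frame_op xs \<eta> = (\<Sum>\<xi>\<leftarrow>xs. ract Y \<xi> (ip Y \<xi> \<eta>))"

definition admissible :: "'x list \<Rightarrow> bool" where
  "admissible xs \<longleftrightarrow> set xs \<subseteq> elems Y \<and>
     (\<forall>\<eta>\<in>elems Y. pos_element (ip Y \<eta> \<eta> - (\<Sum>\<xi>\<leftarrow>xs. star (ip Y \<xi> \<eta>) * ip Y \<xi> \<eta>)))"

lemma frame_op_closed [simp]: "set xs \<subseteq> elems Y \<Longrightarrow> \<eta> \<in> elems Y \<Longrightarrow> frame_op xs \<eta> \<in> elems Y"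
  by (auto simp: frame_op_def)

lemma ip_frame_op:
  assumes "set xs \<subseteq> elems Y" "\<eta> \<in> elems Y" "\<zeta> \<in> elems Y"
  shows "ip Y \<zeta> (frame_op xs \<eta>) = (\<Sum>\<xi>\<leftarrow>xs. star (ip Y \<xi> \<zeta>) * ip Y \<xi> \<eta>)"
  using assms by (simp add: frame_op_def ip_sum_list ip_ract ip_star subset_eq cong: map_cong)

lemma adjoint_pair_frame_op: "set xs \<subseteq> elems Y \<Longrightarrow> adjoint_pair (frame_op xs) (frame_op xs)"
  unfolding adjoint_pair_def
proof safe
  fix \<xi> \<zeta>
  assume xs: "set xs \<subseteq> elems Y" and [simp]: "\<xi> \<in> elems Y" "\<zeta> \<in> elems Y"
  have "ip Y (frame_op xs \<xi>) \<zeta> = star (\<Sum>x\<leftarrow>xs. star (ip Y x \<zeta>) * ip Y x \<xi>)"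
    using xs by (simp add: ip_frame_op[symmetric] ip_star)
  also have "\<dots> = (\<Sum>x\<leftarrow>xs. star (ip Y x \<xi>) * ip Y x \<zeta>)"
    by (induction xs) (simp_all add: star_add star_mult star_star)
  finally show "ip Y (frame_op xs \<xi>) \<zeta> = ip Y \<xi> (frame_op xs \<zeta>)"
    using xs by (simp add: ip_frame_op)
qed simp_all

lemma pos_sum_list: "(\<And>x. x \<in> set xs \<Longrightarrow> pos_element (f x :: 'a)) \<Longrightarrow> pos_element (\<Sum>x\<leftarrow>xs. f x)"
  by (induction xs) (auto intro: pos_add)

text \<open>
  The Cauchy-Schwarz inequality for the positive form \<open>\<langle>\<zeta>, k \<eta>\<rangle>\<close> with \<open>k\<close> the operator of the
  family, taken at \<open>\<zeta> = k \<eta>\<close>.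
\<close>

lemma frame_op_contraction:
  assumes xs: "admissible xs" and \<eta> [simp]: "\<eta> \<in> elems Y"
  shows "hnorm Y (frame_op xs \<eta>) \<le> hnorm Y \<eta>"
proof -
  have sub: "set xs \<subseteq> elems Y"
    using xs by (simp add: admissible_def)
  note adj = adjoint_pair_frame_op[OF sub]
  let ?B = "\<lambda>\<zeta> \<eta>. ip Y \<zeta> (frame_op xs \<eta>)"
  have pos: "pos_element (?B \<zeta> \<zeta>)" if "\<zeta> \<in> elems Y" for \<zeta>
    using that sub by (auto simp: ip_frame_op intro!: pos_sum_list)
  have le: "norm (?B \<zeta> \<zeta>) \<le> (hnorm Y \<zeta>)\<^sup>2" if "\<zeta> \<in> elems Y" for \<zeta>
    unfolding hnorm_sq using xs that pos[OF that]
    by (intro pos_norm_mono) (auto simp: admissible_def ip_frame_op)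
  let ?\<zeta> = "frame_op xs \<eta>"
  have "pos_element (star a * ?B ?\<zeta> ?\<zeta> * a - star a * ?B ?\<zeta> \<eta> - star (?B ?\<zeta> \<eta>) * a + ?B \<eta> \<eta>)" for a
  proof -
    let ?\<xi> = "\<eta> - ract Y ?\<zeta> a"
    have "?B ?\<xi> ?\<xi> = star a * ?B ?\<zeta> ?\<zeta> * a - star a * ?B ?\<zeta> \<eta> - star (?B ?\<zeta> \<eta>) * a + ?B \<eta> \<eta>"
      using sub
      by (simp add: ip_diff ip_diff_left ip_ract ip_ract_left ip_star algebra_simps
          adjoint_pair_linear[OF adj] adjoint_pairD[OF adj])
    then show ?thesis
      using pos[of ?\<xi>] sub by simp
  qed
  then have "(norm (?B ?\<zeta> \<eta>))\<^sup>2 \<le> norm (?B ?\<zeta> ?\<zeta>) * norm (?B \<eta> \<eta>)"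
    using pos[of ?\<zeta>] pos[of \<eta>] sub by (intro cauchy_schwarz_norm) auto
  also have "\<dots> \<le> (hnorm Y ?\<zeta>)\<^sup>2 * (hnorm Y \<eta>)\<^sup>2"
    using le[of ?\<zeta>] le[of \<eta>] sub by (intro mult_mono) auto
  finally have "(hnorm Y ?\<zeta>)\<^sup>2 * (hnorm Y ?\<zeta>)\<^sup>2 \<le> (hnorm Y ?\<zeta>)\<^sup>2 * (hnorm Y \<eta>)\<^sup>2"
    using hnorm_sq[of ?\<zeta>] by (simp add: power2_eq_square)
  then have "(hnorm Y ?\<zeta>)\<^sup>2 \<le> (hnorm Y \<eta>)\<^sup>2 \<or> hnorm Y ?\<zeta> = 0"
    using mult_le_cancel_left_pos[of "(hnorm Y ?\<zeta>)\<^sup>2"] by fastforce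
  then show ?thesis
    by (auto intro: power2_le_imp_le)
qed

lemma admissible_root:
  assumes "admissible xs"
  obtains S where "adjoint_pair S S" "\<And>\<xi>. \<xi> \<in> elems Y \<Longrightarrow> S (S \<xi>) = \<xi> - frame_op xs \<xi>"
  using assms sqrt_one_minus_operator[OF adjoint_pair_frame_op frame_op_contraction[OF assms]]
  by (auto simp: admissible_def)

lemma adj_op_eq:
  assumes "adjoint_pair T S"
  shows "restrict T (elems Y) \<in> adjointable Y" "adj_op Y (restrict T (elems Y)) = restrict S (elems Y)"
proof -
  note D = adjoint_pairD[OF assms]
  show "restrict T (elems Y) \<in> adjointable Y"
    unfolding adjointable_def using D by (auto intro!: bexI[of _ "restrict S (elems Y)"])
  show "adj_op Y (restrict T (elems Y)) = restrict S (elems Y)"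
    unfolding adj_op_def
  proof (rule the_equality)
    fix S'
    assume S': "S' \<in> elems Y \<rightarrow>\<^sub>E elems Y \<and>
      (\<forall>\<xi>\<in>elems Y. \<forall>\<zeta>\<in>elems Y. ip Y (restrict T (elems Y) \<xi>) \<zeta> = ip Y \<xi> (S' \<zeta>))"
    show "S' = restrict S (elems Y)"
    proof (rule PiE_ext)
      show "S' \<in> elems Y \<rightarrow>\<^sub>E elems Y" "restrict S (elems Y) \<in> elems Y \<rightarrow>\<^sub>E elems Y"
        using S' D by auto
      fix \<zeta>
      assume "\<zeta> \<in> elems Y"
      moreover from this have "S' \<zeta> \<in> elems Y"
        using S' by auto
      ultimately show "S' \<zeta> = restrict S (elems Y) \<zeta>"
        using S' D by (intro elems_eqI) auto
    qed
  qed (use D in auto)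
qed

lemma adjointable_obtain_adjoint:
  assumes "T \<in> adjointable Y"
  shows "adjoint_pair T (adj_op Y T)"
proof -
  obtain S where S: "T \<in> elems Y \<rightarrow>\<^sub>E elems Y" "S \<in> elems Y \<rightarrow>\<^sub>E elems Y"
    "\<forall>\<xi>\<in>elems Y. \<forall>\<zeta>\<in>elems Y. ip Y (T \<xi>) \<zeta> = ip Y \<xi> (S \<zeta>)"
    using assms by (auto simp: adjointable_def)
  then have "adjoint_pair T S"
    by (auto simp: adjoint_pair_def)
  then have "adj_op Y T = S"
    using adj_op_eq(2) S by (metis PiE_restrict)
  then show ?thesis
    using \<open>adjoint_pair T S\<close> by simp
qed

text \<open>
  An inequality of forms becomes an inequality of operators through the square root of
  \<open>1 - frame_op xs\<close>.
\<close>

lemma tr_admissible_iff: "distinct xs \<Longrightarrow> tr_admissible Y (set xs) \<longleftrightarrow> admissible xs"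
proof -
  assume "distinct xs"
  then have frame: "(\<lambda>\<eta>\<in>elems Y. \<Sum>\<xi>\<in>set xs. theta Y \<xi> \<xi> \<eta>) = restrict (frame_op xs) (elems Y)"
    by (intro restrict_ext) (simp add: frame_op_def theta_def sum_list_distinct_conv_sum_set)
  have diff: "(\<lambda>\<eta>\<in>elems Y. id_op Y \<eta> - restrict (frame_op xs) (elems Y) \<eta>) = (\<lambda>\<eta>\<in>elems Y. \<eta> - frame_op xs \<eta>)"
    by (intro restrict_ext) (simp add: id_op_def)
  show ?thesis
  proof
    assume "tr_admissible Y (set xs)"
    then obtain S where xs: "set xs \<subseteq> elems Y" and S: "S \<in> adjointable Y"
      and eq: "(\<lambda>\<eta>\<in>elems Y. \<eta> - frame_op xs \<eta>) = compose (elems Y) (adj_op Y S) S"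
      unfolding tr_admissible_def op_le_def pos_op_def frame diff by auto
    note D = adjoint_pairD[OF adjointable_obtain_adjoint[OF S]]
    have "pos_element (ip Y \<eta> \<eta> - (\<Sum>\<xi>\<leftarrow>xs. star (ip Y \<xi> \<eta>) * ip Y \<xi> \<eta>))" if \<eta>: "\<eta> \<in> elems Y" for \<eta>
    proof -
      have "\<eta> - frame_op xs \<eta> = adj_op Y S (S \<eta>)"
        using fun_cong[OF eq, of \<eta>] \<eta> by (simp add: compose_def)
      then have "ip Y \<eta> (\<eta> - frame_op xs \<eta>) = ip Y (S \<eta>) (S \<eta>)"
        using \<eta> by (simp add: D)
      then show ?thesis
        using xs \<eta> ip_pos[of "S \<eta>"] D(1) by (simp add: ip_diff ip_frame_op)
    qed
    then show "admissible xs"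
      using xs by (auto simp: admissible_def)
  next
    assume xs: "admissible xs"
    obtain S where S: "adjoint_pair S S" "\<And>\<xi>. \<xi> \<in> elems Y \<Longrightarrow> S (S \<xi>) = \<xi> - frame_op xs \<xi>"
      using admissible_root[OF xs] by metis
    have "(\<lambda>\<eta>\<in>elems Y. \<eta> - frame_op xs \<eta>)
        = compose (elems Y) (restrict S (elems Y)) (restrict S (elems Y))"
      unfolding compose_def using S(2) adjoint_pairD(1)[OF S(1)] by (intro restrict_ext) simp
    then have "pos_op Y (\<lambda>\<eta>\<in>elems Y. \<eta> - frame_op xs \<eta>)"
      unfolding pos_op_def using adj_op_eq[OF S(1)] by metis
    then show "tr_admissible Y (set xs)"
      unfolding tr_admissible_def op_le_def frame diff using xs by (simp add: admissible_def)
  qed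
qed

end

section \<open>Approximate units\<close>

lemma sum_list_swap:
  "(\<Sum>x\<leftarrow>xs. \<Sum>y\<leftarrow>ys. f x y) = (\<Sum>y\<leftarrow>ys. \<Sum>x\<leftarrow>xs. f x y :: 'b::comm_monoid_add)"
  by (induction xs) (simp_all add: sum_list_addf)

context hilbert_module
begin

definition almost_fixes :: "'x list \<Rightarrow> 'x list \<Rightarrow> real \<Rightarrow> bool" where
  "almost_fixes xs F \<delta> \<longleftrightarrow> set xs \<subseteq> elems Y \<and> (\<forall>\<eta>\<in>set F. hnorm Y (\<eta> - frame_op xs \<eta>) < \<delta>)"

lemma frame_op_append: "frame_op (xs @ ys) \<eta> = frame_op xs \<eta> + frame_op ys \<eta>"
  by (simp add: frame_op_def)

lemma frame_op_adjoint_image: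
  assumes S: "adjoint_pair S S" and xs: "set xs \<subseteq> elems Y" and \<eta>: "\<eta> \<in> elems Y"
  shows "frame_op (map S xs) \<eta> = S (frame_op xs (S \<eta>))"
proof -
  note D = adjoint_pairD[OF S]
  have "S (frame_op xs (S \<eta>)) = (\<Sum>\<xi>\<leftarrow>xs. S (ract Y \<xi> (ip Y \<xi> (S \<eta>))))"
    unfolding frame_op_def using xs \<eta> by (intro adjoint_pair_sum_list[OF S]) (auto simp: D)
  also have "\<dots> = (\<Sum>\<xi>\<leftarrow>xs. ract Y (S \<xi>) (ip Y (S \<xi>) \<eta>))"
    using xs \<eta> by (intro arg_cong[where f = sum_list] map_cong) (auto simp: D adjoint_pair_ract[OF S])
  finally show ?thesis
    by (simp add: frame_op_def o_def)
qed

lemma pos_sum_list_minus_member: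
  assumes "\<And>x. x \<in> set xs \<Longrightarrow> pos_element (f x :: 'a)" "y \<in> set xs"
  shows "pos_element ((\<Sum>x\<leftarrow>xs. f x) - f y)"
proof -
  obtain us vs where "xs = us @ y # vs"
    using split_list assms(2) by metis
  then have "(\<Sum>x\<leftarrow>xs. f x) - f y = (\<Sum>x\<leftarrow>us. f x) + (\<Sum>x\<leftarrow>vs. f x)"
    by (simp add: algebra_simps)
  then show ?thesis
    using assms(1) \<open>xs = us @ y # vs\<close> by (auto intro!: pos_add pos_sum_list)
qed

lemma admissible_scaled:
  assumes xs: "set xs \<subseteq> elems Y"
  obtains s where "0 < s" "admissible (map (\<lambda>\<xi>. s *\<^sub>R \<xi>) xs)"
proof
  define N where "N = (\<Sum>\<xi>\<leftarrow>xs. (hnorm Y \<xi>)\<^sup>2)"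
  have "0 \<le> N"
    unfolding N_def by (rule sum_list_nonneg) auto
  let ?s = "1 / (1 + N)"
  show "0 < ?s"
    using \<open>0 \<le> N\<close> by simp
  have "N \<le> (1 + N)\<^sup>2"
    using \<open>0 \<le> N\<close> by (simp add: power2_eq_square algebra_simps)
  then have "?s\<^sup>2 * N \<le> 1"
    using \<open>0 \<le> N\<close> by (simp add: power_divide divide_le_eq_1)
  show "admissible (map (\<lambda>\<xi>. ?s *\<^sub>R \<xi>) xs)"
    unfolding admissible_def
  proof (intro conjI ballI)
    fix \<eta>
    assume \<eta>: "\<eta> \<in> elems Y"
    have "pos_element (N *\<^sub>R ip Y \<eta> \<eta> - (\<Sum>\<xi>\<leftarrow>xs. star (ip Y \<xi> \<eta>) * ip Y \<xi> \<eta>))"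
      unfolding N_def using xs
    proof (induction xs)
      case (Cons x xs)
      have "pos_element (((hnorm Y x)\<^sup>2 *\<^sub>R ip Y \<eta> \<eta> - star (ip Y x \<eta>) * ip Y x \<eta>)
         + ((\<Sum>\<xi>\<leftarrow>xs. (hnorm Y \<xi>)\<^sup>2) *\<^sub>R ip Y \<eta> \<eta> - (\<Sum>\<xi>\<leftarrow>xs. star (ip Y \<xi> \<eta>) * ip Y \<xi> \<eta>)))"
        using Cons \<eta> by (intro pos_add ip_cauchy_schwarz_pos) auto
      then show ?case
        by (simp add: algebra_simps)
    qed simp
    then have "pos_element (?s\<^sup>2 *\<^sub>R (N *\<^sub>R ip Y \<eta> \<eta> - (\<Sum>\<xi>\<leftarrow>xs. star (ip Y \<xi> \<eta>) * ip Y \<xi> \<eta>))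
        + (1 - ?s\<^sup>2 * N) *\<^sub>R ip Y \<eta> \<eta>)"
      using \<open>?s\<^sup>2 * N \<le> 1\<close> \<eta> by (intro pos_add pos_scaleR ip_pos) auto
    also have "?s\<^sup>2 *\<^sub>R (N *\<^sub>R ip Y \<eta> \<eta> - (\<Sum>\<xi>\<leftarrow>xs. star (ip Y \<xi> \<eta>) * ip Y \<xi> \<eta>)) + (1 - ?s\<^sup>2 * N) *\<^sub>R ip Y \<eta> \<eta>
      = ip Y \<eta> \<eta> - ?s\<^sup>2 *\<^sub>R (\<Sum>\<xi>\<leftarrow>xs. star (ip Y \<xi> \<eta>) * ip Y \<xi> \<eta>)"
      by (simp add: scaleR_right_diff_distrib scaleR_left_diff_distrib)
    also have "?s\<^sup>2 *\<^sub>R (\<Sum>\<xi>\<leftarrow>xs. star (ip Y \<xi> \<eta>) * ip Y \<xi> \<eta>)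
      = (\<Sum>\<xi>\<leftarrow>map (\<lambda>\<xi>. ?s *\<^sub>R \<xi>) xs. star (ip Y \<xi> \<eta>) * ip Y \<xi> \<eta>)"
      using xs \<eta> by (induction xs) (auto simp: ip_scaleR_left star_scaleR scaleR_right_distrib power2_eq_square)
    finally show "pos_element (ip Y \<eta> \<eta> - (\<Sum>\<xi>\<leftarrow>map (\<lambda>\<xi>. ?s *\<^sub>R \<xi>) xs. star (ip Y \<xi> \<eta>) * ip Y \<xi> \<eta>))" .
  qed (use xs in auto)
qed

text \<open>
  Scale the given vectors to an admissible family with operator \<open>k\<close> and let \<open>S\<close> be a self-adjoint
  square root of \<open>1 - k\<close>. The vectors \<open>(S ^^ i) \<xi>\<close> with \<open>i < n\<close> form a family with operator
  $\sum_{i<n} S^i k S^i = 1 - S^{2n}$. It is admissible, because \<open>1\<close> minus it is the square of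
  \<open>S ^^ n\<close>. The forms \<open>q i\<close> of $S^i k S^i$ decrease with \<open>i\<close> and sum to at most
  \<open>\<langle>\<eta>, \<eta>\<rangle>\<close>, so \<open>q n\<close> is at most its \<open>n\<close>-th part; as
  \<open>\<theta>\<close> of \<open>(S ^^ n) \<xi>\<close> is one of the summands of $S^n k S^n$, this vector tends to \<open>0\<close>.
\<close>

theorem approximate_unit:
  assumes xs: "set xs \<subseteq> elems Y" and "0 < e"
  obtains zs where "admissible zs" "almost_fixes zs xs e"
proof -
  obtain s where s: "0 < s" and adm: "admissible (map (\<lambda>\<xi>. s *\<^sub>R \<xi>) xs)"
    using admissible_scaled[OF xs] .
  define ys where "ys = map (\<lambda>\<xi>. s *\<^sub>R \<xi>) xs"
  have ys: "set ys \<subseteq> elems Y"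
    using xs by (auto simp: ys_def)
  obtain S where S: "adjoint_pair S S" and SS: "\<And>\<xi>. \<xi> \<in> elems Y \<Longrightarrow> S (S \<xi>) = \<xi> - frame_op ys \<xi>"
    using admissible_root[OF adm] unfolding ys_def by metis
  note Sn = adjoint_pair_funpow[OF S]
  note Dn = adjoint_pairD[OF Sn]
  have [simp]: "(S ^^ n) \<xi> \<in> elems Y" if "\<xi> \<in> elems Y" for n \<xi>
    using Dn that by blast
  define d where "d n \<eta> = ip Y ((S ^^ n) \<eta>) ((S ^^ n) \<eta>)" for n \<eta>
  define q where "q n \<eta> = ip Y ((S ^^ n) \<eta>) (frame_op ys ((S ^^ n) \<eta>))" for n \<eta>
  have frame_ys: "frame_op ys \<xi> = \<xi> - S (S \<xi>)" if "\<xi> \<in> elems Y" for \<xi>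
    using SS[OF that] by simp
  have d_Suc: "d (Suc n) \<eta> = d n \<eta> - q n \<eta>" if "\<eta> \<in> elems Y" for n \<eta>
    using that by (simp add: d_def q_def frame_ys ip_diff adjoint_pairD[OF S])
  have q_Suc: "pos_element (q n \<eta> - q (Suc n) \<eta>)" if \<eta>: "\<eta> \<in> elems Y" for n \<eta>
  proof -
    let ?\<zeta> = "(S ^^ n) \<eta>"
    have "q n \<eta> - q (Suc n) \<eta> = ip Y (frame_op ys ?\<zeta>) (frame_op ys ?\<zeta>)"
      using \<eta> adjoint_pairD(1)[OF S]
      by (simp add: q_def frame_ys ip_diff ip_diff_left adjoint_pairD(3)[OF S] adjoint_pair_diff[OF S])
    then show ?thesis
      using \<eta> ys by (simp add: ip_pos)
  qed
  have decay: "pos_element (d 0 \<eta> - d n \<eta> - real n *\<^sub>R q n \<eta>)" if \<eta>: "\<eta> \<in> elems Y" for n \<eta>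
  proof (induction n)
    case (Suc n)
    have "pos_element (d 0 \<eta> - d n \<eta> - real n *\<^sub>R q n \<eta> + real (Suc n) *\<^sub>R (q n \<eta> - q (Suc n) \<eta>))"
      using Suc q_Suc[OF \<eta>] by (intro pos_add pos_scaleR) auto
    also have "d 0 \<eta> - d n \<eta> - real n *\<^sub>R q n \<eta> + real (Suc n) *\<^sub>R (q n \<eta> - q (Suc n) \<eta>)
      = d 0 \<eta> - d (Suc n) \<eta> - real (Suc n) *\<^sub>R q (Suc n) \<eta>"
      by (simp add: d_Suc[OF \<eta>] algebra_simps)
    finally show ?case .
  qed simp
  have small: "real n * (hnorm Y ((S ^^ n) y))\<^sup>2 \<le> 1" if y: "y \<in> set ys" for y n
  proof -
    define \<zeta> where "\<zeta> = (S ^^ n) y"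
    have [simp]: "y \<in> elems Y" and \<zeta> [simp]: "\<zeta> \<in> elems Y"
      using y ys by (auto simp: \<zeta>_def)
    have "q n \<zeta> = (\<Sum>\<xi>\<leftarrow>ys. star (ip Y \<xi> ((S ^^ n) \<zeta>)) * ip Y \<xi> ((S ^^ n) \<zeta>))"
      unfolding q_def using ys by (simp add: ip_frame_op)
    moreover have "ip Y y ((S ^^ n) \<zeta>) = ip Y \<zeta> \<zeta>"
      using Dn(3)[of y \<zeta> n] by (simp add: \<zeta>_def[symmetric])
    ultimately have "pos_element (q n \<zeta> - ip Y \<zeta> \<zeta> * ip Y \<zeta> \<zeta>)"
      using pos_sum_list_minus_member[of ys "\<lambda>\<xi>. star (ip Y \<xi> ((S ^^ n) \<zeta>)) * ip Y \<xi> ((S ^^ n) \<zeta>)" y] y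
      by (simp add: ip_star)
    then have "pos_element ((d 0 \<zeta> - d n \<zeta> - real n *\<^sub>R q n \<zeta>) + d n \<zeta>
        + real n *\<^sub>R (q n \<zeta> - ip Y \<zeta> \<zeta> * ip Y \<zeta> \<zeta>))"
      by (intro pos_add pos_scaleR decay) (simp_all add: d_def ip_pos)
    then have "pos_element (ip Y \<zeta> \<zeta> - real n *\<^sub>R (ip Y \<zeta> \<zeta> * ip Y \<zeta> \<zeta>))"
      by (simp add: d_def scaleR_right_diff_distrib)
    moreover have "pos_element (real n *\<^sub>R (ip Y \<zeta> \<zeta> * ip Y \<zeta> \<zeta>))"
      using pos_star_mult[of "ip Y \<zeta> \<zeta>"] by (intro pos_scaleR) (simp_all add: ip_star)
    ultimately have "norm (real n *\<^sub>R (ip Y \<zeta> \<zeta> * ip Y \<zeta> \<zeta>)) \<le> norm (ip Y \<zeta> \<zeta>)"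
      using pos_norm_mono by blast
    then have "real n * ((hnorm Y \<zeta>)\<^sup>2 * (hnorm Y \<zeta>)\<^sup>2) \<le> 1 * (hnorm Y \<zeta>)\<^sup>2"
      unfolding hnorm_sq by (simp add: norm_selfadjoint_square ip_star power2_eq_square)
    then show ?thesis
      unfolding \<zeta>_def[symmetric]
      by (cases "hnorm Y \<zeta> = 0") (simp_all only: mult.assoc[symmetric] mult_le_cancel_right, auto)
  qed
  define zs where "zs n = concat (map (\<lambda>i. map (S ^^ i) ys) [0..<n])" for n
  have zs: "set (zs n) \<subseteq> elems Y" for n
    using ys by (auto simp: zs_def)
  have frame_zs: "frame_op (zs n) \<eta> = \<eta> - (S ^^ n) ((S ^^ n) \<eta>)" if \<eta> [simp]: "\<eta> \<in> elems Y" for n \<eta>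
  proof (induction n)
    case (Suc n)
    have "frame_op (map (S ^^ n) ys) \<eta> = (S ^^ n) ((S ^^ n) \<eta> - S (S ((S ^^ n) \<eta>)))"
      using ys by (simp add: frame_op_adjoint_image[OF Sn] frame_ys)
    also have "\<dots> = (S ^^ n) ((S ^^ n) \<eta>) - (S ^^ Suc n) ((S ^^ Suc n) \<eta>)"
      using adjoint_pairD(1)[OF S] by (simp add: adjoint_pair_diff[OF Sn] funpow_swap1)
    finally show ?case
      using Suc by (simp add: zs_def frame_op_append)
  qed (simp add: zs_def frame_op_def)
  have adm_zs: "admissible (zs n)" for n
    unfolding admissible_def
  proof (intro conjI ballI)
    fix \<eta>
    assume \<eta>: "\<eta> \<in> elems Y"
    have "ip Y \<eta> \<eta> - (\<Sum>\<xi>\<leftarrow>zs n. star (ip Y \<xi> \<eta>) * ip Y \<xi> \<eta>) = ip Y \<eta> (\<eta> - frame_op (zs n) \<eta>)"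
      using \<eta> zs by (simp add: ip_frame_op ip_diff)
    also have "\<dots> = ip Y ((S ^^ n) \<eta>) ((S ^^ n) \<eta>)"
      using \<eta> by (simp add: frame_zs Dn)
    finally show "pos_element (ip Y \<eta> \<eta> - (\<Sum>\<xi>\<leftarrow>zs n. star (ip Y \<xi> \<eta>) * ip Y \<xi> \<eta>))"
      using \<eta> by (simp add: ip_pos)
  qed (rule zs)
  have contr: "hnorm Y ((S ^^ n) \<eta>) \<le> hnorm Y \<eta>" if \<eta>: "\<eta> \<in> elems Y" for n \<eta>
  proof -
    have "pos_element (ip Y \<eta> (frame_op (zs n) \<eta>))"
      using \<eta> zs by (auto simp: ip_frame_op intro!: pos_sum_list)
    then have "norm (ip Y ((S ^^ n) \<eta>) ((S ^^ n) \<eta>)) \<le> norm (ip Y \<eta> \<eta>)"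
      using \<eta> ip_pos[of "(S ^^ n) \<eta>"] by (intro pos_norm_mono) (auto simp: frame_zs ip_diff Dn)
    then show ?thesis
      by (simp add: hnorm_def)
  qed
  obtain n :: nat where "1 / (s * e)\<^sup>2 < real n"
    using reals_Archimedean2 by blast
  moreover have "0 < 1 / (s * e)\<^sup>2"
    using s \<open>0 < e\<close> by simp
  ultimately have "0 < real n"
    by linarith
  with \<open>1 / (s * e)\<^sup>2 < real n\<close> have n: "1 < real n * (s * e)\<^sup>2" "0 < real n"
    using s \<open>0 < e\<close> by (simp_all add: field_simps)
  have "hnorm Y (\<xi> - frame_op (zs n) \<xi>) < e" if \<xi>: "\<xi> \<in> set xs" for \<xi>
  proof -
    have [simp]: "\<xi> \<in> elems Y"
      using \<xi> xs by auto
    have y: "s *\<^sub>R \<xi> \<in> set ys"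
      using \<xi> by (auto simp: ys_def)
    have "s * hnorm Y (\<xi> - frame_op (zs n) \<xi>) = hnorm Y ((S ^^ n) ((S ^^ n) (s *\<^sub>R \<xi>)))"
      using s by (simp add: frame_zs adjoint_pair_scaleR[OF Sn] hnorm_scaleR)
    also have "\<dots> \<le> hnorm Y ((S ^^ n) (s *\<^sub>R \<xi>))"
      by (rule contr) simp
    finally have "(s * hnorm Y (\<xi> - frame_op (zs n) \<xi>))\<^sup>2 \<le> (hnorm Y ((S ^^ n) (s *\<^sub>R \<xi>)))\<^sup>2"
      using s by (intro power_mono) auto
    then have "real n * (s * hnorm Y (\<xi> - frame_op (zs n) \<xi>))\<^sup>2 \<le> real n * (hnorm Y ((S ^^ n) (s *\<^sub>R \<xi>)))\<^sup>2"
      by (rule mult_left_mono) simp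
    also have "\<dots> \<le> 1"
      by (rule small[OF y])
    also have "\<dots> < real n * (s * e)\<^sup>2"
      by (rule n)
    finally have "(s * hnorm Y (\<xi> - frame_op (zs n) \<xi>))\<^sup>2 < (s * e)\<^sup>2"
      using n(2) by (simp only: mult_less_cancel_left_pos)
    then show ?thesis
      using s \<open>0 < e\<close> power_less_imp_less_base[of "s * hnorm Y (\<xi> - frame_op (zs n) \<xi>)" 2 "s * e"] by simp
  qed
  then show ?thesis
    using that[of "zs n"] adm_zs zs by (auto simp: almost_fixes_def)
qed

end

section \<open>Induced traces\<close>

context correspondence
begin

lemma adjoint_pair_lact: "adjoint_pair (lact Y a) (lact Y (star a))"
proof -
  have "adjoint_pair (left_op Y a) (left_op Y (star a))"
    using adjointable_obtain_adjoint[OF left_op_adjointable[of a]] by (simp add: left_op_star)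
  then show ?thesis
    unfolding adjoint_pair_def left_op_def by simp
qed

lemmas ip_lact = adjoint_pairD(3)[OF adjoint_pair_lact]

lemma lact_closed [simp]: "\<xi> \<in> elems Y \<Longrightarrow> lact Y a \<xi> \<in> elems Y"
  using adjoint_pairD(1)[OF adjoint_pair_lact] .

lemma lact_scaleR: "\<xi> \<in> elems Y \<Longrightarrow> lact Y (r *\<^sub>R a) \<xi> = r *\<^sub>R lact Y a \<xi>"
  by (simp add: scaleR_scaleC lact_scaleC)

lemma lact_minus: "\<xi> \<in> elems Y \<Longrightarrow> lact Y (- a) \<xi> = - lact Y a \<xi>"
  using lact_scaleR[of \<xi> "-1" a] by simp

lemma ip_lact_star_mult: "\<xi> \<in> elems Y \<Longrightarrow> ip Y \<xi> (lact Y (star c * c) \<xi>) = ip Y (lact Y c \<xi>) (lact Y c \<xi>)"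
  by (simp add: lact_mult ip_lact)

lemma pos_ip_lact: "pos_element a \<Longrightarrow> \<xi> \<in> elems Y \<Longrightarrow> pos_element (ip Y \<xi> (lact Y a \<xi>))"
  unfolding pos_element_def[of a] by (auto simp: ip_lact_star_mult ip_pos)

text \<open>
  The difference is the inner square of the image of \<open>\<xi>\<close> under the root of \<open>M - b\<close>.
\<close>

lemma ip_lact_le_norm:
  assumes b: "pos_element b" "norm b \<le> M" and \<xi> [simp]: "\<xi> \<in> elems Y"
  shows "pos_element (M *\<^sub>R ip Y \<xi> \<xi> - ip Y \<xi> (lact Y b \<xi>))"
proof -
  obtain \<sigma> d where d: "star d = d" "\<sigma> * \<sigma> = M" "d * d + (2 * \<sigma>) *\<^sub>R d = - b"
    using pos_norm_minus_root[OF b] .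
  let ?\<zeta> = "\<sigma> *\<^sub>R \<xi> + lact Y d \<xi>"
  have two: "\<sigma> *\<^sub>R x + \<sigma> *\<^sub>R x = (2 * \<sigma>) *\<^sub>R x" for x :: 'a
    by (metis mult_2 scaleR_left.add)
  have "ip Y ?\<zeta> ?\<zeta> = (\<sigma> * \<sigma>) *\<^sub>R ip Y \<xi> \<xi> + ((\<sigma> *\<^sub>R ip Y \<xi> (lact Y d \<xi>) + \<sigma> *\<^sub>R ip Y \<xi> (lact Y d \<xi>))
      + ip Y \<xi> (lact Y (d * d) \<xi>))"
    by (simp add: ip_add ip_add_left ip_scaleR ip_scaleR_left ip_lact d(1) lact_mult scaleR_right_distrib)
  also have "\<dots> = M *\<^sub>R ip Y \<xi> \<xi> + ip Y \<xi> (lact Y (d * d + (2 * \<sigma>) *\<^sub>R d) \<xi>)"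
    unfolding two by (simp add: d(2) lact_add lact_scaleR ip_add ip_scaleR)
  also have "\<dots> = M *\<^sub>R ip Y \<xi> \<xi> - ip Y \<xi> (lact Y b \<xi>)"
    unfolding d by (simp add: lact_minus ip_minus)
  finally show ?thesis
    using ip_pos[of ?\<zeta>] by simp
qed

end

locale bounded_trace =
  fixes t :: "'a::cstar_algebra \<Rightarrow> real"
  assumes bounded_linear_t: "bounded_linear t"
    and t_commute: "t (a * b) = t (b * a)"
    and t_pos: "pos_element a \<Longrightarrow> 0 \<le> t a"
begin

lemma t_mono: "pos_element (b - a) \<Longrightarrow> t a \<le> t b"
  using t_pos[of "b - a"] by (simp add: linear_diff[OF bounded_linear.linear[OF bounded_linear_t]])

lemma t_add: "t (a + b) = t a + t b"
  by (rule linear_add[OF bounded_linear.linear[OF bounded_linear_t]])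

lemma t_sum_list: "t (\<Sum>x\<leftarrow>xs. f x) = (\<Sum>x\<leftarrow>xs. t (f x))"
  by (induction xs) (simp_all add: t_add linear_0[OF bounded_linear.linear[OF bounded_linear_t]])

end

locale traced_correspondence = correspondence Y + bounded_trace t
  for Y :: "('a::cstar_algebra, 'x::complex_vector) corr" and t :: "'a \<Rightarrow> real"
begin

definition trace_sum :: "'x list \<Rightarrow> 'a \<Rightarrow> real" where
  "trace_sum xs a = (\<Sum>\<xi>\<leftarrow>xs. t (ip Y \<xi> (lact Y a \<xi>)))"

lemma trace_sum_star_mult:
  "set xs \<subseteq> elems Y \<Longrightarrow> trace_sum xs (star c * c) = (\<Sum>\<xi>\<leftarrow>xs. t (ip Y (lact Y c \<xi>) (lact Y c \<xi>)))"
  unfolding trace_sum_def by (intro arg_cong[where f = sum_list] map_cong) (auto simp: ip_lact_star_mult)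

text \<open>
  The operators of the two families enter symmetrically: up to the error of replacing \<open>lact Y c \<mu>\<close> by
  its image under \<open>frame_op ns\<close>, both sides are sums of \<open>t (star x * x) = t (x * star x)\<close> for the inner
  products \<open>x\<close> between the vectors \<open>lact Y c \<mu>\<close> and \<open>\<nu>\<close>, and admissibility of \<open>ms\<close> bounds the
  sum over \<open>\<mu>\<close>. The exchange turns \<open>star c * c\<close> into \<open>c * star c\<close>.
\<close>

lemma trace_compare:
  assumes ms: "admissible ms" and ns: "set ns \<subseteq> elems Y"
    and C: "0 \<le> C" "\<And>a. \<bar>t a\<bar> \<le> norm a * C"
  shows "trace_sum ms (star c * c) \<le> trace_sum ns (c * star c)
    + (\<Sum>\<mu>\<leftarrow>ms. hnorm Y (lact Y c \<mu>) * hnorm Y (lact Y c \<mu> - frame_op ns (lact Y c \<mu>)) * C)"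
    (is "_ \<le> _ + ?err")
proof -
  have sub: "set ms \<subseteq> elems Y"
    using ms by (simp add: admissible_def)
  let ?N = "\<lambda>\<mu>. \<Sum>\<nu>\<leftarrow>ns. t (star (ip Y \<mu> (lact Y (star c) \<nu>)) * ip Y \<mu> (lact Y (star c) \<nu>))"
  have "t (ip Y (lact Y c \<mu>) (lact Y c \<mu>))
      \<le> ?N \<mu> + hnorm Y (lact Y c \<mu>) * hnorm Y (lact Y c \<mu> - frame_op ns (lact Y c \<mu>)) * C"
    if "\<mu> \<in> set ms" for \<mu>
  proof -
    have [simp]: "\<mu> \<in> elems Y"
      using sub that by auto
    let ?\<zeta> = "lact Y c \<mu>"
    have "ip Y ?\<zeta> ?\<zeta> = ip Y ?\<zeta> (frame_op ns ?\<zeta>) + ip Y ?\<zeta> (?\<zeta> - frame_op ns ?\<zeta>)"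
      using ns by (simp add: ip_diff)
    then have "t (ip Y ?\<zeta> ?\<zeta>) = t (ip Y ?\<zeta> (frame_op ns ?\<zeta>)) + t (ip Y ?\<zeta> (?\<zeta> - frame_op ns ?\<zeta>))"
      by (simp only: t_add)
    moreover have "t (ip Y ?\<zeta> (frame_op ns ?\<zeta>)) = (\<Sum>\<nu>\<leftarrow>ns. t (star (ip Y \<nu> ?\<zeta>) * ip Y \<nu> ?\<zeta>))"
      using ns by (simp add: ip_frame_op t_sum_list)
    moreover have "\<dots> = ?N \<mu>"
    proof (intro arg_cong[where f = sum_list] map_cong refl)
      fix \<nu>
      assume "\<nu> \<in> set ns"
      then have [simp]: "\<nu> \<in> elems Y"
        using ns by auto
      have "star (ip Y \<mu> (lact Y (star c) \<nu>)) = ip Y \<nu> ?\<zeta>"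
        using ip_lact[of \<nu> \<mu> "star c"] by (simp add: ip_star star_star)
      moreover from this have "ip Y \<mu> (lact Y (star c) \<nu>) = star (ip Y \<nu> ?\<zeta>)"
        by (metis star_star)
      ultimately show "t (star (ip Y \<nu> ?\<zeta>) * ip Y \<nu> ?\<zeta>)
          = t (star (ip Y \<mu> (lact Y (star c) \<nu>)) * ip Y \<mu> (lact Y (star c) \<nu>))"
        by (metis t_commute)
    qed
    moreover have "t (ip Y ?\<zeta> (?\<zeta> - frame_op ns ?\<zeta>)) \<le> hnorm Y ?\<zeta> * hnorm Y (?\<zeta> - frame_op ns ?\<zeta>) * C"
      using ns C
      by (intro order_trans[OF abs_ge_self order_trans[OF C(2)]] mult_right_mono ip_cauchy_schwarz) auto
    ultimately show ?thesis
      by simp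
  qed
  then have "(\<Sum>\<mu>\<leftarrow>ms. t (ip Y (lact Y c \<mu>) (lact Y c \<mu>))) \<le> (\<Sum>\<mu>\<leftarrow>ms. ?N \<mu>
      + hnorm Y (lact Y c \<mu>) * hnorm Y (lact Y c \<mu> - frame_op ns (lact Y c \<mu>)) * C)"
    by (rule sum_list_mono)
  then have "trace_sum ms (star c * c) \<le> (\<Sum>\<mu>\<leftarrow>ms. ?N \<mu>) + ?err"
    using sub by (simp add: trace_sum_star_mult sum_list_addf)
  also have "(\<Sum>\<mu>\<leftarrow>ms. ?N \<mu>)
      = (\<Sum>\<nu>\<leftarrow>ns. t (\<Sum>\<mu>\<leftarrow>ms. star (ip Y \<mu> (lact Y (star c) \<nu>)) * ip Y \<mu> (lact Y (star c) \<nu>)))"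
    by (simp add: t_sum_list sum_list_swap[of _ ns])
  also have "\<dots> \<le> (\<Sum>\<nu>\<leftarrow>ns. t (ip Y (lact Y (star c) \<nu>) (lact Y (star c) \<nu>)))"
    using ms ns by (intro sum_list_mono t_mono) (auto simp: admissible_def)
  also have "\<dots> = trace_sum ns (c * star c)"
    using trace_sum_star_mult[OF ns, of "star c"] by (simp add: star_star)
  finally show ?thesis
    by simp
qed

lemma trace_compare_eventually:
  assumes ms: "admissible ms" and B: "B < trace_sum ms (star c * c)"
  obtains F \<delta> where "set F \<subseteq> elems Y" "0 < \<delta>" "\<And>ns. almost_fixes ns F \<delta> \<Longrightarrow> B < trace_sum ns (c * star c)"
proof -
  obtain C where C: "0 \<le> C" "\<And>a. \<bar>t a\<bar> \<le> norm a * C"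
    using bounded_linear.nonneg_bounded[OF bounded_linear_t] by auto
  have sub: "set ms \<subseteq> elems Y"
    using ms by (simp add: admissible_def)
  define S where "S = (\<Sum>\<mu>\<leftarrow>ms. hnorm Y (lact Y c \<mu>) * C)"
  have "0 \<le> S"
    unfolding S_def using C by (intro sum_list_nonneg) auto
  define \<delta> where "\<delta> = (trace_sum ms (star c * c) - B) / (1 + S)"
  have "0 < \<delta>"
    using B \<open>0 \<le> S\<close> by (simp add: \<delta>_def)
  have "S * \<delta> < trace_sum ms (star c * c) - B"
    using B \<open>0 \<le> S\<close> by (simp add: \<delta>_def field_simps)
  show ?thesis
  proof (rule that[of "map (lact Y c) ms" \<delta>])
    show "set (map (lact Y c) ms) \<subseteq> elems Y" "0 < \<delta>"
      using sub \<open>0 < \<delta>\<close> by auto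
    fix ns
    assume ns: "almost_fixes ns (map (lact Y c) ms) \<delta>"
    then have "trace_sum ms (star c * c) \<le> trace_sum ns (c * star c)
      + (\<Sum>\<mu>\<leftarrow>ms. hnorm Y (lact Y c \<mu>) * hnorm Y (lact Y c \<mu> - frame_op ns (lact Y c \<mu>)) * C)"
      by (intro trace_compare[OF ms _ C]) (auto simp: almost_fixes_def)
    also have "(\<Sum>\<mu>\<leftarrow>ms. hnorm Y (lact Y c \<mu>) * hnorm Y (lact Y c \<mu> - frame_op ns (lact Y c \<mu>)) * C)
        \<le> (\<Sum>\<mu>\<leftarrow>ms. hnorm Y (lact Y c \<mu>) * \<delta> * C)"
      using ns C by (intro sum_list_mono mult_right_mono mult_left_mono) (auto simp: almost_fixes_def less_imp_le)
    also have "\<dots> = S * \<delta>"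
      unfolding S_def sum_list_mult_const[symmetric] by (simp add: mult_ac)
    finally show "B < trace_sum ns (c * star c)"
      using \<open>S * \<delta> < trace_sum ms (star c * c) - B\<close> by simp
  qed
qed

text \<open>
  One comparison replaces \<open>star c * c\<close> by \<open>c * star c\<close>; a second one, through an intermediate
  approximate unit, restores it.
\<close>

theorem trace_sum_eventually:
  assumes a: "pos_element a" and ms: "admissible ms" and B: "B < trace_sum ms a"
  obtains F \<delta> where "set F \<subseteq> elems Y" "0 < \<delta>" "\<And>ns. almost_fixes ns F \<delta> \<Longrightarrow> B < trace_sum ns a"
proof -
  obtain c where c: "a = star c * c"
    using a by (auto simp: pos_element_def)
  obtain F \<delta> where F: "set F \<subseteq> elems Y" "0 < \<delta>" "\<And>ns. almost_fixes ns F \<delta> \<Longrightarrow> B < trace_sum ns (c * star c)"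
    using trace_compare_eventually[OF ms B[unfolded c]] by metis
  obtain zs where zs: "admissible zs" "almost_fixes zs F \<delta>"
    using approximate_unit[OF F(1,2)] .
  have "B < trace_sum zs (star (star c) * star c)"
    using F(3)[OF zs(2)] by (simp add: star_star)
  show ?thesis
  proof (rule trace_compare_eventually[OF zs(1) \<open>B < trace_sum zs (star (star c) * star c)\<close>])
    fix G \<epsilon>
    assume "set G \<subseteq> elems Y" "0 < \<epsilon>"
      "\<And>ns. almost_fixes ns G \<epsilon> \<Longrightarrow> B < trace_sum ns (star c * star (star c))"
    then show ?thesis
      using that[of G \<epsilon>] by (simp add: c star_star)
  qed
qed

end

lemma root_of_unity_multiple_avoiding:
  fixes x :: "'x::complex_vector"
  assumes "x \<noteq> 0" "finite A"
  obtains c where "cmod c = 1" "c *\<^sub>C x \<notin> A"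
proof -
  \<comment> \<open>More roots of unity than elements of \<open>A\<close>.\<close>
  let ?n = "Suc (card A)" and ?f = "\<lambda>c. c *\<^sub>C x"
  have "inj_on ?f {c. c ^ ?n = 1}"
    using assms(1) by (intro inj_onI) (rule complex_vector.scale_right_imp_eq)
  then have card: "card (?f ` {c. c ^ ?n = 1}) = ?n"
    using card_roots_unity_eq[of ?n] by (simp only: card_image)
  have "\<not> ?f ` {c. c ^ ?n = 1} \<subseteq> A"
  proof
    assume "?f ` {c. c ^ ?n = 1} \<subseteq> A"
    then show False
      using card_mono[OF assms(2)] card by (metis not_less_eq_eq order_refl)
  qed
  then obtain c where "c ^ ?n = 1" "?f c \<notin> A"
    by blast
  moreover from this have "cmod c ^ ?n = 1"
    by (metis norm_one norm_power)
  then have "cmod c = 1"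
    using power_eq_1_iff[of "cmod c" ?n] by (simp del: power_Suc)
  ultimately show ?thesis
    using that by blast
qed

text \<open>
  Induced traces are suprema over finite sets of vectors, whereas the families below may repeat a
  vector; repetitions are separated by phases, which change neither side.
\<close>

lemma phases_distinct:
  fixes xs :: "'x::complex_vector list"
  shows "\<exists>ys. distinct ys \<and> list_all2 (\<lambda>y x. \<exists>c. cmod c = 1 \<and> y = c *\<^sub>C x) ys (filter (\<lambda>x. x \<noteq> 0) xs)"
proof (induction xs)
  case (Cons x xs)
  then obtain ys where ys: "distinct ys"
    "list_all2 (\<lambda>y x. \<exists>c. cmod c = 1 \<and> y = c *\<^sub>C x) ys (filter (\<lambda>x. x \<noteq> 0) xs)"
    by blast
  show ?case
  proof (cases "x = 0")
    case False
    obtain c where "cmod c = 1" "c *\<^sub>C x \<notin> set ys"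
      using root_of_unity_multiple_avoiding[OF False, of "set ys"] by blast
    then show ?thesis
      using ys False by (intro exI[of _ "c *\<^sub>C x # ys"]) auto
  qed (use ys in auto)
qed simp

lemma sum_list_phases:
  assumes "list_all2 (\<lambda>y x. \<exists>c. cmod c = 1 \<and> y = c *\<^sub>C x) ys (filter (\<lambda>x. x \<noteq> 0) xs)"
    and "set xs \<subseteq> E" and f: "f 0 = 0" "\<And>c x. cmod c = 1 \<Longrightarrow> x \<in> E \<Longrightarrow> f (c *\<^sub>C x) = f x"
  shows "(\<Sum>y\<leftarrow>ys. f y) = (\<Sum>x\<leftarrow>xs. f x :: 'b::comm_monoid_add)"
  using assms(1,2)
proof (induction xs arbitrary: ys)
  case (Cons x xs)
  show ?case
  proof (cases "x = 0")
    case False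
    with Cons.prems obtain c zs where "ys = c *\<^sub>C x # zs" "cmod c = 1"
      "list_all2 (\<lambda>y x. \<exists>c. cmod c = 1 \<and> y = c *\<^sub>C x) zs (filter (\<lambda>x. x \<noteq> 0) xs)"
      by (auto simp: list_all2_Cons2)
    then show ?thesis
      using Cons.IH[of zs] Cons.prems f(2) by auto
  qed (use Cons f(1) in auto)
qed simp

lemma (in hilbert_module) admissible_phases:
  assumes xs: "admissible xs"
    and ys: "list_all2 (\<lambda>y x. \<exists>c. cmod c = 1 \<and> y = c *\<^sub>C x) ys (filter (\<lambda>x. x \<noteq> 0) xs)"
  shows "admissible ys"
proof -
  have sub: "set xs \<subseteq> elems Y"
    using xs by (simp add: admissible_def)
  have "set ys \<subseteq> elems Y"
    using ys sub by (auto simp: list_all2_conv_all_nth set_conv_nth[of ys] subset_iff)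
      (metis (mono_tags, lifting) elems_closed(3) filter_is_subset nth_mem subsetD)
  moreover have "(\<Sum>\<xi>\<leftarrow>ys. star (ip Y \<xi> \<eta>) * ip Y \<xi> \<eta>) = (\<Sum>\<xi>\<leftarrow>xs. star (ip Y \<xi> \<eta>) * ip Y \<xi> \<eta>)"
    if "\<eta> \<in> elems Y" for \<eta>
  proof (rule sum_list_phases[OF ys sub])
    fix c x
    assume "cmod c = 1" "x \<in> elems Y"
    then have "c * cnj c = 1"
      by (simp add: complex_norm_square[symmetric])
    then show "star (ip Y (c *\<^sub>C x) \<eta>) * ip Y (c *\<^sub>C x) \<eta> = star (ip Y x \<eta>) * ip Y x \<eta>"
      using that \<open>x \<in> elems Y\<close>
      by (simp add: ip_scaleC_left star_scaleC mult_scaleC_left mult_scaleC_right scaleC_scaleC scaleC_one mult.commute)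
  qed (use that in simp)
  ultimately show ?thesis
    using xs by (simp add: admissible_def)
qed

locale state_correspondence = correspondence Y
  for Y :: "('a::cstar_algebra, 'x::complex_vector) corr" +
  fixes \<tau> :: "'a \<Rightarrow> complex"
  assumes \<tau>: "tracial_state \<tau>"

lemma bounded_trace_Re: "tracial_state \<tau> \<Longrightarrow> bounded_trace (\<lambda>a. Re (\<tau> a))"
  unfolding tracial_state_def
  by (intro bounded_trace.intro bounded_linear_compose[OF bounded_linear_Re]) auto

sublocale state_correspondence \<subseteq> traced_correspondence Y "\<lambda>a. Re (\<tau> a)"
  by (rule traced_correspondence.intro[OF correspondence_axioms bounded_trace_Re[OF \<tau>]])

context state_correspondence
begin

lemma trace_sum_set: "distinct xs \<Longrightarrow> set xs \<subseteq> elems Y \<Longrightarrow>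
    (\<Sum>\<xi>\<in>set xs. Re (\<tau> (ip Y \<xi> (left_op Y a \<xi>)))) = trace_sum xs a"
  by (simp add: trace_sum_def sum_list_distinct_conv_sum_set left_op_def subset_iff)

text \<open>
  Together with \<open>less_Tr_obtain\<close> this makes the induced trace a supremum over admissible lists.
\<close>

theorem trace_sum_le_Tr:
  assumes "admissible xs"
  shows "ereal (trace_sum xs a) \<le> Tr \<tau> Y a"
proof -
  have sub: "set xs \<subseteq> elems Y"
    using assms by (simp add: admissible_def)
  obtain ys where ys: "distinct ys"
    "list_all2 (\<lambda>y x. \<exists>c. cmod c = 1 \<and> y = c *\<^sub>C x) ys (filter (\<lambda>x. x \<noteq> 0) xs)"
    using phases_distinct by blast
  have "admissible ys"
    by (rule admissible_phases[OF assms ys(2)])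
  then have adm: "tr_admissible Y (set ys)" and sub': "set ys \<subseteq> elems Y"
    using tr_admissible_iff[OF ys(1)] by (auto simp: admissible_def)
  have "trace_sum ys a = trace_sum xs a"
    unfolding trace_sum_def
  proof (rule sum_list_phases[OF ys(2) sub])
    fix c x
    assume "cmod c = 1" and [simp]: "x \<in> elems Y"
    then have "c * cnj c = 1"
      by (simp add: complex_norm_square[symmetric])
    have "lact Y a (c *\<^sub>C x) = c *\<^sub>C lact Y a x"
      by (rule elems_eqI) (auto simp: ip_scaleC ip_lact[of _ _ "star a", unfolded star_star, symmetric])
    then show "Re (\<tau> (ip Y (c *\<^sub>C x) (lact Y a (c *\<^sub>C x)))) = Re (\<tau> (ip Y x (lact Y a x)))"
      using \<open>c * cnj c = 1\<close>
      by (simp add: ip_scaleC ip_scaleC_left scaleC_scaleC scaleC_one mult.commute)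
  qed (simp add: adjoint_pair_zero[OF adjoint_pair_lact] linear_0[OF bounded_linear.linear[OF bounded_linear_t]])
  then have "ereal (trace_sum xs a) = ereal (\<Sum>\<xi>\<in>set ys. Re (\<tau> (ip Y \<xi> (left_op Y a \<xi>))))"
    using trace_sum_set[OF ys(1) sub'] by simp
  also have "\<dots> \<le> Tr \<tau> Y a"
    unfolding Tr_def Tr_op_def using adm by (intro SUP_upper) auto
  finally show ?thesis .
qed

theorem less_Tr_obtain:
  assumes "ereal B < Tr \<tau> Y a"
  obtains xs where "admissible xs" "B < trace_sum xs a"
proof -
  obtain H where H: "tr_admissible Y H" "ereal B < ereal (\<Sum>\<xi>\<in>H. Re (\<tau> (ip Y \<xi> (left_op Y a \<xi>))))"
    using assms unfolding Tr_def Tr_op_def by (auto simp: less_SUP_iff)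
  then obtain xs where xs: "set xs = H" "distinct xs"
    using finite_distinct_list unfolding tr_admissible_def by blast
  have "admissible xs"
    using H(1) xs tr_admissible_iff by blast
  moreover have "B < trace_sum xs a"
    using H(2) trace_sum_set[OF xs(2)] \<open>admissible xs\<close> xs(1) by (auto simp: admissible_def)
  ultimately show ?thesis
    using that by blast
qed

lemma Tr_nonneg: "0 \<le> Tr \<tau> Y a"
  using trace_sum_le_Tr[of "[]" a] by (simp add: admissible_def ip_pos trace_sum_def zero_ereal_def)

end

section \<open>Induced traces on interior tensor products\<close>

lemma (in hilbert_module) ip_self_limit:
  assumes \<xi>: "\<xi> \<in> elems Y" and u: "\<And>n. u n \<in> elems Y" and lim: "(\<lambda>n. hnorm Y (u n - \<xi>)) \<longlonglongrightarrow> 0"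
  shows "(\<lambda>n. ip Y (u n) (u n)) \<longlonglongrightarrow> ip Y \<xi> \<xi>"
proof -
  have cross: "(\<lambda>n. ip Y \<xi> (u n)) \<longlonglongrightarrow> ip Y \<xi> \<xi>"
    by (rule ip_limit[OF \<xi> \<xi> u lim])
  have "(\<lambda>n. ip Y (u n - \<xi>) (u n - \<xi>)) \<longlonglongrightarrow> 0"
  proof (rule tendsto_norm_zero_cancel)
    show "(\<lambda>n. norm (ip Y (u n - \<xi>) (u n - \<xi>))) \<longlonglongrightarrow> 0"
      using tendsto_mult_zero[OF lim lim] by (simp add: hnorm_sq[symmetric] power2_eq_square)
  qed
  then have "(\<lambda>n. ip Y (u n - \<xi>) (u n - \<xi>) + ip Y \<xi> (u n) + star (ip Y \<xi> (u n)) - ip Y \<xi> \<xi>)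
    \<longlonglongrightarrow> 0 + ip Y \<xi> \<xi> + star (ip Y \<xi> \<xi>) - ip Y \<xi> \<xi>"
    using cross
    by (intro tendsto_add tendsto_diff tendsto_const bounded_linear.tendsto[OF bounded_linear_star])
  then show ?thesis
    using \<xi> u by (simp add: ip_diff ip_diff_left ip_star)
qed

locale traced_tensor_product =
  Y: state_correspondence Y \<tau> + Z: state_correspondence Z \<tau> + W: state_correspondence W \<tau>
  for Y Z W :: "('a::cstar_algebra, 'x::complex_vector) corr" and \<tau> :: "'a \<Rightarrow> complex" +
  fixes m :: "'x \<Rightarrow> 'x \<Rightarrow> 'x"
  assumes iso: "tensor_iso Y Z W m"
    and lact_m: "\<xi> \<in> elems Y \<Longrightarrow> \<zeta> \<in> elems Z \<Longrightarrow> lact W a (m \<xi> \<zeta>) = m (lact Y a \<xi>) \<zeta>"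
begin

lemma m_closed [simp]: "\<xi> \<in> elems Y \<Longrightarrow> \<zeta> \<in> elems Z \<Longrightarrow> m \<xi> \<zeta> \<in> elems W"
  using iso by (simp add: tensor_iso_def)

lemma ip_m:
  assumes "\<xi> \<in> elems Y" "\<zeta> \<in> elems Z" "\<xi>' \<in> elems Y" "\<zeta>' \<in> elems Z"
  shows "ip W (m \<xi> \<zeta>) (m \<xi>' \<zeta>') = ip Z \<zeta> (lact Z (ip Y \<xi> \<xi>') \<zeta>')"
proof -
  have "ip W (\<Sum>(\<xi>, \<zeta>)\<leftarrow>[(\<xi>, \<zeta>)]. m \<xi> \<zeta>) (\<Sum>(\<xi>, \<zeta>)\<leftarrow>[(\<xi>', \<zeta>')]. m \<xi> \<zeta>) = tensor_ip Y Z [(\<xi>, \<zeta>)] [(\<xi>', \<zeta>')]"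
    using iso assms unfolding tensor_iso_def by (metis (no_types, lifting) SigmaI lists.simps)
  then show ?thesis
    by (simp add: tensor_ip_def)
qed

lemma
  shows m_add_right: "\<xi> \<in> elems Y \<Longrightarrow> \<zeta> \<in> elems Z \<Longrightarrow> \<zeta>' \<in> elems Z \<Longrightarrow> m \<xi> (\<zeta> + \<zeta>') = m \<xi> \<zeta> + m \<xi> \<zeta>'"
    and m_diff_right: "\<xi> \<in> elems Y \<Longrightarrow> \<zeta> \<in> elems Z \<Longrightarrow> \<zeta>' \<in> elems Z \<Longrightarrow> m \<xi> (\<zeta> - \<zeta>') = m \<xi> \<zeta> - m \<xi> \<zeta>'"
    and m_add_left: "\<xi> \<in> elems Y \<Longrightarrow> \<xi>' \<in> elems Y \<Longrightarrow> \<zeta> \<in> elems Z \<Longrightarrow> m (\<xi> + \<xi>') \<zeta> = m \<xi> \<zeta> + m \<xi>' \<zeta>"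
    and m_diff_left: "\<xi> \<in> elems Y \<Longrightarrow> \<xi>' \<in> elems Y \<Longrightarrow> \<zeta> \<in> elems Z \<Longrightarrow> m (\<xi> - \<xi>') \<zeta> = m \<xi> \<zeta> - m \<xi>' \<zeta>"
    and m_ract: "\<xi> \<in> elems Y \<Longrightarrow> \<zeta> \<in> elems Z \<Longrightarrow> m \<xi> (ract Z \<zeta> a) = ract W (m \<xi> \<zeta>) a"
    and m_balanced: "\<xi> \<in> elems Y \<Longrightarrow> \<zeta> \<in> elems Z \<Longrightarrow> m (ract Y \<xi> a) \<zeta> = m \<xi> (lact Z a \<zeta>)"
proof -
  have eq: "u = v" if "u \<in> elems W" "v \<in> elems W" "ip W u u = ip W u v" "ip W v u = ip W v v" for u v
    using W.ip_definite[of "u - v"] that by (simp add: W.ip_diff W.ip_diff_left)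
  have lact_diff: "lact Z (a - b) x = lact Z a x - lact Z b x" if "x \<in> elems Z" for a b x
    using Z.lact_add[of x a "- b"] that by (simp add: Z.lact_minus)
  note ips = ip_m W.ip_add W.ip_add_left W.ip_diff W.ip_diff_left W.ip_ract W.ip_ract_left
    Y.ip_add Y.ip_add_left Y.ip_diff Y.ip_diff_left Y.ip_ract Y.ip_ract_left
    Z.ip_add Z.ip_add_left Z.ip_diff Z.ip_diff_left Z.ip_ract Z.ip_ract_left
    Z.lact_add Z.lact_mult lact_diff Z.adjoint_pair_linear[OF Z.adjoint_pair_lact] Z.ip_lact
  show "\<xi> \<in> elems Y \<Longrightarrow> \<zeta> \<in> elems Z \<Longrightarrow> \<zeta>' \<in> elems Z \<Longrightarrow> m \<xi> (\<zeta> + \<zeta>') = m \<xi> \<zeta> + m \<xi> \<zeta>'"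
    by (rule eq) (simp_all add: ips)
  show "\<xi> \<in> elems Y \<Longrightarrow> \<zeta> \<in> elems Z \<Longrightarrow> \<zeta>' \<in> elems Z \<Longrightarrow> m \<xi> (\<zeta> - \<zeta>') = m \<xi> \<zeta> - m \<xi> \<zeta>'"
    by (rule eq) (simp_all add: ips)
  show "\<xi> \<in> elems Y \<Longrightarrow> \<xi>' \<in> elems Y \<Longrightarrow> \<zeta> \<in> elems Z \<Longrightarrow> m (\<xi> + \<xi>') \<zeta> = m \<xi> \<zeta> + m \<xi>' \<zeta>"
    by (rule eq) (simp_all add: ips)
  show "\<xi> \<in> elems Y \<Longrightarrow> \<xi>' \<in> elems Y \<Longrightarrow> \<zeta> \<in> elems Z \<Longrightarrow> m (\<xi> - \<xi>') \<zeta> = m \<xi> \<zeta> - m \<xi>' \<zeta>"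
    by (rule eq) (simp_all add: ips)
  show "\<xi> \<in> elems Y \<Longrightarrow> \<zeta> \<in> elems Z \<Longrightarrow> m \<xi> (ract Z \<zeta> a) = ract W (m \<xi> \<zeta>) a"
    by (rule eq) (simp_all add: ips mult.assoc)
  show "\<xi> \<in> elems Y \<Longrightarrow> \<zeta> \<in> elems Z \<Longrightarrow> m (ract Y \<xi> a) \<zeta> = m \<xi> (lact Z a \<zeta>)"
    by (rule eq) (simp_all add: ips)
qed

lemma m_zero [simp]: "\<xi> \<in> elems Y \<Longrightarrow> m \<xi> 0 = 0" "\<zeta> \<in> elems Z \<Longrightarrow> m 0 \<zeta> = 0"
  using m_diff_right[of \<xi> 0 0] m_diff_left[of 0 0 \<zeta>] by auto

lemma m_sum_list_right:
  "\<xi> \<in> elems Y \<Longrightarrow> (\<And>x. x \<in> set xs \<Longrightarrow> f x \<in> elems Z) \<Longrightarrow> m \<xi> (\<Sum>x\<leftarrow>xs. f x) = (\<Sum>x\<leftarrow>xs. m \<xi> (f x))"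
  by (induction xs) (auto simp: m_add_right)

lemma m_sum_list_left:
  "\<zeta> \<in> elems Z \<Longrightarrow> (\<And>x. x \<in> set xs \<Longrightarrow> f x \<in> elems Y) \<Longrightarrow> m (\<Sum>x\<leftarrow>xs. f x) \<zeta> = (\<Sum>x\<leftarrow>xs. m (f x) \<zeta>)"
  by (induction xs) (auto simp: m_add_left)

lemma hnorm_m_le:
  assumes [simp]: "\<xi> \<in> elems Y" "\<zeta> \<in> elems Z"
  shows "hnorm W (m \<xi> \<zeta>) \<le> hnorm Y \<xi> * hnorm Z \<zeta>"
proof (rule power2_le_imp_le)
  have "norm (ip Z \<zeta> (lact Z (ip Y \<xi> \<xi>) \<zeta>)) \<le> norm ((hnorm Y \<xi>)\<^sup>2 *\<^sub>R ip Z \<zeta> \<zeta>)"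
    by (intro pos_norm_mono Z.pos_ip_lact Z.ip_lact_le_norm) (simp_all add: Y.ip_pos Y.hnorm_sq)
  then show "(hnorm W (m \<xi> \<zeta>))\<^sup>2 \<le> (hnorm Y \<xi> * hnorm Z \<zeta>)\<^sup>2"
    by (simp add: W.hnorm_sq ip_m power_mult_distrib Z.hnorm_sq)
qed simp

definition tensors :: "('x \<times> 'x) list set" where
  "tensors = lists (elems Y \<times> elems Z)"

lemma tensors_simps [simp]: "[] \<in> tensors" "p # s \<in> tensors \<longleftrightarrow> p \<in> elems Y \<times> elems Z \<and> s \<in> tensors"
  by (simp_all add: tensors_def)

definition msum :: "('x \<times> 'x) list \<Rightarrow> 'x" where
  "msum s = (\<Sum>(\<xi>, \<zeta>)\<leftarrow>s. m \<xi> \<zeta>)"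

definition left_map :: "('x \<Rightarrow> 'x) \<Rightarrow> ('x \<times> 'x) list \<Rightarrow> ('x \<times> 'x) list" where
  "left_map T s = map (\<lambda>(\<xi>, \<zeta>). (T \<xi>, \<zeta>)) s"

text \<open>The adjoint of the creation operator \<open>\<zeta> \<mapsto> m \<xi> \<zeta>\<close>.\<close>

definition annihilate :: "'x \<Rightarrow> ('x \<times> 'x) list \<Rightarrow> 'x" where
  "annihilate \<xi> s = (\<Sum>(\<xi>', \<zeta>')\<leftarrow>s. lact Z (ip Y \<xi> \<xi>') \<zeta>')"

lemma msum_simps [simp]: "msum [] = 0" "msum ((\<xi>, \<zeta>) # s) = m \<xi> \<zeta> + msum s"
  by (simp_all add: msum_def)

lemma left_map_simps [simp]: "left_map T [] = []" "left_map T ((\<xi>, \<zeta>) # s) = (T \<xi>, \<zeta>) # left_map T s"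
  by (simp_all add: left_map_def)

lemma annihilate_simps [simp]:
  "annihilate \<xi> [] = 0" "annihilate \<xi> ((\<xi>', \<zeta>') # s) = lact Z (ip Y \<xi> \<xi>') \<zeta>' + annihilate \<xi> s"
  by (simp_all add: annihilate_def)

lemma tensors_dense: "\<eta> \<in> elems W \<Longrightarrow> 0 < e \<Longrightarrow> \<exists>s\<in>tensors. hnorm W (\<eta> - msum s) < e"
  using iso unfolding tensor_iso_def msum_def tensors_def by auto

lemma msum_closed [simp]: "s \<in> tensors \<Longrightarrow> msum s \<in> elems W"
  by (induction s) auto

lemma annihilate_closed [simp]: "s \<in> tensors \<Longrightarrow> annihilate \<xi> s \<in> elems Z"
  by (induction s) auto

lemma left_map_closed [simp]:
  assumes "s \<in> tensors" and T: "\<And>\<xi>. \<xi> \<in> elems Y \<Longrightarrow> T \<xi> \<in> elems Y"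
  shows "left_map T s \<in> tensors"
  using assms(1) by (induction s) (auto simp: T)

lemma ip_m_msum:
  "s \<in> tensors \<Longrightarrow> \<xi> \<in> elems Y \<Longrightarrow> \<zeta> \<in> elems Z \<Longrightarrow> ip W (m \<xi> \<zeta>) (msum s) = ip Z \<zeta> (annihilate \<xi> s)"
  by (induction s) (auto simp: W.ip_add Z.ip_add ip_m)

lemma ip_left_map:
  assumes T: "Y.adjoint_pair T S" and s: "s \<in> tensors" and s': "s' \<in> tensors"
  shows "ip W (msum (left_map T s)) (msum s') = ip W (msum s) (msum (left_map S s'))"
proof -
  note D = Y.adjoint_pairD[OF T]
  have one: "ip W (m (T \<xi>) \<zeta>) (msum s') = ip W (m \<xi> \<zeta>) (msum (left_map S s'))"
    if "\<xi> \<in> elems Y" "\<zeta> \<in> elems Z" for \<xi> \<zeta>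
    using s' that by (induction s') (auto simp: W.ip_add ip_m D)
  show ?thesis
    using s s' by (induction s) (auto simp: W.ip_add_left one D)
qed

lemma msum_left_map_diff:
  assumes "s \<in> tensors"
    and TS: "\<And>\<xi>. \<xi> \<in> elems Y \<Longrightarrow> T \<xi> \<in> elems Y" "\<And>\<xi>. \<xi> \<in> elems Y \<Longrightarrow> S \<xi> \<in> elems Y"
  shows "msum (left_map (\<lambda>\<xi>. T \<xi> - S \<xi>) s) = msum (left_map T s) - msum (left_map S s)"
  using assms(1) by (induction s) (auto simp: m_diff_left TS)

lemma left_map_id [simp]: "left_map (\<lambda>\<xi>. \<xi>) s = s"
  by (induction s) auto

lemma left_map_comp_cong:
  assumes "s \<in> tensors" and TS: "\<And>\<xi>. \<xi> \<in> elems Y \<Longrightarrow> T (S \<xi>) = R \<xi>"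
  shows "left_map T (left_map S s) = left_map R s"
  using assms(1) by (induction s) (auto simp: TS)

text \<open>
  Annihilating and then creating \<open>\<xi>\<close> is $\theta_{\xi,\xi} \otimes 1$; the sum over the family is
  \<open>frame_op xs \<otimes> 1\<close>.
\<close>

lemma msum_frame_op:
  assumes xs: "set xs \<subseteq> elems Y" and s: "s \<in> tensors"
  shows "(\<Sum>\<xi>\<leftarrow>xs. m \<xi> (annihilate \<xi> s)) = msum (left_map (Y.frame_op xs) s)"
  using s
proof (induction s)
  case Nil
  then show ?case
    using xs by (induction xs) auto
next
  case (Cons p s)
  obtain \<xi>' \<zeta>' where p: "p = (\<xi>', \<zeta>')" and [simp]: "\<xi>' \<in> elems Y" "\<zeta>' \<in> elems Z"
    using Cons by auto
  have "(\<Sum>\<xi>\<leftarrow>xs. m \<xi> (annihilate \<xi> (p # s)))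
      = (\<Sum>\<xi>\<leftarrow>xs. m (ract Y \<xi> (ip Y \<xi> \<xi>')) \<zeta>' + m \<xi> (annihilate \<xi> s))"
    using xs Cons by (intro arg_cong[where f = sum_list] map_cong) (auto simp: p m_add_right m_balanced)
  also have "\<dots> = m (Y.frame_op xs \<xi>') \<zeta>' + msum (left_map (Y.frame_op xs) s)"
    using Cons xs unfolding Y.frame_op_def
    by (subst m_sum_list_left) (auto simp: sum_list_addf Y.frame_op_def)
  finally show ?case
    by (simp add: p)
qed

definition products :: "'x list \<Rightarrow> ('x \<Rightarrow> 'x list) \<Rightarrow> 'x list" where
  "products xs ks = concat (map (\<lambda>\<xi>. map (m \<xi>) (ks \<xi>)) xs)"

lemma sum_list_products: "(\<Sum>\<mu>\<leftarrow>products xs ks. f \<mu>) = (\<Sum>\<xi>\<leftarrow>xs. \<Sum>\<zeta>\<leftarrow>ks \<xi>. f (m \<xi> \<zeta>))"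
  by (induction xs) (simp_all add: products_def o_def)

text \<open>
  On a finite sum \<open>\<eta>\<close> of elementary tensors the operator of a product family is at most
  \<open>frame_op xs \<otimes> 1\<close>, and \<open>1 - frame_op xs\<close> has a self-adjoint square root \<open>S\<close>, so that
  \<open>\<langle>\<eta>, (1 - frame_op xs \<otimes> 1) \<eta>\<rangle>\<close> is the square of the image of \<open>\<eta>\<close> under \<open>S \<otimes> 1\<close>.
\<close>

lemma admissible_products:
  assumes xs: "Y.admissible xs" and ks: "\<And>\<xi>. \<xi> \<in> set xs \<Longrightarrow> Z.admissible (ks \<xi>)"
  shows "W.admissible (products xs ks)"
proof -
  have sub: "set xs \<subseteq> elems Y"
    using xs by (simp add: Y.admissible_def)
  have subk: "set (ks \<xi>) \<subseteq> elems Z" if "\<xi> \<in> set xs" for \<xi>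
    using ks[OF that] by (simp add: Z.admissible_def)
  have subp: "set (products xs ks) \<subseteq> elems W"
    using sub subk by (fastforce simp: products_def)
  obtain S where S: "Y.adjoint_pair S S" "\<And>\<xi>. \<xi> \<in> elems Y \<Longrightarrow> S (S \<xi>) = \<xi> - Y.frame_op xs \<xi>"
    using Y.admissible_root[OF xs] by metis
  let ?Q = "\<lambda>\<eta>. ip W \<eta> \<eta> - (\<Sum>\<mu>\<leftarrow>products xs ks. star (ip W \<mu> \<eta>) * ip W \<mu> \<eta>)"
  have tensors: "pos_element (?Q (msum s))" if s: "s \<in> tensors" for s
  proof -
    let ?u = "\<lambda>\<xi>. annihilate \<xi> s"
    have "(\<Sum>\<mu>\<leftarrow>products xs ks. star (ip W \<mu> (msum s)) * ip W \<mu> (msum s))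
        = (\<Sum>\<xi>\<leftarrow>xs. \<Sum>\<zeta>\<leftarrow>ks \<xi>. star (ip Z \<zeta> (?u \<xi>)) * ip Z \<zeta> (?u \<xi>))"
      unfolding sum_list_products using sub subk s
      by (intro arg_cong[where f = sum_list] map_cong refl) (simp add: ip_m_msum subset_iff)
    moreover have "(\<Sum>\<xi>\<leftarrow>xs. ip Z (?u \<xi>) (?u \<xi>)) = ip W (msum s) (\<Sum>\<xi>\<leftarrow>xs. m \<xi> (?u \<xi>))"
    proof -
      have "ip W (msum s) (m \<xi> (?u \<xi>)) = ip Z (?u \<xi>) (?u \<xi>)" if "\<xi> \<in> set xs" for \<xi>
      proof -
        have "\<xi> \<in> elems Y"
          using that sub by auto
        then have "star (ip W (m \<xi> (?u \<xi>)) (msum s)) = star (ip Z (?u \<xi>) (?u \<xi>))"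
          using s by (simp add: ip_m_msum)
        then show ?thesis
          using s \<open>\<xi> \<in> elems Y\<close> by (simp add: W.ip_star Z.ip_star)
      qed
      then show ?thesis
        using s sub by (subst W.ip_sum_list) (auto intro!: arg_cong[where f = sum_list])
    qed
    moreover have "\<dots> = ip W (msum s) (msum (left_map (Y.frame_op xs) s))"
      by (simp add: msum_frame_op[OF sub s])
    moreover have "ip W (msum s) (msum s) - ip W (msum s) (msum (left_map (Y.frame_op xs) s))
        = ip W (msum (left_map S s)) (msum (left_map S s))"
    proof -
      note SC = Y.adjoint_pairD(1)[OF S(1)]
      have "ip W (msum (left_map S s)) (msum (left_map S s)) = ip W (msum s) (msum (left_map S (left_map S s)))"
        using s SC by (intro ip_left_map[OF S(1)]) auto
      also have "left_map S (left_map S s) = left_map (\<lambda>\<xi>. \<xi> - Y.frame_op xs \<xi>) s"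
        using s S(2) by (rule left_map_comp_cong)
      also have "msum \<dots> = msum s - msum (left_map (Y.frame_op xs) s)"
        using s sub by (subst msum_left_map_diff) auto
      finally show ?thesis
        using s sub by (simp add: W.ip_diff)
    qed
    ultimately have "?Q (msum s) = ip W (msum (left_map S s)) (msum (left_map S s))
        + (\<Sum>\<xi>\<leftarrow>xs. ip Z (?u \<xi>) (?u \<xi>) - (\<Sum>\<zeta>\<leftarrow>ks \<xi>. star (ip Z \<zeta> (?u \<xi>)) * ip Z \<zeta> (?u \<xi>)))"
      by (simp add: sum_list_subtractf diff_eq_eq)
    also have "pos_element \<dots>"
      using s ks Y.adjoint_pairD(1)[OF S(1)]
      by (intro pos_add W.ip_pos W.pos_sum_list) (auto simp: Z.admissible_def)
    finally show ?thesis .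
  qed
  have "pos_element (?Q \<eta>)" if \<eta>: "\<eta> \<in> elems W" for \<eta>
  proof -
    have "\<forall>n. \<exists>s\<in>tensors. hnorm W (\<eta> - msum s) < 1 / real (Suc n)"
      using tensors_dense[OF \<eta>] by simp
    then obtain s where s: "\<And>n. s n \<in> tensors" "\<And>n. hnorm W (\<eta> - msum (s n)) < 1 / real (Suc n)"
      by metis
    have lim: "(\<lambda>n. hnorm W (msum (s n) - \<eta>)) \<longlonglongrightarrow> 0"
    proof (rule Lim_null_comparison[OF _ LIMSEQ_Suc[OF lim_1_over_n]])
      show "\<forall>\<^sub>F n in sequentially. norm (hnorm W (msum (s n) - \<eta>)) \<le> 1 / real (Suc n)"
        using s \<eta> W.hnorm_minus_commute[of \<eta>] by (auto intro!: always_eventually less_imp_le)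
    qed
    have "(\<lambda>n. \<Sum>\<mu>\<leftarrow>ps. star (ip W \<mu> (msum (s n))) * ip W \<mu> (msum (s n)))
        \<longlonglongrightarrow> (\<Sum>\<mu>\<leftarrow>ps. star (ip W \<mu> \<eta>) * ip W \<mu> \<eta>)" if "set ps \<subseteq> elems W" for ps
      using that
    proof (induction ps)
      case (Cons \<mu> ps)
      then show ?case
        using W.ip_limit[OF \<eta> _ msum_closed[OF s(1)] lim, of \<mu>]
        by (auto intro!: tendsto_add tendsto_mult bounded_linear.tendsto[OF bounded_linear_star])
    qed simp
    then have "(\<lambda>n. ?Q (msum (s n))) \<longlonglongrightarrow> ?Q \<eta>"
      using subp by (intro tendsto_diff W.ip_self_limit[OF \<eta> msum_closed[OF s(1)] lim]) auto
    then show ?thesis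
      by (rule pos_limit[rotated]) (rule tensors[OF s(1)])
  qed
  then show ?thesis
    using subp by (simp add: W.admissible_def)
qed

lemma trace_sum_products:
  assumes "set xs \<subseteq> elems Y" "\<And>\<xi>. \<xi> \<in> set xs \<Longrightarrow> set (ks \<xi>) \<subseteq> elems Z"
  shows "W.trace_sum (products xs ks) a = (\<Sum>\<xi>\<leftarrow>xs. Z.trace_sum (ks \<xi>) (ip Y \<xi> (lact Y a \<xi>)))"
  unfolding W.trace_sum_def Z.trace_sum_def sum_list_products
  using assms by (intro arg_cong[where f = sum_list] map_cong refl) (simp add: lact_m ip_m subset_iff)

text \<open>
  A crude bound for \<open>T \<otimes> 1\<close> on one representation of a tensor; it suffices because \<open>\<delta>\<close> is chosen
  after the representation.
\<close>

lemma hnorm_msum_left_map_le: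
  assumes "s \<in> tensors" "\<And>\<xi>. \<xi> \<in> elems Y \<Longrightarrow> T \<xi> \<in> elems Y"
    and "\<And>\<xi>. \<xi> \<in> fst ` set s \<Longrightarrow> hnorm Y (T \<xi>) \<le> \<delta>"
  shows "hnorm W (msum (left_map T s)) \<le> \<delta> * (\<Sum>\<zeta>\<leftarrow>map snd s. hnorm Z \<zeta>)"
  using assms
proof (induction s)
  case (Cons p s)
  obtain \<xi> \<zeta> where p: "p = (\<xi>, \<zeta>)" and [simp]: "\<xi> \<in> elems Y" "\<zeta> \<in> elems Z"
    using Cons.prems(1) by auto
  have [simp]: "T \<xi> \<in> elems Y"
    using Cons.prems by auto
  have "hnorm W (m (T \<xi>) \<zeta> + msum (left_map T s)) \<le> hnorm W (m (T \<xi>) \<zeta>) + hnorm W (msum (left_map T s))"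
    using Cons.prems by (intro W.hnorm_triangle) auto
  also have "hnorm W (m (T \<xi>) \<zeta>) \<le> \<delta> * hnorm Z \<zeta>"
    using Cons.prems(3)[of \<xi>] by (intro order_trans[OF hnorm_m_le] mult_right_mono) (auto simp: p)
  also have "hnorm W (msum (left_map T s)) \<le> \<delta> * (\<Sum>\<zeta>\<leftarrow>map snd s. hnorm Z \<zeta>)"
    using Cons.prems by (intro Cons.IH) auto
  finally show ?case
    by (simp add: p algebra_simps)
qed simp

lemma frame_op_products:
  assumes xs: "set xs \<subseteq> elems Y" and ks: "\<And>\<xi>. \<xi> \<in> set xs \<Longrightarrow> set (ks \<xi>) \<subseteq> elems Z" and s: "s \<in> tensors"
  shows "W.frame_op (products xs ks) (msum s) = (\<Sum>\<xi>\<leftarrow>xs. m \<xi> (Z.frame_op (ks \<xi>) (annihilate \<xi> s)))"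
  unfolding W.frame_op_def sum_list_products
proof (intro arg_cong[where f = sum_list] map_cong refl)
  fix \<xi>
  assume "\<xi> \<in> set xs"
  then have "\<xi> \<in> elems Y" and sub: "set (ks \<xi>) \<subseteq> elems Z"
    using xs ks by auto
  then show "(\<Sum>\<zeta>\<leftarrow>ks \<xi>. ract W (m \<xi> \<zeta>) (ip W (m \<xi> \<zeta>) (msum s))) = m \<xi> (Z.frame_op (ks \<xi>) (annihilate \<xi> s))"
    unfolding Z.frame_op_def using s
    by (subst m_sum_list_right) (auto simp: ip_m_msum m_ract subset_iff intro!: arg_cong[where f = sum_list])
qed

text \<open>
  Approximate the vectors of \<open>G\<close> by finite sums of elementary tensors. The family \<open>xs\<close> has to
  fix the left factors of these sums, which is all that is asked of it; given \<open>xs\<close>, the families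
  \<open>ks\<close> in the right module are chosen to fix the finitely many vectors obtained by annihilation.
\<close>

lemma almost_fixes_products:
  assumes G: "set G \<subseteq> elems W" and "0 < \<epsilon>"
  obtains F \<delta> where "set F \<subseteq> elems Y" "0 < \<delta>"
    "\<And>xs. Y.admissible xs \<Longrightarrow> Y.almost_fixes xs F \<delta> \<Longrightarrow>
       \<exists>ks. (\<forall>\<xi>\<in>set xs. Z.admissible (ks \<xi>)) \<and> W.almost_fixes (products xs ks) G \<epsilon>"
proof -
  have "\<forall>\<eta>\<in>set G. \<exists>s\<in>tensors. hnorm W (\<eta> - msum s) < \<epsilon> / 4"
  proof
    fix \<eta>
    assume "\<eta> \<in> set G"
    then show "\<exists>s\<in>tensors. hnorm W (\<eta> - msum s) < \<epsilon> / 4"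
      using tensors_dense[of \<eta> "\<epsilon> / 4"] G \<open>0 < \<epsilon>\<close> by auto
  qed
  then obtain s where s: "\<And>\<eta>. \<eta> \<in> set G \<Longrightarrow> s \<eta> \<in> tensors"
    "\<And>\<eta>. \<eta> \<in> set G \<Longrightarrow> hnorm W (\<eta> - msum (s \<eta>)) < \<epsilon> / 4"
    by metis
  define F where "F = concat (map (\<lambda>\<eta>. map fst (s \<eta>)) G)"
  define N where "N = (\<Sum>\<eta>\<leftarrow>G. \<Sum>\<zeta>\<leftarrow>map snd (s \<eta>). hnorm Z \<zeta>)"
  have "0 \<le> N"
    unfolding N_def by (intro sum_list_nonneg) (auto intro!: sum_list_nonneg)
  define \<delta> where "\<delta> = \<epsilon> / 4 / (1 + N)"
  have "0 < \<delta>"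
    using \<open>0 < \<epsilon>\<close> \<open>0 \<le> N\<close> by (simp add: \<delta>_def)
  have "\<delta> * N < \<epsilon> / 4"
    using \<open>0 < \<epsilon>\<close> \<open>0 \<le> N\<close> by (simp add: \<delta>_def field_simps)
  show ?thesis
  proof (rule that[of F \<delta>])
    show "set F \<subseteq> elems Y"
      using s(1) by (fastforce simp: F_def tensors_def in_lists_conv_set)
    show "0 < \<delta>"
      by fact
    fix xs
    assume adm: "Y.admissible xs" and fixes_F: "Y.almost_fixes xs F \<delta>"
    have sub: "set xs \<subseteq> elems Y"
      using adm by (simp add: Y.admissible_def)
    define M where "M = (\<Sum>\<xi>\<leftarrow>xs. hnorm Y \<xi>)"
    have "0 \<le> M"
      unfolding M_def by (intro sum_list_nonneg) auto
    define \<delta>' where "\<delta>' = \<epsilon> / 4 / (1 + M)"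
    have "0 < \<delta>'"
      using \<open>0 < \<epsilon>\<close> \<open>0 \<le> M\<close> by (simp add: \<delta>'_def)
    have "\<delta>' * M < \<epsilon> / 4"
      using \<open>0 < \<epsilon>\<close> \<open>0 \<le> M\<close> by (simp add: \<delta>'_def field_simps)
    have "\<forall>\<xi>. \<exists>zs. Z.admissible zs \<and> Z.almost_fixes zs (map (\<lambda>\<eta>. annihilate \<xi> (s \<eta>)) G) \<delta>'"
    proof
      fix \<xi>
      have "set (map (\<lambda>\<eta>. annihilate \<xi> (s \<eta>)) G) \<subseteq> elems Z"
        using s(1) by auto
      then show "\<exists>zs. Z.admissible zs \<and> Z.almost_fixes zs (map (\<lambda>\<eta>. annihilate \<xi> (s \<eta>)) G) \<delta>'"
        using Z.approximate_unit[OF _ \<open>0 < \<delta>'\<close>] by metis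
    qed
    then obtain ks where ks: "\<And>\<xi>. Z.admissible (ks \<xi>)"
      "\<And>\<xi>. Z.almost_fixes (ks \<xi>) (map (\<lambda>\<eta>. annihilate \<xi> (s \<eta>)) G) \<delta>'"
      by metis
    have subk: "set (ks \<xi>) \<subseteq> elems Z" for \<xi>
      using ks(1) by (simp add: Z.admissible_def)
    let ?P = "products xs ks"
    have P: "W.admissible ?P"
      using adm ks(1) by (intro admissible_products)
    have subP: "set ?P \<subseteq> elems W"
      using P by (simp add: W.admissible_def)
    have "hnorm W (\<eta> - W.frame_op ?P \<eta>) < \<epsilon>" if \<eta>: "\<eta> \<in> set G" for \<eta>
    proof -
      have [simp]: "\<eta> \<in> elems W" "s \<eta> \<in> tensors"
        using \<eta> G s(1) by auto
      let ?h = "msum (left_map (Y.frame_op xs) (s \<eta>))"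
      have [simp]: "left_map (Y.frame_op xs) (s \<eta>) \<in> tensors"
        using sub by (intro left_map_closed) auto
      note [simp] = W.frame_op_closed[OF subP]
      have 1: "hnorm W (\<eta> - msum (s \<eta>)) < \<epsilon> / 4"
        by (rule s(2)[OF \<eta>])
      have "msum (s \<eta>) - ?h = msum (left_map (\<lambda>\<xi>. \<xi> - Y.frame_op xs \<xi>) (s \<eta>))"
        using sub by (subst msum_left_map_diff) auto
      also have "hnorm W \<dots> \<le> \<delta> * (\<Sum>\<zeta>\<leftarrow>map snd (s \<eta>). hnorm Z \<zeta>)"
      proof (rule hnorm_msum_left_map_le)
        fix \<xi>
        assume "\<xi> \<in> fst ` set (s \<eta>)"
        then have "\<xi> \<in> set F"
          using \<eta> by (auto simp: F_def)
        then show "hnorm Y (\<xi> - Y.frame_op xs \<xi>) \<le> \<delta>"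
          using fixes_F by (auto simp: Y.almost_fixes_def less_imp_le)
      qed (use sub in auto)
      also have "(\<Sum>\<zeta>\<leftarrow>map snd (s \<eta>). hnorm Z \<zeta>) \<le> N"
        unfolding N_def using \<eta> by (intro member_le_sum_list) (auto intro!: sum_list_nonneg)
      finally have 2: "hnorm W (msum (s \<eta>) - ?h) < \<epsilon> / 4"
        using \<open>0 < \<delta>\<close> \<open>\<delta> * N < \<epsilon> / 4\<close> by (simp add: mult_left_mono)
      have "?h - W.frame_op ?P (msum (s \<eta>))
          = (\<Sum>\<xi>\<leftarrow>xs. m \<xi> (annihilate \<xi> (s \<eta>) - Z.frame_op (ks \<xi>) (annihilate \<xi> (s \<eta>))))"
      proof -
        have "(\<Sum>\<xi>\<leftarrow>xs. m \<xi> (annihilate \<xi> (s \<eta>) - Z.frame_op (ks \<xi>) (annihilate \<xi> (s \<eta>))))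
          = (\<Sum>\<xi>\<leftarrow>xs. m \<xi> (annihilate \<xi> (s \<eta>)) - m \<xi> (Z.frame_op (ks \<xi>) (annihilate \<xi> (s \<eta>))))"
          using sub subk by (intro arg_cong[where f = sum_list] map_cong refl m_diff_right) auto
        then show ?thesis
          using sub subk by (simp add: sum_list_subtractf frame_op_products msum_frame_op)
      qed
      also have "hnorm W \<dots> \<le> (\<Sum>\<xi>\<leftarrow>xs. hnorm W (m \<xi> (annihilate \<xi> (s \<eta>) - Z.frame_op (ks \<xi>) (annihilate \<xi> (s \<eta>)))))"
        using sub subk by (intro W.hnorm_sum_list) auto
      also have "\<dots> \<le> (\<Sum>\<xi>\<leftarrow>xs. hnorm Y \<xi> * \<delta>')"
      proof (rule sum_list_mono)
        fix \<xi>
        assume "\<xi> \<in> set xs"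
        then have "\<xi> \<in> elems Y"
          using sub by auto
        moreover have "hnorm Z (annihilate \<xi> (s \<eta>) - Z.frame_op (ks \<xi>) (annihilate \<xi> (s \<eta>))) \<le> \<delta>'"
          using ks(2)[of \<xi>] \<eta> by (auto simp: Z.almost_fixes_def less_imp_le)
        ultimately show "hnorm W (m \<xi> (annihilate \<xi> (s \<eta>) - Z.frame_op (ks \<xi>) (annihilate \<xi> (s \<eta>)))) \<le> hnorm Y \<xi> * \<delta>'"
          using subk by (intro order_trans[OF hnorm_m_le] mult_left_mono) auto
      qed
      also have "\<dots> = \<delta>' * M"
        unfolding M_def sum_list_const_mult[symmetric] by (simp add: mult.commute)
      finally have 3: "hnorm W (?h - W.frame_op ?P (msum (s \<eta>))) < \<epsilon> / 4"
        using \<open>\<delta>' * M < \<epsilon> / 4\<close> by linarith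
      have "W.frame_op ?P (msum (s \<eta>)) - W.frame_op ?P \<eta> = W.frame_op ?P (msum (s \<eta>) - \<eta>)"
        by (simp add: W.adjoint_pair_diff[OF W.adjoint_pair_frame_op[OF subP]])
      then have "hnorm W (W.frame_op ?P (msum (s \<eta>)) - W.frame_op ?P \<eta>) \<le> hnorm W (msum (s \<eta>) - \<eta>)"
        using W.frame_op_contraction[OF P, of "msum (s \<eta>) - \<eta>"] by simp
      then have 4: "hnorm W (W.frame_op ?P (msum (s \<eta>)) - W.frame_op ?P \<eta>) < \<epsilon> / 4"
        using 1 W.hnorm_minus_commute[of \<eta> "msum (s \<eta>)"] by simp
      show ?thesis
        using 1 2 3 4 W.hnorm_triangle_diff[of \<eta> "msum (s \<eta>)" "W.frame_op ?P \<eta>"]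
          W.hnorm_triangle_diff[of "msum (s \<eta>)" ?h "W.frame_op ?P \<eta>"]
          W.hnorm_triangle_diff[of ?h "W.frame_op ?P (msum (s \<eta>))" "W.frame_op ?P \<eta>"]
        by simp
    qed
    then have "W.almost_fixes ?P G \<epsilon>"
      using subP by (simp add: W.almost_fixes_def)
    then show "\<exists>ks. (\<forall>\<xi>\<in>set xs. Z.admissible (ks \<xi>)) \<and> W.almost_fixes (products xs ks) G \<epsilon>"
      using ks(1) by blast
  qed
qed

definition tr :: "'a \<Rightarrow> real" where
  "tr b = real_of_ereal (Tr \<tau> Z b)"

context
  assumes finite_Tr: "\<And>b. pos_element b \<Longrightarrow> Tr \<tau> Z b \<noteq> \<infinity>"
begin

lemma ereal_tr: "pos_element b \<Longrightarrow> ereal (tr b) = Tr \<tau> Z b"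
  using finite_Tr[of b] Z.Tr_nonneg[of b] unfolding tr_def by (auto simp: ereal_real)

text \<open>
  This bound and the next one say that inducing a trace through \<open>Z\<close> and then through \<open>Y\<close> is inducing
  it through \<open>W\<close>. The lower bound holds for every sufficiently good approximate unit of \<open>Y\<close>, so that
  one of them can serve several modules \<open>Z\<close>.
\<close>

theorem sum_tr_le_Tr:
  assumes a: "pos_element a" and xs: "Y.admissible xs"
  shows "ereal (\<Sum>\<xi>\<leftarrow>xs. tr (ip Y \<xi> (lact Y a \<xi>))) \<le> Tr \<tau> W a"
proof (rule ereal_le_epsilon2)
  fix e :: real
  assume "0 < e"
  have sub: "set xs \<subseteq> elems Y"
    using xs by (simp add: Y.admissible_def)
  let ?b = "\<lambda>\<xi>. ip Y \<xi> (lact Y a \<xi>)"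
  define e' where "e' = e / real (Suc (length xs))"
  have "0 < e'"
    using \<open>0 < e\<close> by (simp add: e'_def)
  have "\<forall>\<xi>\<in>set xs. \<exists>ks. Z.admissible ks \<and> tr (?b \<xi>) - e' < Z.trace_sum ks (?b \<xi>)"
  proof
    fix \<xi>
    assume "\<xi> \<in> set xs"
    then have "pos_element (?b \<xi>)"
      using sub a by (auto intro: Y.pos_ip_lact)
    then have "ereal (tr (?b \<xi>) - e') < Tr \<tau> Z (?b \<xi>)"
      using ereal_tr[of "?b \<xi>"] \<open>0 < e'\<close> by (metis diff_less_eq less_add_same_cancel1 less_ereal.simps(1))
    then show "\<exists>ks. Z.admissible ks \<and> tr (?b \<xi>) - e' < Z.trace_sum ks (?b \<xi>)"
      using Z.less_Tr_obtain by metis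
  qed
  then obtain ks where ks: "\<And>\<xi>. \<xi> \<in> set xs \<Longrightarrow> Z.admissible (ks \<xi>)"
    "\<And>\<xi>. \<xi> \<in> set xs \<Longrightarrow> tr (?b \<xi>) - e' < Z.trace_sum (ks \<xi>) (?b \<xi>)"
    by metis
  have "(\<Sum>\<xi>\<leftarrow>xs. tr (?b \<xi>)) \<le> (\<Sum>\<xi>\<leftarrow>xs. Z.trace_sum (ks \<xi>) (?b \<xi>) + e')"
    using ks(2) by (intro sum_list_mono) (simp add: less_imp_le diff_le_eq[symmetric])
  also have "\<dots> = W.trace_sum (products xs ks) a + real (length xs) * e'"
    using sub ks(1) by (subst trace_sum_products) (auto simp: sum_list_addf sum_list_triv Z.admissible_def)
  also have "real (length xs) * e' \<le> e"
    using \<open>0 < e\<close> by (simp add: e'_def field_simps)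
  finally have "ereal (\<Sum>\<xi>\<leftarrow>xs. tr (?b \<xi>)) \<le> ereal (W.trace_sum (products xs ks) a) + ereal e"
    by simp
  also have "\<dots> \<le> Tr \<tau> W a + ereal e"
    using admissible_products[OF xs ks(1)] by (intro add_right_mono W.trace_sum_le_Tr) auto
  finally show "ereal (\<Sum>\<xi>\<leftarrow>xs. tr (?b \<xi>)) \<le> Tr \<tau> W a + ereal e" .
qed

theorem less_Tr_eventually:
  assumes a: "pos_element a" and B: "ereal B < Tr \<tau> W a"
  obtains F \<delta> where "set F \<subseteq> elems Y" "0 < \<delta>"
    "\<And>xs. Y.admissible xs \<Longrightarrow> Y.almost_fixes xs F \<delta> \<Longrightarrow> B < (\<Sum>\<xi>\<leftarrow>xs. tr (ip Y \<xi> (lact Y a \<xi>)))"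
proof -
  obtain ms where ms: "W.admissible ms" "B < W.trace_sum ms a"
    using W.less_Tr_obtain[OF B] .
  obtain G \<epsilon> where G: "set G \<subseteq> elems W" "0 < \<epsilon>" "\<And>ns. W.almost_fixes ns G \<epsilon> \<Longrightarrow> B < W.trace_sum ns a"
    using W.trace_sum_eventually[OF a ms] by metis
  obtain F \<delta> where F: "set F \<subseteq> elems Y" "0 < \<delta>"
    "\<And>xs. Y.admissible xs \<Longrightarrow> Y.almost_fixes xs F \<delta> \<Longrightarrow>
       \<exists>ks. (\<forall>\<xi>\<in>set xs. Z.admissible (ks \<xi>)) \<and> W.almost_fixes (products xs ks) G \<epsilon>"
    using almost_fixes_products[OF G(1,2)] by metis
  show ?thesis
  proof (rule that[OF F(1,2)])
    fix xs
    assume xs: "Y.admissible xs" and "Y.almost_fixes xs F \<delta>"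
    then obtain ks where ks: "\<forall>\<xi>\<in>set xs. Z.admissible (ks \<xi>)" and "W.almost_fixes (products xs ks) G \<epsilon>"
      using F(3) by blast
    have sub: "set xs \<subseteq> elems Y"
      using xs by (simp add: Y.admissible_def)
    have "B < W.trace_sum (products xs ks) a"
      by (rule G(3)) fact
    also have "\<dots> = (\<Sum>\<xi>\<leftarrow>xs. Z.trace_sum (ks \<xi>) (ip Y \<xi> (lact Y a \<xi>)))"
      using sub ks by (intro trace_sum_products) (auto simp: Z.admissible_def)
    also have "\<dots> \<le> (\<Sum>\<xi>\<leftarrow>xs. tr (ip Y \<xi> (lact Y a \<xi>)))"
    proof (rule sum_list_mono)
      fix \<xi>
      assume \<xi>: "\<xi> \<in> set xs"
      then have "pos_element (ip Y \<xi> (lact Y a \<xi>))"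
        using sub a by (auto intro: Y.pos_ip_lact)
      then have "ereal (Z.trace_sum (ks \<xi>) (ip Y \<xi> (lact Y a \<xi>))) \<le> ereal (tr (ip Y \<xi> (lact Y a \<xi>)))"
        using Z.trace_sum_le_Tr ks \<xi> ereal_tr by metis
      then show "Z.trace_sum (ks \<xi>) (ip Y \<xi> (lact Y a \<xi>)) \<le> tr (ip Y \<xi> (lact Y a \<xi>))"
        by simp
    qed
    finally show "B < (\<Sum>\<xi>\<leftarrow>xs. tr (ip Y \<xi> (lact Y a \<xi>)))" .
  qed
qed

end

theorem Tr_tensor_bound:
  assumes Y: "\<And>b. pos_element b \<Longrightarrow> Tr \<tau> Y b \<le> ereal (C * Re (\<tau> b))"
    and Z: "\<And>b. pos_element b \<Longrightarrow> Tr \<tau> Z b \<le> ereal (D * Re (\<tau> b))" and "0 \<le> D"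
    and a: "pos_element a"
  shows "Tr \<tau> W a \<le> ereal (D * C * Re (\<tau> a))"
proof (rule ccontr)
  have fin: "Tr \<tau> Z b \<noteq> \<infinity>" if "pos_element b" for b
    using Z[OF that] by auto
  assume "\<not> Tr \<tau> W a \<le> ereal (D * C * Re (\<tau> a))"
  then have less: "ereal (D * C * Re (\<tau> a)) < Tr \<tau> W a"
    by simp
  obtain F \<delta> where F: "set F \<subseteq> elems Y" "0 < \<delta>"
    "\<And>xs. Y.admissible xs \<Longrightarrow> Y.almost_fixes xs F \<delta> \<Longrightarrow>
      D * C * Re (\<tau> a) < (\<Sum>\<xi>\<leftarrow>xs. tr (ip Y \<xi> (lact Y a \<xi>)))"
    using less_Tr_eventually[OF fin a less] by blast
  obtain xs where xs: "Y.admissible xs" "Y.almost_fixes xs F \<delta>"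
    using Y.approximate_unit[OF F(1,2)] .
  have sub: "set xs \<subseteq> elems Y"
    using xs by (simp add: Y.admissible_def)
  have "D * C * Re (\<tau> a) < (\<Sum>\<xi>\<leftarrow>xs. tr (ip Y \<xi> (lact Y a \<xi>)))"
    using F(3) xs by blast
  also have "\<dots> \<le> (\<Sum>\<xi>\<leftarrow>xs. D * Re (\<tau> (ip Y \<xi> (lact Y a \<xi>))))"
  proof (rule sum_list_mono)
    fix \<xi>
    assume "\<xi> \<in> set xs"
    then have pos: "pos_element (ip Y \<xi> (lact Y a \<xi>))"
      using sub a by (auto intro: Y.pos_ip_lact)
    then have "ereal (tr (ip Y \<xi> (lact Y a \<xi>))) \<le> ereal (D * Re (\<tau> (ip Y \<xi> (lact Y a \<xi>))))"
      using ereal_tr[OF fin pos] Z[OF pos] by simp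
    then show "tr (ip Y \<xi> (lact Y a \<xi>)) \<le> D * Re (\<tau> (ip Y \<xi> (lact Y a \<xi>)))"
      by simp
  qed
  also have "\<dots> = D * Y.trace_sum xs a"
    by (simp add: Y.trace_sum_def sum_list_const_mult)
  also have "\<dots> \<le> D * (C * Re (\<tau> a))"
  proof -
    have "ereal (Y.trace_sum xs a) \<le> ereal (C * Re (\<tau> a))"
      using order_trans[OF Y.trace_sum_le_Tr[OF xs(1)] Y[OF a]] .
    then show ?thesis
      using \<open>0 \<le> D\<close> by (simp add: mult_left_mono)
  qed
  finally show False
    by (simp add: mult.assoc)
qed

end

section \<open>Inclusion-exclusion sums\<close>

text \<open>
  The alternating sum of \<open>\<psi> (U \<inter> \<Inter>K)\<close> over the subfamilies \<open>K\<close> of a list; see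
  \<open>incl_excl_subsets\<close>. The recursion turns each identity below into an induction on the list.
\<close>

fun incl_excl :: "('s set \<Rightarrow> real) \<Rightarrow> 's set \<Rightarrow> 's set list \<Rightarrow> real" where
  "incl_excl \<psi> U [] = \<psi> U"
| "incl_excl \<psi> U (A # As) = incl_excl \<psi> U As - incl_excl \<psi> (U \<inter> A) As"

lemma incl_excl_middle: "incl_excl \<psi> U (As @ A # Bs) = incl_excl \<psi> U (A # As @ Bs)"
proof (induction As arbitrary: U)
  case (Cons B As)
  have "U \<inter> B \<inter> A = U \<inter> A \<inter> B"
    by blast
  then show ?case
    using Cons[of U] Cons[of "U \<inter> B"] by simp
qed simp

lemma incl_excl_superset: "A \<in> set As \<Longrightarrow> U \<subseteq> A \<Longrightarrow> incl_excl \<psi> U As = 0"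
proof (induction As arbitrary: U)
  case (Cons B Bs)
  show ?case
  proof (cases "A = B")
    case True
    then show ?thesis
      using Cons.prems by (simp add: Int_absorb2)
  next
    case False
    then show ?thesis
      using Cons.IH[of U] Cons.IH[of "U \<inter> B"] Cons.prems by auto
  qed
qed simp

lemma incl_excl_empty: "\<psi> {} = 0 \<Longrightarrow> incl_excl \<psi> {} As = 0"
  by (induction As) auto

lemma incl_excl_restrict: "U \<subseteq> V \<Longrightarrow> incl_excl \<psi> U (map (\<lambda>A. V \<inter> A) As) = incl_excl \<psi> U As"
proof (induction As arbitrary: U)
  case (Cons A As)
  have "U \<inter> (V \<inter> A) = U \<inter> A"
    using Cons.prems by blast
  then show ?case
    using Cons.IH[of U] Cons.IH[of "U \<inter> A"] Cons.prems by auto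
qed simp

lemma incl_excl_filter_nonempty:
  "\<psi> {} = 0 \<Longrightarrow> incl_excl \<psi> U (filter (\<lambda>A. A \<noteq> {}) As) = incl_excl \<psi> U As"
  by (induction As arbitrary: U) (auto simp: incl_excl_empty)

lemma incl_excl_image:
  assumes "inj_on f C"
  shows "U \<subseteq> C \<Longrightarrow> \<Union> (set As) \<subseteq> C \<Longrightarrow>
    incl_excl \<psi> (f ` U) (map ((`) f) As) = incl_excl (\<lambda>S. \<psi> (f ` S)) U As"
proof (induction As arbitrary: U)
  case (Cons A As)
  have "f ` U \<inter> f ` A = f ` (U \<inter> A)"
    using Cons.prems by (intro inj_on_image_Int[OF assms, symmetric]) auto
  then show ?case
    using Cons.IH[of U] Cons.IH[of "U \<inter> A"] Cons.prems by auto
qed simp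

lemma incl_excl_close:
  assumes "\<And>U A. U \<in> S \<Longrightarrow> A \<in> set As \<Longrightarrow> U \<inter> A \<in> S" and "\<And>U. U \<in> S \<Longrightarrow> \<bar>\<psi> U - \<phi> U\<bar> \<le> \<epsilon>" and "U \<in> S"
  shows "\<bar>incl_excl \<psi> U As - incl_excl \<phi> U As\<bar> \<le> 2 ^ length As * \<epsilon>"
  using assms
proof (induction As arbitrary: U)
  case (Cons A As)
  have "\<bar>incl_excl \<psi> V As - incl_excl \<phi> V As\<bar> \<le> 2 ^ length As * \<epsilon>" if "V \<in> {U, U \<inter> A}" for V
    using Cons.prems that by (intro Cons.IH) auto
  from this[of U] this[of "U \<inter> A"] show ?case
    by (simp add: abs_le_iff)
qed simp

lemma incl_excl_remdups: "incl_excl \<psi> U (map A (remdups js)) = incl_excl \<psi> U (map A js)"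
proof (induction js arbitrary: U)
  case (Cons j js)
  have "incl_excl \<psi> (U \<inter> A j) (map A js) = 0" if "j \<in> set js"
    using that by (intro incl_excl_superset[of "A j"]) auto
  then show ?case
    using Cons by auto
qed simp

lemma incl_excl_scaled_sum:
  "incl_excl (\<lambda>S. c * (\<Sum>x\<leftarrow>xs. \<psi> x S)) U As = c * (\<Sum>x\<leftarrow>xs. incl_excl (\<psi> x) U As)"
  by (induction As arbitrary: U) (simp_all add: sum_list_subtractf right_diff_distrib)

lemma sum_Pow_insert:
  fixes f :: "'s set \<Rightarrow> 'b::comm_monoid_add"
  assumes "finite J" "j \<notin> J"
  shows "(\<Sum>K\<in>Pow (insert j J). f K) = (\<Sum>K\<in>Pow J. f K) + (\<Sum>K\<in>Pow J. f (insert j K))"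
proof -
  have "inj_on (insert j) (Pow J)"
    using assms(2) by (auto simp: inj_on_def)
  moreover have "Pow J \<inter> insert j ` Pow J = {}"
    using assms(2) by auto
  ultimately show ?thesis
    using assms(1) unfolding Pow_insert by (subst sum.union_disjoint) (auto simp: sum.reindex)
qed

lemma incl_excl_subsets:
  "distinct js \<Longrightarrow> incl_excl \<psi> U (map A js) = (\<Sum>K\<in>Pow (set js). (-1) ^ card K * \<psi> (U \<inter> (\<Inter>k\<in>K. A k)))"
proof (induction js arbitrary: U)
  case (Cons j js)
  have "(\<Sum>K\<in>Pow (set js). (-1) ^ card (insert j K) * \<psi> (U \<inter> (\<Inter>k\<in>insert j K. A k)))
      = - (\<Sum>K\<in>Pow (set js). (-1) ^ card K * \<psi> (U \<inter> A j \<inter> (\<Inter>k\<in>K. A k)))"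
    unfolding sum_negf[symmetric]
  proof (rule sum.cong)
    fix K
    assume "K \<in> Pow (set js)"
    then have "finite K" "j \<notin> K"
      using Cons.prems finite_subset by auto
    then show "(-1) ^ card (insert j K) * \<psi> (U \<inter> (\<Inter>k\<in>insert j K. A k))
        = - ((-1) ^ card K * \<psi> (U \<inter> A j \<inter> (\<Inter>k\<in>K. A k)))"
      by (simp add: Int_assoc)
  qed simp
  then show ?case
    using Cons by (simp add: sum_Pow_insert)
qed simp

section \<open>Residuals and factor length\<close>

context weak_quasi_lattice_ordered
begin

lemma P_carrier [simp]: "p \<in> P \<Longrightarrow> p \<in> carrier G"
  using subset by auto

lemma coset_mem: "r \<in> p <# P \<longleftrightarrow> (\<exists>h\<in>P. r = p \<otimes> h)"
  by (auto simp: l_coset_def)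

lemma coset_self: "p \<in> P \<Longrightarrow> p \<in> p <# P"
  unfolding coset_mem by (intro bexI[of _ \<one>]) auto

lemma coset_subset: "p \<in> P \<Longrightarrow> p <# P \<subseteq> P"
  by (auto simp: coset_mem)

lemma coset_one: "\<one> <# P = P"
  by (rule lcos_mult_one[OF subset])

lemma coset_mult: "p \<in> P \<Longrightarrow> q \<in> P \<Longrightarrow> p <# (q <# P) = (p \<otimes> q) <# P"
  by (rule lcos_m_assoc[OF subset]) auto

lemma coset_image: "p <# S = (\<otimes>) p ` S"
  by (auto simp: l_coset_def)

lemma inj_on_left_mult: "p \<in> P \<Longrightarrow> inj_on ((\<otimes>) p) P"
  by (auto simp: inj_on_def)

lemma coset_Int: "p \<in> P \<Longrightarrow> A \<subseteq> P \<Longrightarrow> B \<subseteq> P \<Longrightarrow> (p <# A) \<inter> (p <# B) = p <# (A \<inter> B)"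
  unfolding coset_image by (rule inj_on_image_Int[OF inj_on_left_mult, symmetric])

lemma mult_eq_one: 
  assumes "p \<in> P" "q \<in> P" "p \<otimes> q = \<one>"
  shows "p = \<one>"
proof -
  have "p = inv q"
    using assms inv_equality[of p q] by simp
  then have "p \<in> P \<inter> set_inv P"
    using assms by (auto simp: SET_INV_def)
  then show ?thesis
    using P_inter_inv by blast
qed

lemma coset_eq:
  assumes "p \<in> P" "q \<in> P" "p <# P = q <# P"
  shows "p = q"
proof -
  obtain h where h: "h \<in> P" "p = q \<otimes> h"
    using coset_self[OF assms(1)] assms(3) by (auto simp: coset_mem)
  obtain h' where h': "h' \<in> P" "q = p \<otimes> h'"
    using coset_self[OF assms(2)] assms(3)[symmetric] by (auto simp: coset_mem)
  have "q \<otimes> (h \<otimes> h') = q \<otimes> \<one>"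
    using h h' assms by (metis P_carrier m_assoc r_one)
  then have "h \<otimes> h' = \<one>"
    using h(1) h'(1) assms(2) by (simp del: r_one)
  then show ?thesis
    using mult_eq_one[OF h(1) h'(1)] h(2) assms(2) by simp
qed

definition generator :: "'g set \<Rightarrow> 'g" where
  "generator S = (THE r. r \<in> P \<and> S = r <# P)"

lemma generator_coset [simp]: "r \<in> P \<Longrightarrow> generator (r <# P) = r"
  unfolding generator_def by (rule the_equality) (auto intro: coset_eq[symmetric])

definition principal :: "'g set \<Rightarrow> bool" where
  "principal S \<longleftrightarrow> S = {} \<or> (\<exists>r\<in>P. S = r <# P)"

lemma principal_Int: "principal S \<Longrightarrow> p \<in> P \<Longrightarrow> principal (S \<inter> (p <# P))"
  using ex_join unfolding principal_def by (metis Int_empty_left)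

lemma principal_INT:
  assumes "finite K" "K \<subseteq> P"
  shows "principal (P \<inter> (\<Inter>k\<in>K. k <# P))"
  using assms
proof (induction K)
  case empty
  then show ?case
    using coset_one by (auto simp: principal_def)
next
  case (insert p K)
  then have "principal (P \<inter> (\<Inter>k\<in>K. k <# P) \<inter> (p <# P))"
    by (intro principal_Int) auto
  then show ?case
    by (simp add: Int_ac)
qed

lemma vee_eq:
  assumes "finite K" "K \<subseteq> P" "K \<noteq> {}"
  shows "vee G P K = (if P \<inter> (\<Inter>k\<in>K. k <# P) = {} then None else Some (generator (P \<inter> (\<Inter>k\<in>K. k <# P))))"
proof -
  have "P \<inter> (\<Inter>k\<in>K. k <# P) = (\<Inter>k\<in>K. k <# P)"
    using assms coset_subset by blast
  then show ?thesis
    by (simp add: vee_def generator_def)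
qed

text \<open>\<open>residual x p l\<close> says that \<open>l\<close> is $x^{-1}(x\vee p)$.\<close>

definition residual :: "'g \<Rightarrow> 'g \<Rightarrow> 'g \<Rightarrow> bool" where
  "residual x p l \<longleftrightarrow> l \<in> P \<and> (x <# P) \<inter> (p <# P) = (x \<otimes> l) <# P"

lemma residual_exists:
  assumes "x \<in> P" "p \<in> P" "(x <# P) \<inter> (p <# P) \<noteq> {}"
  obtains l where "residual x p l"
proof -
  obtain r where r: "r \<in> P" "(x <# P) \<inter> (p <# P) = r <# P"
    using ex_join assms by blast
  then have "r \<in> x <# P"
    using coset_self by blast
  then show ?thesis
    using r that by (auto simp: coset_mem residual_def)
qed

lemma residual_join: "residual x p l \<Longrightarrow> x \<in> P \<Longrightarrow> x \<otimes> l \<in> (x <# P) \<inter> (p <# P)"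
  using coset_self[of "x \<otimes> l"] by (auto simp: residual_def)

text \<open>
  This is $(xx')^{-1}(xx' \vee p) = x'^{-1}(x' \vee x^{-1}(x \vee p))$.
\<close>

lemma residual_mult_left:
  assumes "x \<in> P" "x' \<in> P" "p \<in> P" and l: "residual (x \<otimes> x') p l"
  obtains l' where "residual x p l'" "residual x' l' l"
proof -
  have sub: "(x \<otimes> x') <# P \<subseteq> x <# P"
    using assms by (metis coset_mult coset_subset coset_image image_mono)
  then have "(x <# P) \<inter> (p <# P) \<noteq> {}"
    using residual_join[OF l] assms by auto
  then obtain l' where l': "residual x p l'"
    using residual_exists assms by blast
  have [simp]: "l \<in> P" "l' \<in> P"
    using l l' by (auto simp: residual_def)
  have "x <# ((x' <# P) \<inter> (l' <# P)) = ((x \<otimes> x') <# P) \<inter> ((x \<otimes> l') <# P)"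
    using assms coset_subset by (subst coset_Int[symmetric]) (auto simp: coset_mult)
  also have "\<dots> = ((x \<otimes> x') <# P) \<inter> (p <# P)"
    using l' sub by (auto simp: residual_def)
  also have "\<dots> = x <# ((x' \<otimes> l) <# P)"
    using l assms by (simp add: residual_def coset_mult m_assoc)
  finally have "(x' <# P) \<inter> (l' <# P) = (x' \<otimes> l) <# P"
    unfolding coset_image using assms coset_subset
    by (subst (asm) inj_on_image_eq_iff[OF inj_on_left_mult]) (auto simp: coset_image[symmetric])
  then show ?thesis
    using that[OF l'] by (simp add: residual_def)
qed

text \<open>
  Write $x \vee p = xw = pz$. Then $x \vee pq = p(z \vee q) = pz\,l' = xw\,l'$ with
  $l' = z^{-1}(z \vee q)$.
\<close>

lemma residual_mult_right:
  assumes "x \<in> P" "p \<in> P" "q \<in> P" and l: "residual x (p \<otimes> q) l"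
  obtains w z l' where "residual x p w" "z \<in> P" "residual z q l'" "l = w \<otimes> l'"
proof -
  have sub: "(p \<otimes> q) <# P \<subseteq> p <# P"
    using assms by (metis coset_mult coset_subset coset_image image_mono)
  have xl: "x \<otimes> l \<in> (x <# P) \<inter> ((p \<otimes> q) <# P)"
    using residual_join[OF l] assms by auto
  then have "(x <# P) \<inter> (p <# P) \<noteq> {}"
    using sub by blast
  then obtain w where w: "residual x p w"
    using residual_exists assms by blast
  have [simp]: "l \<in> P" "w \<in> P"
    using l w by (auto simp: residual_def)
  have "x \<otimes> w \<in> p <# P"
    using residual_join[OF w] assms by auto
  then obtain z where z: "z \<in> P" "x \<otimes> w = p \<otimes> z"
    by (auto simp: coset_mem)
  have join: "(x <# P) \<inter> ((p \<otimes> q) <# P) = p <# ((z <# P) \<inter> (q <# P))"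
  proof -
    have "(x <# P) \<inter> ((p \<otimes> q) <# P) = ((x <# P) \<inter> (p <# P)) \<inter> ((p \<otimes> q) <# P)"
      using sub by blast
    also have "\<dots> = ((p \<otimes> z) <# P) \<inter> ((p \<otimes> q) <# P)"
      using w z by (simp add: residual_def)
    finally show ?thesis
      using assms z coset_subset by (subst coset_Int[symmetric]) (auto simp: coset_mult)
  qed
  then have "(z <# P) \<inter> (q <# P) \<noteq> {}"
    using xl by (auto simp: l_coset_def)
  then obtain l' where l': "residual z q l'"
    using residual_exists z assms by blast
  then have [simp]: "l' \<in> P"
    by (simp add: residual_def)
  have "(x \<otimes> l) <# P = (x \<otimes> (w \<otimes> l')) <# P"
    using l l' join z assms m_assoc[of x w l'] by (simp add: residual_def coset_mult m_assoc)
  then have "x \<otimes> l = x \<otimes> (w \<otimes> l')"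
    using assms by (intro coset_eq) auto
  then have "l = w \<otimes> l'"
    using assms by simp
  then show ?thesis
    using that w z(1) l' by blast
qed

lemma residual_one_left:
  assumes "p \<in> P" "residual \<one> p l"
  shows "l = p"
proof -
  have l: "l \<in> P" "P \<inter> (p <# P) = l <# P"
    using assms(2) by (auto simp: residual_def coset_one)
  moreover have "P \<inter> (p <# P) = p <# P"
    using coset_subset[OF assms(1)] by blast
  ultimately show ?thesis
    using assms(1) coset_eq by metis
qed

lemma residual_one_right:
  assumes "x \<in> P" "residual x \<one> l"
  shows "l = \<one>"
proof -
  have l: "l \<in> P" "(x <# P) \<inter> P = (x \<otimes> l) <# P"
    using assms(2) by (auto simp: residual_def coset_one)
  moreover have "(x <# P) \<inter> P = x <# P"
    using coset_subset[OF assms(1)] by blast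
  ultimately have "x = x \<otimes> l"
    using assms(1) by (intro coset_eq) auto
  then have "x \<otimes> l = x \<otimes> \<one>"
    using assms(1) by simp
  then show ?thesis
    using assms(1) l(1) by (simp del: r_one)
qed

lemma residual_self: "x \<in> P \<Longrightarrow> residual x x \<one>"
  by (simp add: residual_def)

lemma vee_residual:
  assumes "x \<in> P" "p \<in> P"
  shows "vee G P {x, p} = Some r \<longleftrightarrow> (\<exists>l. residual x p l \<and> r = x \<otimes> l)"
proof -
  have int: "P \<inter> (\<Inter>k\<in>{x, p}. k <# P) = (x <# P) \<inter> (p <# P)"
    using assms coset_subset by auto
  have vee: "vee G P {x, p} = (if (x <# P) \<inter> (p <# P) = {} then None else Some (generator ((x <# P) \<inter> (p <# P))))"
    using vee_eq[of "{x, p}"] assms unfolding int by simp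
  show ?thesis
  proof
    assume "vee G P {x, p} = Some r"
    then have r: "(x <# P) \<inter> (p <# P) \<noteq> {}" "r = generator ((x <# P) \<inter> (p <# P))"
      unfolding vee by (auto split: if_splits)
    then obtain l where "residual x p l"
      using residual_exists assms by blast
    then show "\<exists>l. residual x p l \<and> r = x \<otimes> l"
      using r assms by (auto simp: residual_def intro!: exI[of _ l])
  next
    assume "\<exists>l. residual x p l \<and> r = x \<otimes> l"
    then obtain l where l: "residual x p l" "r = x \<otimes> l"
      by blast
    then have "(x <# P) \<inter> (p <# P) \<noteq> {}" "generator ((x <# P) \<inter> (p <# P)) = r"
      using residual_join[OF l(1)] assms by (auto simp: residual_def)
    then show "vee G P {x, p} = Some r"
      by (simp add: vee)
  qed
qed

lemma atoms_P: "s \<in> atoms G P \<Longrightarrow> s \<in> P"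
  by (simp add: atoms_def)

lemma minimal_level_Suc:
  assumes "minimal_level G P n \<subseteq> P"
  shows "minimal_level G P (Suc n) = {l. \<exists>x\<in>atoms G P. \<exists>p\<in>minimal_level G P n. residual x p l}"
proof -
  have cancel: "inv x \<otimes> (x \<otimes> l) = l" if "x \<in> P" "l \<in> P" for x l
    using that by (simp add: m_assoc[symmetric])
  show ?thesis
  proof (intro equalityI subsetI)
    fix l
    assume "l \<in> minimal_level G P (Suc n)"
    then obtain x p r where r: "l = inv x \<otimes> r" "x \<in> atoms G P" "p \<in> minimal_level G P n" "vee G P {x, p} = Some r"
      by auto
    then have "x \<in> P" "p \<in> P"
      using assms atoms_P by auto
    then obtain l' where "residual x p l'" "r = x \<otimes> l'"
      using r(4) vee_residual by blast
    then show "l \<in> {l. \<exists>x\<in>atoms G P. \<exists>p\<in>minimal_level G P n. residual x p l}"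
      using r(1-3) cancel[of x l'] \<open>x \<in> P\<close> by (auto simp: residual_def)
  next
    fix l
    assume "l \<in> {l. \<exists>x\<in>atoms G P. \<exists>p\<in>minimal_level G P n. residual x p l}"
    then obtain x p where xp: "x \<in> atoms G P" "p \<in> minimal_level G P n" "residual x p l"
      by blast
    then have "x \<in> P" "p \<in> P" "l \<in> P"
      using assms atoms_P by (auto simp: residual_def)
    then have "vee G P {x, p} = Some (x \<otimes> l)" "l = inv x \<otimes> (x \<otimes> l)"
      using xp(3) vee_residual cancel by auto
    then show "l \<in> minimal_level G P (Suc n)"
      using xp(1,2) by auto
  qed
qed

lemma minimal_level_subset: "minimal_level G P n \<subseteq> P"
proof (induction n)
  case (Suc n)
  then show ?case
    unfolding minimal_level_Suc[OF Suc] by (auto simp: residual_def)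
qed (auto simp: atoms_P)

lemma minimal_set_subset: "minimal_set G P \<subseteq> P"
  using minimal_level_subset by (auto simp: minimal_set_def)

lemma atoms_minimal_set: "atoms G P \<subseteq> minimal_set G P"
  unfolding minimal_set_def by (rule order_trans[OF _ UN_upper[of 0]]) simp_all

lemma residual_atom_minimal_set:
  "x \<in> atoms G P \<Longrightarrow> p \<in> minimal_set G P \<Longrightarrow> residual x p l \<Longrightarrow> l \<in> minimal_set G P"
  unfolding minimal_set_def
  using minimal_level_Suc[OF minimal_level_subset] by (smt (verit) UN_iff UNIV_I mem_Collect_eq)

lemma one_minimal_set: "atoms G P \<noteq> {} \<Longrightarrow> \<one> \<in> minimal_set G P"
  using residual_atom_minimal_set residual_self atoms_minimal_set atoms_P by blast

end

locale noetherian_quasi_lattice_ordered = weak_quasi_lattice_ordered G P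
  for G :: "('g, 'm) monoid_scheme" (structure) and P :: "'g set" +
  assumes noetherian: "noetherian_monoid G P"
begin

lemma atom_induct [consumes 1, case_names one atom mult]:
  assumes "p \<in> P"
    and one: "Q \<one>" and atom: "\<And>s. s \<in> atoms G P \<Longrightarrow> Q s"
    and mult: "\<And>x y. x \<in> P \<Longrightarrow> y \<in> P \<Longrightarrow> Q x \<Longrightarrow> Q y \<Longrightarrow> Q (x \<otimes> y)"
  shows "Q p"
proof -
  define R where "R = {(p, q). p \<in> P \<and> q \<in> P \<and> proper_factor G P p q}"
  have "wf R"
    unfolding wf_iff_no_infinite_down_chain
  proof
    assume "\<exists>u. \<forall>i. (u (Suc i), u i) \<in> R"
    then show False
      using noetherian unfolding noetherian_monoid_def R_def by blast
  qed
  then show ?thesis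
    using assms(1)
  proof (induction p rule: wf_induct_rule)
    case (less p)
    consider "p = \<one>" | "p \<in> atoms G P" | "p \<noteq> \<one>" "p \<notin> atoms G P"
      by blast
    then show ?case
    proof cases
      case 3
      then obtain x y where xy: "x \<in> P" "x \<noteq> \<one>" "y \<in> P" "y \<noteq> \<one>" "p = x \<otimes> y"
        using less.prems by (auto simp: atoms_def)
      have "proper_factor G P x p"
        unfolding proper_factor_def using xy by (intro bexI[of _ \<one>] bexI[of _ y]) auto
      moreover have "proper_factor G P y p"
        unfolding proper_factor_def using xy by (intro bexI[of _ x] bexI[of _ \<one>]) auto
      ultimately show ?thesis
        using xy less mult by (auto simp: R_def)
    qed (use one atom in auto)
  qed
qed

text \<open>
  The minimal set is closed under residuals by atoms, and \<open>residual_mult_left\<close> composes these to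
  residuals by arbitrary elements.
\<close>

lemma residual_minimal_set:
  assumes "x \<in> P" "p \<in> minimal_set G P" "residual x p l"
  shows "l \<in> minimal_set G P"
  using assms
proof (induction x arbitrary: p l rule: atom_induct)
  case one
  then show ?case
    using residual_one_left minimal_set_subset by auto
next
  case (atom s)
  then show ?case
    using residual_atom_minimal_set by blast
next
  case (mult x y)
  then obtain l' where "residual x p l'" "residual y l' l"
    using residual_mult_left minimal_set_subset by blast
  then show ?case
    using mult by blast
qed

primrec minimal_products :: "nat \<Rightarrow> 'g set" where
  "minimal_products 0 = {\<one>}"
| "minimal_products (Suc n) = {p \<otimes> q | p q. p \<in> minimal_set G P \<and> q \<in> minimal_products n}"

lemma minimal_products_subset: "minimal_products n \<subseteq> P"
  using minimal_set_subset by (induction n) auto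

text \<open>
  The rule \<open>residual_mult_right\<close> takes residuals of a product factor by factor.
\<close>

lemma residual_minimal_products:
  "x \<in> P \<Longrightarrow> p \<in> minimal_products n \<Longrightarrow> residual x p l \<Longrightarrow> l \<in> minimal_products n"
proof (induction n arbitrary: x p l)
  case 0
  then show ?case
    using residual_one_right by auto
next
  case (Suc n)
  then obtain p' q where pq: "p = p' \<otimes> q" "p' \<in> minimal_set G P" "q \<in> minimal_products n"
    by auto
  then have "p' \<in> P" "q \<in> P"
    using minimal_set_subset minimal_products_subset by auto
  then obtain w z l' where "residual x p' w" "z \<in> P" "residual z q l'" "l = w \<otimes> l'"
    using Suc.prems pq residual_mult_right[of x p' q l] by blast
  moreover from this have "w \<in> minimal_set G P" "l' \<in> minimal_products n"
    using residual_minimal_set[of x p' w] Suc.IH[of z q l'] Suc.prems pq by auto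
  ultimately show ?case
    by auto
qed

lemma minimal_products_mult:
  "p \<in> minimal_products m \<Longrightarrow> q \<in> minimal_products n \<Longrightarrow> p \<otimes> q \<in> minimal_products (m + n)"
proof (induction m arbitrary: p)
  case 0
  then show ?case
    using subsetD[OF minimal_products_subset, of q n] by auto
next
  case (Suc m)
  then obtain a b where ab: "p = a \<otimes> b" "a \<in> minimal_set G P" "b \<in> minimal_products m"
    by auto
  then have "p \<otimes> q = a \<otimes> (b \<otimes> q)"
    using Suc.prems minimal_set_subset minimal_products_subset by (simp add: m_assoc subset_iff)
  then show ?case
    using Suc ab by auto
qed

lemma minimal_products_Suc: "\<one> \<in> minimal_set G P \<Longrightarrow> p \<in> minimal_products n \<Longrightarrow> p \<in> minimal_products (Suc n)"
  unfolding minimal_products.simps mem_Collect_eq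
  using subsetD[OF minimal_products_subset, of p n] by (intro exI[of _ \<one>] exI[of _ p]) simp

lemma minimal_products_cover: "p \<in> P \<Longrightarrow> \<exists>n. p \<in> minimal_products n"
proof (induction p rule: atom_induct)
  case one
  then show ?case
    by (auto intro: exI[of _ 0])
next
  case (atom s)
  then have "s \<in> minimal_set G P" "s \<in> P"
    using atoms_minimal_set atoms_P by auto
  then show ?case
    by (intro exI[of _ 1]) (auto intro!: exI[of _ s])
next
  case (mult x y)
  then show ?case
    using minimal_products_mult by blast
qed

text \<open>One less than the number of factors, so that the elements of the minimal set have length zero.\<close>

definition factor_length :: "'g \<Rightarrow> nat" where
  "factor_length p = (LEAST n. p \<in> minimal_products (Suc n))"

lemma factor_length_le: "p \<in> minimal_products (Suc n) \<Longrightarrow> factor_length p \<le> n"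
  unfolding factor_length_def by (rule Least_le)

lemma factor_length_products:
  assumes "\<one> \<in> minimal_set G P" "p \<in> P"
  shows "p \<in> minimal_products (Suc (factor_length p))"
proof -
  obtain n where "p \<in> minimal_products n"
    using minimal_products_cover assms by blast
  then have "p \<in> minimal_products (Suc n)"
    using minimal_products_Suc assms by blast
  then show ?thesis
    unfolding factor_length_def by (rule LeastI)
qed

lemma factor_length_residual:
  assumes "\<one> \<in> minimal_set G P" "x \<in> P" "p \<in> P" "residual x p l"
  shows "factor_length l \<le> factor_length p"
  using residual_minimal_products[OF assms(2) factor_length_products[OF assms(1,3)] assms(4)]
  by (rule factor_length_le)

lemma factor_length_zero:
  assumes "\<one> \<in> minimal_set G P" "p \<in> P" "factor_length p = 0"
  shows "p \<in> minimal_set G P"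
  using factor_length_products[OF assms(1,2)] assms(3) minimal_set_subset by auto

lemma factor_length_split:
  assumes "\<one> \<in> minimal_set G P" "p \<in> P" "0 < factor_length p"
  obtains x q where "x \<in> minimal_set G P" "x \<noteq> \<one>" "q \<in> P" "p = x \<otimes> q" "factor_length q < factor_length p"
proof -
  obtain n where n: "factor_length p = Suc n"
    using assms(3) gr0_implies_Suc by blast
  then obtain x q where xq: "x \<in> minimal_set G P" "q \<in> minimal_products (Suc n)" "p = x \<otimes> q"
    using factor_length_products[OF assms(1,2)] by auto
  have q: "q \<in> P"
    using xq minimal_products_subset by blast
  have "x \<noteq> \<one>"
    using factor_length_le[OF xq(2)] n q xq(3) by auto
  then show ?thesis
    using that[OF xq(1) _ q xq(3)] factor_length_le[OF xq(2)] n by simp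
qed

end

section \<open>Alternating sums over principal ideals\<close>

context weak_quasi_lattice_ordered
begin

definition on_ideals :: "('g \<Rightarrow> real) \<Rightarrow> 'g set \<Rightarrow> real" where
  "on_ideals g S = (if S = {} then 0 else g (generator S))"

lemma on_ideals_simps [simp]:
  "on_ideals g {} = 0" "r \<in> P \<Longrightarrow> on_ideals g (r <# P) = g r" "on_ideals g P = g \<one>"
proof -
  show "r \<in> P \<Longrightarrow> on_ideals g (r <# P) = g r" for r
    using coset_self[of r] by (auto simp: on_ideals_def)
  from this[of \<one>] show "on_ideals g P = g \<one>"
    by (simp add: coset_one)
qed (simp add: on_ideals_def)

abbreviation ideal_excl :: "('g \<Rightarrow> real) \<Rightarrow> 'g list \<Rightarrow> real" where
  "ideal_excl g js \<equiv> incl_excl (on_ideals g) P (map (\<lambda>k. k <# P) js)"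

lemma vee_cases:
  assumes "finite K" "K \<subseteq> P" "K \<noteq> {}"
  obtains "vee G P K = None" "P \<inter> (\<Inter>k\<in>K. k <# P) = {}"
  | r where "vee G P K = Some r" "r \<in> P" "P \<inter> (\<Inter>k\<in>K. k <# P) = r <# P"
proof (cases "P \<inter> (\<Inter>k\<in>K. k <# P) = {}")
  case True
  then show ?thesis
    using that(1) vee_eq[OF assms] by (simp only: if_True)
next
  case False
  then obtain r where r: "r \<in> P" "P \<inter> (\<Inter>k\<in>K. k <# P) = r <# P"
    using principal_INT[OF assms(1,2)] unfolding principal_def by metis
  then have "vee G P K = Some r"
    using vee_eq[OF assms] False by (simp only: if_False generator_coset)
  then show ?thesis
    using that(2) r by blast
qed

lemma sum_vee:
  assumes js: "distinct js" "set js \<subseteq> P"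
  shows "(\<Sum>K | K \<subseteq> set js \<and> K \<noteq> {}. case vee G P K of None \<Rightarrow> 0 | Some r \<Rightarrow> (-1) ^ card K * g r)
    = ideal_excl g js - g \<one>"
proof -
  have "ideal_excl g js = (\<Sum>K\<in>Pow (set js). (-1) ^ card K * on_ideals g (P \<inter> (\<Inter>k\<in>K. k <# P)))"
    by (rule incl_excl_subsets[OF js(1)])
  also have "Pow (set js) = insert {} {K. K \<subseteq> set js \<and> K \<noteq> {}}"
    by auto
  also have "(\<Sum>K\<in>\<dots>. (-1) ^ card K * on_ideals g (P \<inter> (\<Inter>k\<in>K. k <# P)))
    = g \<one> + (\<Sum>K | K \<subseteq> set js \<and> K \<noteq> {}. (-1) ^ card K * on_ideals g (P \<inter> (\<Inter>k\<in>K. k <# P)))"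
    by (subst sum.insert) auto
  also have "(\<Sum>K | K \<subseteq> set js \<and> K \<noteq> {}. (-1) ^ card K * on_ideals g (P \<inter> (\<Inter>k\<in>K. k <# P)))
    = (\<Sum>K | K \<subseteq> set js \<and> K \<noteq> {}. case vee G P K of None \<Rightarrow> 0 | Some r \<Rightarrow> (-1) ^ card K * g r)"
  proof (rule sum.cong)
    fix K
    assume "K \<in> {K. K \<subseteq> set js \<and> K \<noteq> {}}"
    then have K: "finite K" "K \<subseteq> P" "K \<noteq> {}"
      using js(2) finite_subset by auto
    then show "(-1) ^ card K * on_ideals g (P \<inter> (\<Inter>k\<in>K. k <# P))
        = (case vee G P K of None \<Rightarrow> 0 | Some r \<Rightarrow> (-1) ^ card K * g r)"
      by (cases rule: vee_cases) auto
  qed simp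
  finally show ?thesis
    by simp
qed

lemma vee_not_one:
  assumes "finite K" "K \<subseteq> P" "K \<noteq> {}" "\<one> \<notin> K" "vee G P K = Some r"
  shows "r \<noteq> \<one>"
  using assms(1-3)
proof (cases rule: vee_cases)
  case (2 r')
  obtain k where k: "k \<in> K" "k \<in> P"
    using assms by blast
  have "r \<in> k <# P"
    using 2 k coset_self[of r] assms(5) by auto
  then show ?thesis
    using mult_eq_one[of k] k assms(4) by (auto simp: coset_mem)
qed (use assms in simp)

lemma residual_list:
  assumes x: "x \<in> P" and "set js \<subseteq> P" and len: "\<And>p l. p \<in> P \<Longrightarrow> residual x p l \<Longrightarrow> len l \<le> (len p :: nat)"
  shows "\<exists>ls. set ls \<subseteq> P \<and> sum_list (map len ls) \<le> sum_list (map len js) \<and>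
    map (\<lambda>l. x <# (l <# P)) ls = filter (\<lambda>A. A \<noteq> {}) (map (\<lambda>k. (x <# P) \<inter> (k <# P)) js)"
  using assms(2)
proof (induction js)
  case (Cons k js)
  then obtain ls where ls: "set ls \<subseteq> P" "sum_list (map len ls) \<le> sum_list (map len js)"
    "map (\<lambda>l. x <# (l <# P)) ls = filter (\<lambda>A. A \<noteq> {}) (map (\<lambda>k. (x <# P) \<inter> (k <# P)) js)"
    by auto
  show ?case
  proof (cases "(x <# P) \<inter> (k <# P) = {}")
    case True
    then show ?thesis
      using ls by (intro exI[of _ ls]) auto
  next
    case False
    then obtain l where l: "residual x k l"
      using residual_exists[OF x _ False] Cons.prems by auto
    then have "l \<in> P" "x <# (l <# P) = (x <# P) \<inter> (k <# P)"
      using x by (auto simp: residual_def coset_mult)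
    then show ?thesis
      using ls False len[OF _ l] Cons.prems by (intro exI[of _ "l # ls"]) auto
  qed
qed simp

text \<open>
  This is the reduction of the whole argument: replacing a factor \<open>x \<otimes> q\<close> by \<open>x\<close> changes the
  sum by one over the ideal \<open>x <# P\<close>, and dividing that ideal by \<open>x\<close> gives a sum over \<open>P\<close> again.
\<close>

lemma ideal_excl_mult:
  assumes x: "x \<in> P" and q: "q \<in> P" and ls: "set ls \<subseteq> P"
    and eq: "map (\<lambda>l. x <# (l <# P)) ls = filter (\<lambda>A. A \<noteq> {}) (map (\<lambda>k. (x <# P) \<inter> (k <# P)) js)"
  shows "ideal_excl g ((x \<otimes> q) # js)
    = ideal_excl g (x # js) + incl_excl (\<lambda>S. on_ideals g (x <# S)) P (map (\<lambda>l. l <# P) (q # ls))"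
proof -
  let ?js = "map (\<lambda>k. k <# P) js" and ?ie = "incl_excl (on_ideals g)"
  have sub: "(x \<otimes> q) <# P \<subseteq> x <# P" "x <# P \<subseteq> P"
    using x q coset_subset by (metis coset_mult coset_image image_mono, metis)
  have ne: "(x \<otimes> q) <# P \<noteq> {}"
    using coset_self[of "x \<otimes> q"] x q by auto
  have "ideal_excl g ((x \<otimes> q) # js) - ideal_excl g (x # js) = ?ie (x <# P) ?js - ?ie ((x \<otimes> q) <# P) ?js"
    using sub by (simp add: Int_absorb1)
  also have "\<dots> = ?ie (x <# P) (((x \<otimes> q) <# P) # ?js)"
    using sub by (simp add: Int_absorb1)
  also have "\<dots> = ?ie (x <# P) (map (\<lambda>A. (x <# P) \<inter> A) (((x \<otimes> q) <# P) # ?js))"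
    by (rule incl_excl_restrict[symmetric]) simp
  also have "\<dots> = ?ie (x <# P) (filter (\<lambda>A. A \<noteq> {}) (map (\<lambda>A. (x <# P) \<inter> A) (((x \<otimes> q) <# P) # ?js)))"
    by (rule incl_excl_filter_nonempty[symmetric]) simp
  also have "filter (\<lambda>A. A \<noteq> {}) (map (\<lambda>A. (x <# P) \<inter> A) (((x \<otimes> q) <# P) # ?js))
      = map ((`) ((\<otimes>) x)) (map (\<lambda>l. l <# P) (q # ls))"
    using eq sub ne x q by (simp add: Int_absorb1 o_def coset_mult coset_image[symmetric])
  also have "?ie (x <# P) \<dots> = incl_excl (\<lambda>S. on_ideals g (x <# S)) P (map (\<lambda>l. l <# P) (q # ls))"
    unfolding coset_image[of x] using ls q coset_subset
    by (intro incl_excl_image[OF inj_on_left_mult[OF x]]) auto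
  finally show ?thesis
    by simp
qed

end

section \<open>Positivity of the alternating sums\<close>

locale traced_product_system =
  noetherian_quasi_lattice_ordered G P + product_system G P X mul j
  for G :: "('g, 'm) monoid_scheme" (structure) and P :: "'g set"
    and X :: "'g \<Rightarrow> ('a::cstar_algebra, 'x::complex_vector) corr"
    and mul :: "'g \<Rightarrow> 'g \<Rightarrow> 'x \<Rightarrow> 'x \<Rightarrow> 'x" and j :: "'a \<Rightarrow> 'x" +
  fixes N :: "'g \<Rightarrow> real" and \<beta> :: real and \<tau> :: "'a \<Rightarrow> complex"
  assumes N_pos: "p \<in> P \<Longrightarrow> 0 < N p"
    and N_mult: "p \<in> P \<Longrightarrow> q \<in> P \<Longrightarrow> N (p \<otimes> q) = N p * N q"
    and state: "tracial_state \<tau>"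
begin

lemma state_fibre: "p \<in> P \<Longrightarrow> state_correspondence (X p) \<tau>"
  using fibre state by (simp add: state_correspondence_def state_correspondence_axioms_def)

lemma lact_mul:
  assumes "p \<in> P" "q \<in> P" "\<xi> \<in> elems (X p)" "\<zeta> \<in> elems (X q)"
  shows "lact (X (p \<otimes> q)) a (mul p q \<xi> \<zeta>) = mul p q (lact (X p) a \<xi>) \<zeta>"
proof -
  have "j a \<in> elems (X \<one>)"
    using j_bij by (auto simp: bij_betw_def)
  then have "mul (\<one> \<otimes> p) q (mul \<one> p (j a) \<xi>) \<zeta> = mul \<one> (p \<otimes> q) (j a) (mul p q \<xi> \<zeta>)"
    using assms by (intro mul_assoc) auto
  then show ?thesis
    using assms by (simp add: mul_left mul_closed)
qed

lemma tensor_fibres: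
  assumes "p \<in> P" "q \<in> P" "p \<noteq> \<one>"
  shows "traced_tensor_product (X p) (X q) (X (p \<otimes> q)) \<tau> (mul p q)"
  using assms
  by (intro traced_tensor_product.intro traced_tensor_product_axioms.intro state_fibre mul_tensor lact_mul) auto

text \<open>
  A family in the trivial fibre is a family of elements \<open>h\<close> with $\sum hh^* \le 1$, and
  $\tau(h^*c^*ch) = \tau(chh^*c^*)$.
\<close>

lemma Tr_one_le:
  assumes a: "pos_element a"
  shows "Tr \<tau> (X \<one>) a \<le> ereal (Re (\<tau> a))"
proof (rule ccontr)
  interpret Y: state_correspondence "X \<one>" \<tau>
    by (rule state_fibre) simp
  obtain c where c: "a = star c * c"
    using a by (auto simp: pos_element_def)
  assume "\<not> Tr \<tau> (X \<one>) a \<le> ereal (Re (\<tau> a))"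
  then have "ereal (Re (\<tau> a)) < Tr \<tau> (X \<one>) a"
    by simp
  then obtain xs where xs: "Y.admissible xs" and less: "Re (\<tau> a) < Y.trace_sum xs a"
    by (rule Y.less_Tr_obtain)
  have range: "elems (X \<one>) = range j"
    using j_bij by (auto simp: bij_betw_def)
  let ?\<eta> = "j (star c)"
  have "Y.trace_sum xs a = (\<Sum>\<xi>\<leftarrow>xs. Re (\<tau> (star (ip (X \<one>) \<xi> ?\<eta>) * ip (X \<one>) \<xi> ?\<eta>)))"
    unfolding Y.trace_sum_def
  proof (intro arg_cong[where f = sum_list] map_cong refl)
    fix \<xi>
    assume "\<xi> \<in> set xs"
    then obtain h where h: "\<xi> = j h"
      using xs range by (auto simp: Y.admissible_def)
    have "Re (\<tau> ((star h * star c) * (c * h))) = Re (\<tau> ((c * h) * (star h * star c)))"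
      by (rule Y.t_commute)
    then show "Re (\<tau> (ip (X \<one>) \<xi> (lact (X \<one>) a \<xi>))) = Re (\<tau> (star (ip (X \<one>) \<xi> ?\<eta>) * ip (X \<one>) \<xi> ?\<eta>))"
      by (simp add: h c j_lact j_ip star_mult star_star mult.assoc)
  qed
  also have "\<dots> \<le> Re (\<tau> (ip (X \<one>) ?\<eta> ?\<eta>))"
    using xs range Y.t_mono by (simp add: Y.admissible_def Y.t_sum_list[symmetric])
  also have "\<dots> = Re (\<tau> a)"
    using Y.t_commute[of c "star c"] by (simp add: c j_ip star_star)
  finally show False
    using less by simp
qed

lemma alternating_sum_eq:
  assumes js: "distinct js" "set js \<subseteq> P" and T: "\<And>r. r \<in> P \<Longrightarrow> Tr \<tau> (X r) a = ereal (T r)"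
  shows "alternating_sum G P X N \<beta> \<tau> (set js) a
    = ereal (Re (\<tau> a) + (ideal_excl (\<lambda>r. N r powr - \<beta> * T r) js - N \<one> powr - \<beta> * T \<one>))"
proof -
  have "(case vee G P K of None \<Rightarrow> 0
      | Some r \<Rightarrow> ereal ((-1) ^ card K * N r powr (- \<beta>)) * Tr \<tau> (X r) a)
    = ereal (case vee G P K of None \<Rightarrow> 0 | Some r \<Rightarrow> (-1) ^ card K * (N r powr - \<beta> * T r))"
    if "K \<in> {K. K \<subseteq> set js \<and> K \<noteq> {}}" for K
  proof -
    have K: "finite K" "K \<subseteq> P" "K \<noteq> {}"
      using that js(2) finite_subset by auto
    then show ?thesis
      by (cases rule: vee_cases) (auto simp: T)
  qed
  then have "(\<Sum>K | K \<subseteq> set js \<and> K \<noteq> {}. case vee G P K of None \<Rightarrow> 0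
      | Some r \<Rightarrow> ereal ((-1) ^ card K * N r powr (- \<beta>)) * Tr \<tau> (X r) a)
    = ereal (\<Sum>K | K \<subseteq> set js \<and> K \<noteq> {}. case vee G P K of None \<Rightarrow> 0
      | Some r \<Rightarrow> (-1) ^ card K * (N r powr - \<beta> * T r))"
    unfolding sum_ereal[symmetric] by (intro sum.cong refl)
  then show ?thesis
    unfolding alternating_sum_def sum_vee[OF js] by simp
qed

lemma N_one: "N \<one> = 1"
  using N_mult[of \<one> \<one>] N_pos[of \<one>] by simp

lemma Tr_le_of_singleton:
  assumes "p \<in> P" and nonneg: "0 \<le> alternating_sum G P X N \<beta> \<tau> {p} a"
  shows "Tr \<tau> (X p) a \<le> ereal (N p powr \<beta> * Re (\<tau> a))"
proof -
  interpret Y: state_correspondence "X p" \<tau>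
    using assms by (intro state_fibre)
  have "P \<inter> (\<Inter>k\<in>{p}. k <# P) = p <# P"
    using coset_subset assms by auto
  then have vee: "vee G P {p} = Some p"
    using vee_eq[of "{p}"] coset_self[of p] assms by auto
  have "{K. K \<subseteq> {p} \<and> K \<noteq> {}} = {{p}}"
    by auto
  then have sum: "0 \<le> ereal (Re (\<tau> a)) + ereal (- (N p powr - \<beta>)) * Tr \<tau> (X p) a"
    using nonneg by (simp add: alternating_sum_def vee)
  have N: "0 < N p powr - \<beta>"
    using N_pos[OF assms(1)] by simp
  show ?thesis
  proof (cases "Tr \<tau> (X p) a")
    case (real T)
    then have "N p powr - \<beta> * T \<le> Re (\<tau> a)"
      using sum by simp
    then have "N p powr \<beta> * (N p powr - \<beta> * T) \<le> N p powr \<beta> * Re (\<tau> a)"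
      by (rule mult_left_mono) simp
    also have "N p powr \<beta> * (N p powr - \<beta> * T) = T"
      using N_pos[OF assms(1)] by (simp add: mult.assoc[symmetric] powr_add[symmetric])
    finally show ?thesis
      using real by simp
  next
    case PInf
    then show ?thesis
      using sum N by simp
  next
    case MInf
    then show ?thesis
      by simp
  qed
qed

text \<open>
  The value at the unit is the trace itself rather than the induced trace of the trivial fibre. The
  term of the empty set then fits into one function on principal ideals, and a sum over a set that
  contains the unit vanishes identically.
\<close>

definition weight :: "'a \<Rightarrow> 'g \<Rightarrow> real" where
  "weight a r = (if r = \<one> then Re (\<tau> a) else N r powr - \<beta> * real_of_ereal (Tr \<tau> (X r) a))"

context
  assumes bounded: "\<And>r. r \<in> P \<Longrightarrow> \<exists>C\<ge>0. \<forall>b. pos_element b \<longrightarrow> Tr \<tau> (X r) b \<le> ereal (C * Re (\<tau> b))"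
begin

lemma Tr_finite:
  assumes "r \<in> P" "pos_element b"
  shows "Tr \<tau> (X r) b \<noteq> \<infinity>" "ereal (real_of_ereal (Tr \<tau> (X r) b)) = Tr \<tau> (X r) b"
proof -
  interpret Y: state_correspondence "X r" \<tau>
    using assms by (intro state_fibre)
  show fin: "Tr \<tau> (X r) b \<noteq> \<infinity>"
    using bounded[OF assms(1)] assms(2) by fastforce
  then show "ereal (real_of_ereal (Tr \<tau> (X r) b)) = Tr \<tau> (X r) b"
    using Y.Tr_nonneg[of b] by (auto simp: ereal_real)
qed

text \<open>
  Multiplicativity of \<open>N\<close> turns transitivity of induction into a statement on weights. For
  \<open>r = \<one>\<close> the fibre \<open>X x\<close> alone is involved.
\<close>

lemma weight_eventually:
  assumes x: "x \<in> P" "x \<noteq> \<one>" and r: "r \<in> P" and a: "pos_element a" and "0 < \<epsilon>"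
  shows "\<exists>F \<delta>. set F \<subseteq> elems (X x) \<and> 0 < \<delta> \<and>
    (\<forall>xs. hilbert_module.admissible (X x) xs \<longrightarrow> hilbert_module.almost_fixes (X x) xs F \<delta> \<longrightarrow>
      \<bar>N x powr - \<beta> * (\<Sum>\<xi>\<leftarrow>xs. weight (ip (X x) \<xi> (lact (X x) a \<xi>)) r) - weight a (x \<otimes> r)\<bar> \<le> \<epsilon>)"
proof -
  interpret Y: state_correspondence "X x" \<tau>
    using x by (intro state_fibre)
  have "x \<otimes> r \<in> P" "x \<otimes> r \<noteq> \<one>"
    using x r mult_eq_one[of x r] by auto
  define T where "T = real_of_ereal (Tr \<tau> (X (x \<otimes> r)) a)"
  define c where "c = N (x \<otimes> r) powr - \<beta>"
  have "0 < c"
    using N_pos[OF \<open>x \<otimes> r \<in> P\<close>] by (simp add: c_def)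
  have T: "Tr \<tau> (X (x \<otimes> r)) a = ereal T"
    using Tr_finite[OF \<open>x \<otimes> r \<in> P\<close> a] by (simp add: T_def)
  have weight_T: "weight a (x \<otimes> r) = c * T"
    using \<open>x \<otimes> r \<noteq> \<one>\<close> by (simp add: weight_def c_def T_def)
  have B: "ereal (T - \<epsilon> / c) < Tr \<tau> (X (x \<otimes> r)) a"
    using \<open>0 < c\<close> \<open>0 < \<epsilon>\<close> by (simp add: T)
  have close: "\<bar>c * s - c * T\<bar> \<le> \<epsilon>" if "T - \<epsilon> / c < s" "s \<le> T" for s
  proof -
    have "c * (T - \<epsilon> / c) \<le> c * s" "c * s \<le> c * T"
      using that \<open>0 < c\<close> by (auto intro!: mult_left_mono)
    then show ?thesis
      using \<open>0 < c\<close> \<open>0 < \<epsilon>\<close> by (simp add: right_diff_distrib abs_le_iff)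
  qed
  show ?thesis
  proof (cases "r = \<one>")
    case True
    then have xr: "x \<otimes> r = x"
      using x by simp
    obtain ms where ms: "Y.admissible ms" "T - \<epsilon> / c < Y.trace_sum ms a"
      using Y.less_Tr_obtain B unfolding xr by blast
    obtain F \<delta> where F: "set F \<subseteq> elems (X x)" "0 < \<delta>"
      "\<And>ns. Y.almost_fixes ns F \<delta> \<Longrightarrow> T - \<epsilon> / c < Y.trace_sum ns a"
      using Y.trace_sum_eventually[OF a ms] by metis
    have "\<bar>N x powr - \<beta> * (\<Sum>\<xi>\<leftarrow>xs. weight (ip (X x) \<xi> (lact (X x) a \<xi>)) r) - weight a (x \<otimes> r)\<bar> \<le> \<epsilon>"
      if "Y.admissible xs" "Y.almost_fixes xs F \<delta>" for xs
    proof -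
      have "N x powr - \<beta> * (\<Sum>\<xi>\<leftarrow>xs. weight (ip (X x) \<xi> (lact (X x) a \<xi>)) r) = c * Y.trace_sum xs a"
        using True xr by (simp add: weight_def Y.trace_sum_def c_def)
      moreover have "Y.trace_sum xs a \<le> T"
        using Y.trace_sum_le_Tr[OF that(1), of a] T xr by simp
      ultimately show ?thesis
        using close F(3)[OF that(2)] by (simp add: weight_T)
    qed
    then show ?thesis
      using F(1,2) by blast
  next
    case False
    interpret tensor: traced_tensor_product "X x" "X r" "X (x \<otimes> r)" \<tau> "mul x r"
      using x r by (intro tensor_fibres)
    have fin: "Tr \<tau> (X r) b \<noteq> \<infinity>" if "pos_element b" for b
      using Tr_finite[OF r that] by simp
    obtain F \<delta> where F: "set F \<subseteq> elems (X x)" "0 < \<delta>"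
      "\<And>xs. Y.admissible xs \<Longrightarrow> Y.almost_fixes xs F \<delta> \<Longrightarrow>
        T - \<epsilon> / c < (\<Sum>\<xi>\<leftarrow>xs. tensor.tr (ip (X x) \<xi> (lact (X x) a \<xi>)))"
      using tensor.less_Tr_eventually[OF fin a B] by metis
    have "\<bar>N x powr - \<beta> * (\<Sum>\<xi>\<leftarrow>xs. weight (ip (X x) \<xi> (lact (X x) a \<xi>)) r) - weight a (x \<otimes> r)\<bar> \<le> \<epsilon>"
      if "Y.admissible xs" "Y.almost_fixes xs F \<delta>" for xs
    proof -
      let ?s = "\<Sum>\<xi>\<leftarrow>xs. tensor.tr (ip (X x) \<xi> (lact (X x) a \<xi>))"
      have "N x powr - \<beta> * (\<Sum>\<xi>\<leftarrow>xs. weight (ip (X x) \<xi> (lact (X x) a \<xi>)) r)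
          = N x powr - \<beta> * (N r powr - \<beta> * ?s)"
        using False by (simp add: weight_def tensor.tr_def sum_list_const_mult)
      also have "\<dots> = c * ?s"
        using N_pos[OF x(1)] N_pos[OF r] by (simp add: c_def N_mult x r powr_mult)
      finally have "N x powr - \<beta> * (\<Sum>\<xi>\<leftarrow>xs. weight (ip (X x) \<xi> (lact (X x) a \<xi>)) r) = c * ?s" .
      moreover have "?s \<le> T"
        using tensor.sum_tr_le_Tr[OF fin a that(1)] T by simp
      ultimately show ?thesis
        using close F(3)[OF that] by (simp add: weight_T)
    qed
    then show ?thesis
      using F(1,2) by blast
  qed
qed

text \<open>
  One family for all \<open>r\<close>: join the lists of vectors to be fixed and take the smaller tolerance.
\<close>

lemma weight_eventually_finite:
  assumes x: "x \<in> P" "x \<noteq> \<one>" and "finite R" "R \<subseteq> P" and a: "pos_element a" and "0 < \<epsilon>"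
  shows "\<exists>F \<delta>. set F \<subseteq> elems (X x) \<and> 0 < \<delta> \<and>
    (\<forall>xs. hilbert_module.admissible (X x) xs \<longrightarrow> hilbert_module.almost_fixes (X x) xs F \<delta> \<longrightarrow>
      (\<forall>r\<in>R. \<bar>N x powr - \<beta> * (\<Sum>\<xi>\<leftarrow>xs. weight (ip (X x) \<xi> (lact (X x) a \<xi>)) r) - weight a (x \<otimes> r)\<bar> \<le> \<epsilon>))"
  using \<open>finite R\<close> \<open>R \<subseteq> P\<close>
proof (induction R)
  case empty
  show ?case
    by (intro exI[of _ "[]"] exI[of _ 1]) auto
next
  case (insert r R)
  interpret Y: state_correspondence "X x" \<tau>
    using x by (intro state_fibre)
  let ?Q = "\<lambda>xs r. \<bar>N x powr - \<beta> * (\<Sum>\<xi>\<leftarrow>xs. weight (ip (X x) \<xi> (lact (X x) a \<xi>)) r) - weight a (x \<otimes> r)\<bar> \<le> \<epsilon>"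
  obtain F \<delta> where F: "set F \<subseteq> elems (X x)" "0 < \<delta>"
    "\<And>xs. Y.admissible xs \<Longrightarrow> Y.almost_fixes xs F \<delta> \<Longrightarrow> \<forall>r\<in>R. ?Q xs r"
    using insert by blast
  obtain F' \<delta>' where F': "set F' \<subseteq> elems (X x)" "0 < \<delta>'"
    "\<And>xs. Y.admissible xs \<Longrightarrow> Y.almost_fixes xs F' \<delta>' \<Longrightarrow> ?Q xs r"
    using weight_eventually[OF x _ a \<open>0 < \<epsilon>\<close>, of r] insert.prems by blast
  have "Y.almost_fixes xs F \<delta>" "Y.almost_fixes xs F' \<delta>'" if "Y.almost_fixes xs (F @ F') (min \<delta> \<delta>')" for xs
    using that by (auto simp: Y.almost_fixes_def)
  then show ?case
    using F F' by (intro exI[of _ "F @ F'"] exI[of _ "min \<delta> \<delta>'"]) auto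
qed

text \<open>
  Inducing through a fibre preserves positivity: up to an arbitrarily small error the induced sum is
  a positive combination of the original sums at the positive elements \<open>\<langle>\<xi>, a \<xi>\<rangle>\<close>, where one
  approximate unit of the fibre serves all the finitely many ideals that occur.
\<close>

lemma induced_incl_excl_nonneg:
  assumes x: "x \<in> P" "x \<noteq> \<one>" and a: "pos_element a" and ls: "set ls \<subseteq> P"
    and nonneg: "\<And>b. pos_element b \<Longrightarrow> 0 \<le> ideal_excl (weight b) ls"
  shows "0 \<le> incl_excl (\<lambda>S. on_ideals (weight a) (x <# S)) P (map (\<lambda>l. l <# P) ls)"
proof (rule field_le_epsilon)
  fix e :: real
  assume "0 < e"
  interpret Y: state_correspondence "X x" \<tau>
    using x by (intro state_fibre)
  let ?As = "map (\<lambda>l. l <# P) ls"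
  define \<epsilon> where "\<epsilon> = e / 2 ^ length ?As"
  have "0 < \<epsilon>"
    using \<open>0 < e\<close> by (simp add: \<epsilon>_def)
  \<comment> \<open>The ideals at which the two sums are evaluated.\<close>
  define \<S> where "\<S> = (\<lambda>K. P \<inter> (\<Inter>k\<in>K. k <# P)) ` Pow (set ls)"
  have "finite \<S>"
    by (simp add: \<S>_def)
  have \<S>: "S = {} \<or> generator S \<in> P \<and> S = generator S <# P" if S: "S \<in> \<S>" for S
  proof -
    have "principal S"
      using S ls finite_subset[of _ "set ls"] unfolding \<S>_def
      by (auto intro!: principal_INT)
    then show ?thesis
      by (auto simp: principal_def)
  qed
  define R where "R = generator ` (\<S> - {{}})"
  have R: "finite R" "R \<subseteq> P"
    using \<open>finite \<S>\<close> \<S> by (auto simp: R_def)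
  obtain F \<delta> where F: "set F \<subseteq> elems (X x)" "0 < \<delta>"
    "\<And>xs. Y.admissible xs \<Longrightarrow> Y.almost_fixes xs F \<delta> \<Longrightarrow>
      \<forall>r\<in>R. \<bar>N x powr - \<beta> * (\<Sum>\<xi>\<leftarrow>xs. weight (ip (X x) \<xi> (lact (X x) a \<xi>)) r) - weight a (x \<otimes> r)\<bar> \<le> \<epsilon>"
    using weight_eventually_finite[OF x R a \<open>0 < \<epsilon>\<close>] by blast
  obtain xs where xs: "Y.admissible xs" "Y.almost_fixes xs F \<delta>"
    using Y.approximate_unit[OF F(1,2)] .
  let ?b = "\<lambda>\<xi>. ip (X x) \<xi> (lact (X x) a \<xi>)"
  let ?\<psi> = "\<lambda>S. N x powr - \<beta> * (\<Sum>\<xi>\<leftarrow>xs. on_ideals (weight (?b \<xi>)) S)"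
  let ?\<phi> = "\<lambda>S. on_ideals (weight a) (x <# S)"
  have "\<bar>incl_excl ?\<psi> P ?As - incl_excl ?\<phi> P ?As\<bar> \<le> 2 ^ length ?As * \<epsilon>"
  proof (rule incl_excl_close)
    show "P \<in> \<S>"
      unfolding \<S>_def by (rule image_eqI[of _ _ "{}"]) auto
    show "U \<inter> A \<in> \<S>" if U: "U \<in> \<S>" and A: "A \<in> set ?As" for U A
    proof -
      obtain K l where "K \<subseteq> set ls" "U = P \<inter> (\<Inter>k\<in>K. k <# P)" "l \<in> set ls" "A = l <# P"
        using U A by (auto simp: \<S>_def)
      then show ?thesis
        unfolding \<S>_def by (intro image_eqI[of _ _ "insert l K"]) auto
    qed
    show "\<bar>?\<psi> S - ?\<phi> S\<bar> \<le> \<epsilon>" if S: "S \<in> \<S>" for S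
    proof (cases "S = {}")
      case True
      then show ?thesis
        using \<open>0 < \<epsilon>\<close> by (simp add: coset_image sum_list_0)
    next
      case False
      then obtain r where r: "r \<in> R" "r \<in> P" "S = r <# P"
        using \<S>[OF S] S by (auto simp: R_def)
      then show ?thesis
        using F(3)[OF xs] x by (simp add: coset_mult)
    qed
  qed
  moreover have "0 \<le> incl_excl ?\<psi> P ?As"
    unfolding incl_excl_scaled_sum using xs a
    by (intro mult_nonneg_nonneg sum_list_nonneg) (auto intro!: nonneg Y.pos_ip_lact simp: Y.admissible_def)
  moreover have "2 ^ length ?As * \<epsilon> = e"
    by (simp add: \<epsilon>_def)
  ultimately show "0 \<le> incl_excl ?\<phi> P ?As + e"
    by linarith
qed

text \<open>
  Induction on the total length of \<open>js\<close>. A member of positive length is split as \<open>x \<otimes> q\<close> with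
  \<open>x\<close> in the minimal set, hence of length \<open>0\<close>, and \<open>q\<close> shorter; \<open>ideal_excl_mult\<close> then leaves the
  lists \<open>x # us @ vs\<close> and \<open>q # ls\<close>, both of smaller total length since residuals are not longer.
\<close>

theorem ideal_excl_nonneg:
  assumes one: "\<one> \<in> minimal_set G P"
    and minimal: "\<And>js a. set js \<subseteq> minimal_set G P \<Longrightarrow> pos_element a \<Longrightarrow> 0 \<le> ideal_excl (weight a) js"
  shows "set js \<subseteq> P \<Longrightarrow> pos_element a \<Longrightarrow> 0 \<le> ideal_excl (weight a) js"
proof (induction "sum_list (map factor_length js)" arbitrary: js a rule: less_induct)
  case less
  show ?case
  proof (cases "\<exists>p\<in>set js. 0 < factor_length p")
    case False
    then have "set js \<subseteq> minimal_set G P"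
      using factor_length_zero[OF one] less.prems by auto
    then show ?thesis
      using minimal less.prems by blast
  next
    case True
    then obtain p us vs where p: "0 < factor_length p" and js: "js = us @ p # vs"
      by (metis split_list)
    have sub: "set (us @ vs) \<subseteq> P" "p \<in> P"
      using less.prems js by auto
    obtain x q where xq: "x \<in> minimal_set G P" "x \<noteq> \<one>" "q \<in> P" "p = x \<otimes> q" "factor_length q < factor_length p"
      using factor_length_split[OF one sub(2) p] .
    have x: "x \<in> P"
      using xq(1) minimal_set_subset by auto
    have "x \<in> minimal_products (Suc 0)"
      using xq(1) x by (auto intro!: exI[of _ x])
    then have "factor_length x = 0"
      using factor_length_le by blast
    obtain ls where ls: "set ls \<subseteq> P"
      "sum_list (map factor_length ls) \<le> sum_list (map factor_length (us @ vs))"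
      "map (\<lambda>l. x <# (l <# P)) ls = filter (\<lambda>A. A \<noteq> {}) (map (\<lambda>k. (x <# P) \<inter> (k <# P)) (us @ vs))"
      using residual_list[OF x sub(1), of factor_length] factor_length_residual[OF one x] by blast
    have "ideal_excl (weight a) js = ideal_excl (weight a) ((x \<otimes> q) # us @ vs)"
      using xq(4) js by (simp only: map_append list.map incl_excl_middle)
    also have "\<dots> = ideal_excl (weight a) (x # us @ vs)
        + incl_excl (\<lambda>S. on_ideals (weight a) (x <# S)) P (map (\<lambda>l. l <# P) (q # ls))"
      by (rule ideal_excl_mult[OF x xq(3) ls(1,3)])
    also have "0 \<le> \<dots>"
    proof (rule add_nonneg_nonneg)
      show "0 \<le> ideal_excl (weight a) (x # us @ vs)"
        using less.prems sub x p js \<open>factor_length x = 0\<close> by (intro less.hyps) auto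
      show "0 \<le> incl_excl (\<lambda>S. on_ideals (weight a) (x <# S)) P (map (\<lambda>l. l <# P) (q # ls))"
      proof (rule induced_incl_excl_nonneg[OF x xq(2) less.prems(2)])
        show "0 \<le> ideal_excl (weight b) (q # ls)" if "pos_element b" for b
          using that ls xq js by (intro less.hyps) auto
      qed (use ls xq in auto)
    qed
    finally show ?thesis .
  qed
qed

lemma alternating_sum_weight:
  assumes js: "distinct js" "set js \<subseteq> P - {\<one>}" and a: "pos_element a"
  shows "alternating_sum G P X N \<beta> \<tau> (set js) a = ereal (ideal_excl (weight a) js)"
proof -
  let ?g = "\<lambda>r. N r powr - \<beta> * real_of_ereal (Tr \<tau> (X r) a)"
  have sub: "set js \<subseteq> P"
    using js by auto
  have "(\<Sum>K | K \<subseteq> set js \<and> K \<noteq> {}. case vee G P K of None \<Rightarrow> 0 | Some r \<Rightarrow> (-1) ^ card K * ?g r)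
    = (\<Sum>K | K \<subseteq> set js \<and> K \<noteq> {}. case vee G P K of None \<Rightarrow> 0 | Some r \<Rightarrow> (-1) ^ card K * weight a r)"
  proof (rule sum.cong)
    fix K
    assume "K \<in> {K. K \<subseteq> set js \<and> K \<noteq> {}}"
    then have "finite K" "K \<subseteq> P" "K \<noteq> {}" "\<one> \<notin> K"
      using js finite_subset by auto
    then show "(case vee G P K of None \<Rightarrow> 0 | Some r \<Rightarrow> (-1) ^ card K * ?g r)
        = (case vee G P K of None \<Rightarrow> 0 | Some r \<Rightarrow> (-1) ^ card K * weight a r)"
      using vee_not_one[of K] by (auto simp: weight_def split: option.split)
  qed simp
  then have "ideal_excl ?g js - ?g \<one> = ideal_excl (weight a) js - weight a \<one>"
    unfolding sum_vee[OF js(1) sub] .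
  then show ?thesis
    using alternating_sum_eq[OF js(1) sub, of a "\<lambda>r. real_of_ereal (Tr \<tau> (X r) a)"] Tr_finite(2)[OF _ a]
    by (simp add: weight_def)
qed

end

text \<open>
  Singletons bound the induced traces for the minimal set, and the bounds multiply along products.
\<close>

lemma bounded_of_minimal_set:
  assumes one: "\<one> \<in> minimal_set G P"
    and nonneg: "\<And>J a. finite J \<Longrightarrow> J \<subseteq> minimal_set G P \<Longrightarrow> pos_element a \<Longrightarrow>
      0 \<le> alternating_sum G P X N \<beta> \<tau> J a"
    and "r \<in> P"
  shows "\<exists>C\<ge>0. \<forall>b. pos_element b \<longrightarrow> Tr \<tau> (X r) b \<le> ereal (C * Re (\<tau> b))"
proof -
  have minimal: "\<exists>C\<ge>0. \<forall>b. pos_element b \<longrightarrow> Tr \<tau> (X p) b \<le> ereal (C * Re (\<tau> b))"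
    if "p \<in> minimal_set G P" for p
    using that minimal_set_subset nonneg[of "{p}"]
    by (intro exI[of _ "N p powr \<beta>"]) (auto intro!: Tr_le_of_singleton)
  show ?thesis
    using \<open>r \<in> P\<close>
  proof (induction r rule: atom_induct)
    case one
    then show ?case
      using minimal assms(1) by blast
  next
    case (atom s)
    then show ?case
      using minimal atoms_minimal_set by blast
  next
    case (mult x y)
    show ?case
    proof (cases "x = \<one>")
      case True
      then show ?thesis
        using mult by simp
    next
      case False
      obtain C where C: "\<And>b. pos_element b \<Longrightarrow> Tr \<tau> (X x) b \<le> ereal (C * Re (\<tau> b))" "0 \<le> C"
        using mult by blast
      obtain D where D: "\<And>b. pos_element b \<Longrightarrow> Tr \<tau> (X y) b \<le> ereal (D * Re (\<tau> b))" "0 \<le> D"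
        using mult by blast
      interpret tensor: traced_tensor_product "X x" "X y" "X (x \<otimes> y)" \<tau> "mul x y"
        using mult False by (intro tensor_fibres)
      show ?thesis
        using tensor.Tr_tensor_bound[OF C(1) D] C(2) D(2) by (intro exI[of _ "D * C"]) auto
    qed
  qed
qed

lemma no_atoms:
  assumes "atoms G P = {}"
  shows "P = {\<one>}" "minimal_set G P = {}"
proof -
  have "p = \<one>" if "p \<in> P" for p
    using that by (induction p rule: atom_induct) (simp_all add: assms)
  then show "P = {\<one>}"
    by auto
  have "minimal_level G P n = {}" for n
    by (cases n) (simp_all add: assms)
  then show "minimal_set G P = {}"
    by (simp add: minimal_set_def)
qed

theorem nonneg_of_minimal_set:
  assumes nonneg: "\<And>J a. finite J \<Longrightarrow> J \<subseteq> minimal_set G P \<Longrightarrow> pos_element a \<Longrightarrow>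
      0 \<le> alternating_sum G P X N \<beta> \<tau> J a"
    and J: "finite J" "J \<subseteq> P - {\<one>}" and a: "pos_element a"
  shows "0 \<le> alternating_sum G P X N \<beta> \<tau> J a"
proof (cases "atoms G P = {}")
  case True
  then show ?thesis
    using no_atoms J a nonneg[of J a] by auto
next
  case False
  then have one: "\<one> \<in> minimal_set G P"
    by (rule one_minimal_set)
  note bounded = bounded_of_minimal_set[OF one nonneg]
  have minimal: "0 \<le> ideal_excl (weight b) js" if js: "set js \<subseteq> minimal_set G P" and b: "pos_element b" for js b
  proof (cases "\<one> \<in> set js")
    case True
    then have "ideal_excl (weight b) js = 0"
      by (intro incl_excl_superset[of P]) (auto intro!: image_eqI[of _ _ \<one>] simp: coset_one)
    then show ?thesis
      by simp
  next
    case False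
    have "0 \<le> alternating_sum G P X N \<beta> \<tau> (set (remdups js)) b"
      using js b by (intro nonneg) auto
    also have "\<dots> = ereal (ideal_excl (weight b) (remdups js))"
      using js b False minimal_set_subset by (intro alternating_sum_weight[OF bounded]) auto
    finally show ?thesis
      by (simp add: incl_excl_remdups)
  qed
  obtain js where js: "set js = J" "distinct js"
    using finite_distinct_list[OF J(1)] by blast
  have "0 \<le> ideal_excl (weight a) js"
    using js(1) J(2) a by (intro ideal_excl_nonneg[OF bounded one minimal]) auto
  then show ?thesis
    using alternating_sum_weight[OF bounded js(2)] js(1) J a by simp
qed

text \<open>
  If \<open>J\<close> contains the unit, all terms except those of the empty set and of \<open>{\<one>}\<close> cancel.
\<close>

theorem nonneg_on_minimal_set:
  assumes nonneg: "\<And>J a. finite J \<Longrightarrow> J \<subseteq> P - {\<one>} \<Longrightarrow> pos_element a \<Longrightarrow>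
      0 \<le> alternating_sum G P X N \<beta> \<tau> J a"
    and J: "finite J" "J \<subseteq> minimal_set G P" and a: "pos_element a"
  shows "0 \<le> alternating_sum G P X N \<beta> \<tau> J a"
proof (cases "\<one> \<in> J")
  case False
  then show ?thesis
    using J a minimal_set_subset by (intro nonneg) auto
next
  case True
  define T where "T r = real_of_ereal (Tr \<tau> (X r) a)" for r
  have T: "Tr \<tau> (X r) a = ereal (T r)" if "r \<in> P" for r
  proof -
    interpret Y: state_correspondence "X r" \<tau>
      using that by (rule state_fibre)
    have "Tr \<tau> (X r) a \<noteq> \<infinity>"
    proof (cases "r = \<one>")
      case True
      then show ?thesis
        using Tr_one_le[OF a] by auto
    next
      case False
      then show ?thesis
        using Tr_le_of_singleton[OF that nonneg[of "{r}" a]] that a by auto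
    qed
    then show ?thesis
      using Y.Tr_nonneg[of a] by (auto simp: T_def ereal_real)
  qed
  obtain js where js: "set js = J" "distinct js"
    using finite_distinct_list[OF J(1)] by blast
  have "ideal_excl (\<lambda>r. N r powr - \<beta> * T r) js = 0"
    using True js by (intro incl_excl_superset[of P]) (auto intro!: image_eqI[of _ _ \<one>] simp: coset_one)
  then have "alternating_sum G P X N \<beta> \<tau> J a = ereal (Re (\<tau> a) - T \<one>)"
    using alternating_sum_eq[OF js(2), of a T] T js(1) J minimal_set_subset by (simp add: N_one)
  moreover have "T \<one> \<le> Re (\<tau> a)"
    using Tr_one_le[OF a] T[of \<one>] by simp
  ultimately show ?thesis
    by simp
qed

end

theorem theorem5p5:
  fixes G :: "('g, 'm) monoid_scheme" and P :: "'g set"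
    and X :: "'g \<Rightarrow> ('a::cstar_algebra, 'x::complex_vector) corr"
    and mul :: "'g \<Rightarrow> 'g \<Rightarrow> 'x \<Rightarrow> 'x \<Rightarrow> 'x" and j :: "'a \<Rightarrow> 'x"
    and N :: "'g \<Rightarrow> real" and \<beta> :: real and \<tau> :: "'a \<Rightarrow> complex"
  assumes "weak_quasi_lattice_ordered G P"
    and "noetherian_monoid G P"
    and "product_system G P X mul j"
    and "\<And>p. p \<in> P \<Longrightarrow> essential_correspondence (X p)"
    and "compactly_aligned G P X mul"
    and "\<And>p. p \<in> P \<Longrightarrow> 0 < N p"
    and "\<And>p q. p \<in> P \<Longrightarrow> q \<in> P \<Longrightarrow> N (p \<otimes>\<^bsub>G\<^esub> q) = N p * N q"
    and "tracial_state \<tau>"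
  shows "(\<forall>J a. finite J \<and> J \<subseteq> P - {\<one>\<^bsub>G\<^esub>} \<and> pos_element a \<longrightarrow>
            0 \<le> alternating_sum G P X N \<beta> \<tau> J a) \<longleftrightarrow>
         (\<forall>J a. finite J \<and> J \<subseteq> minimal_set G P \<and> pos_element a \<longrightarrow>
            0 \<le> alternating_sum G P X N \<beta> \<tau> J a)"
proof -
  interpret traced_product_system G P X mul j N \<beta> \<tau>
    using assms
    by (intro traced_product_system.intro noetherian_quasi_lattice_ordered.intro
        noetherian_quasi_lattice_ordered_axioms.intro traced_product_system_axioms.intro)
  show ?thesis
  proof (intro iffI allI impI; elim conjE)
    fix J and a :: 'a
    assume "\<forall>J (a :: 'a). finite J \<and> J \<subseteq> P - {\<one>\<^bsub>G\<^esub>} \<and> pos_element a \<longrightarrow>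
      0 \<le> alternating_sum G P X N \<beta> \<tau> J a"
      and "finite J" "J \<subseteq> minimal_set G P" "pos_element a"
    then show "0 \<le> alternating_sum G P X N \<beta> \<tau> J a"
      by (intro nonneg_on_minimal_set[of J a]) simp_all
  next
    fix J and a :: 'a
    assume "\<forall>J (a :: 'a). finite J \<and> J \<subseteq> minimal_set G P \<and> pos_element a \<longrightarrow>
      0 \<le> alternating_sum G P X N \<beta> \<tau> J a"
      and "finite J" "J \<subseteq> P - {\<one>\<^bsub>G\<^esub>}" "pos_element a"
    then show "0 \<le> alternating_sum G P X N \<beta> \<tau> J a"
      by (intro nonneg_of_minimal_set[of J a]) simp_all
  qed
qed

end
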